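(* Let $N\ge 2$ and let $q(t)=(q_i(t))_{i\in\mathbf N}$ be a planar collision-free periodic solution of the $N$-body problem with masses $m_1,\dots,m_N>0$. Let an energy constant $h>0$ and asymptotic directions $\theta_+,\theta_-\in[0,2\pi)$ be given arbitrarily. Then for any $x\in\mathbb C$ and $t_x\in\mathbb R$ there are hyperbolic solutions $\gamma^{+}:[t_x,+\infty)\to\mathbb C$ and $\gamma^-:(-\infty,t_x]\to\mathbb C$ of the restricted equation $$\ddot z(t)=-\sum_{i\in\mathbf N}\frac{m_i\,(z(t)-q_i(t))}{|z(t)-q_i(t)|^3}$$ satisfying $\gamma^{\pm}(t_x)=x$ and $$\lim_{t\to\pm\infty}\frac{\gamma^{\pm}(t)}{|\gamma^{\pm}(t)|}=e^{i\theta_{\pm}},\qquad \lim_{t\to\pm\infty}\dot\gamma^{\pm}(t)=\pm\sqrt{2h}\,e^{i\theta_{\pm}}.$$ Moreover $\gamma^{\pm}(t)$ is collision-free whenever $t\neq t_x$, i.e. $\gamma^{\pm}(t)\ne q_i(t)$ for all $i\in\mathbf N$ and all $t\ne t_x$ in the domain of $\gamma^\pm$.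
   Context: $\mathbf N=\{1,\dots,N\}$ and $\mathbb R^2$ is identified with $\mathbb C$. The $N$-body problem is $\ddot q_i=-\sum_{j\in\mathbf N\setminus\{i\}} m_j(q_i-q_j)/|q_i-q_j|^3$, $i\in\mathbf N$. "Planar collision-free periodic solution" means: $q(t)=q(t+T)\in\mathbb C^N$ for all $t\in\mathbb R$, for some $T>0$, and $\inf\{|q_i(t)-q_j(t)|:t\in\mathbb R,\ i\ne j\in\mathbf N\}>0$. A solution on a half-line starting at $t_x$ is a continuous path satisfying the restricted equation at the times where it is collision-free (the initial position $x$ is allowed to coincide with some $q_i(t_x)$). A solution $z$ is hyperbolic as $t\to+\infty$ (resp. $t\to-\infty$) if $|z(t)|\to\infty$ and $|\dot z(t)|\to c$ for some $c>0$ in that limit. *)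

theory Defs
  imports "HOL-Analysis.Analysis"
begin

text \<open>
  Bodies are indexed by \<open>{1..N}\<close>; values of \<open>m\<close> and \<open>q\<close> outside this range are irrelevant.
  Motions live in the plane, identified with \<open>complex\<close>.
\<close>

definition attraction :: "real \<Rightarrow> complex \<Rightarrow> complex \<Rightarrow> complex" where
  "attraction \<mu> p z = (\<mu> / norm (z - p) ^ 3) *\<^sub>R (z - p)"

text \<open>
  Derivatives are taken within the time domain \<open>I\<close>: one-sided at an endpoint of a half-line,
  ordinary ones at interior points. Values of \<open>z\<close> outside \<open>I\<close> play no role.
\<close>

definition velocity :: "real set \<Rightarrow> (real \<Rightarrow> complex) \<Rightarrow> real \<Rightarrow> complex" where
  "velocity I z t = vector_derivative z (at t within I)"

definition has_acceleration :: "real set \<Rightarrow> (real \<Rightarrow> complex) \<Rightarrow> complex \<Rightarrow> real \<Rightarrow> bool" where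
  "has_acceleration I z a t \<longleftrightarrow>
     z differentiable (at t within I) \<and> (velocity I z has_vector_derivative a) (at t within I)"

definition n_body_solution :: "nat \<Rightarrow> (nat \<Rightarrow> real) \<Rightarrow> (nat \<Rightarrow> real \<Rightarrow> complex) \<Rightarrow> bool" where
  "n_body_solution N m q \<longleftrightarrow>
     (\<forall>i\<in>{1..N}. \<forall>t.
        has_acceleration UNIV (q i) (- (\<Sum>j\<in>{1..N} - {i}. attraction (m j) (q j t) (q i t))) t)"

definition periodic_motion :: "nat \<Rightarrow> (nat \<Rightarrow> real \<Rightarrow> complex) \<Rightarrow> bool" where
  "periodic_motion N q \<longleftrightarrow> (\<exists>T>0. \<forall>i\<in>{1..N}. \<forall>t. q i t = q i (t + T))"

text \<open>For \<open>N \<ge> 2\<close> the set below is nonempty and bounded below by 0, so \<open>Inf\<close> is the true infimum.\<close>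

definition collision_free_motion :: "nat \<Rightarrow> (nat \<Rightarrow> real \<Rightarrow> complex) \<Rightarrow> bool" where
  "collision_free_motion N q \<longleftrightarrow>
     Inf {norm (q i t - q j t) | i j t. i \<in> {1..N} \<and> j \<in> {1..N} \<and> i \<noteq> j} > 0"

definition collision_free_at ::
    "nat \<Rightarrow> (nat \<Rightarrow> real \<Rightarrow> complex) \<Rightarrow> (real \<Rightarrow> complex) \<Rightarrow> real \<Rightarrow> bool" where
  "collision_free_at N q z t \<longleftrightarrow> (\<forall>i\<in>{1..N}. z t \<noteq> q i t)"

text \<open>
  A solution may start at a collision: the equation is only required at collision-free times.
  By continuity these form a relatively open subset of \<open>I\<close>.
\<close>

definition restricted_solution ::
    "nat \<Rightarrow> (nat \<Rightarrow> real) \<Rightarrow> (nat \<Rightarrow> real \<Rightarrow> complex) \<Rightarrow> real set \<Rightarrow> (real \<Rightarrow> complex) \<Rightarrow> bool" where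
  "restricted_solution N m q I z \<longleftrightarrow>
     continuous_on I z \<and>
     (\<forall>t\<in>I. collision_free_at N q z t \<longrightarrow>
        has_acceleration I z (- (\<Sum>i\<in>{1..N}. attraction (m i) (q i t) (z t))) t)"

text \<open>The filter \<open>F\<close> is \<open>at_top\<close> for \<open>t \<rightarrow> +\<infinity>\<close> and \<open>at_bot\<close> for \<open>t \<rightarrow> -\<infinity>\<close>.\<close>

definition hyperbolic :: "real filter \<Rightarrow> real set \<Rightarrow> (real \<Rightarrow> complex) \<Rightarrow> bool" where
  "hyperbolic F I z \<longleftrightarrow>
     filterlim (\<lambda>t. norm (z t)) at_top F \<and>
     (\<exists>c>0. ((\<lambda>t. norm (velocity I z t)) \<longlongrightarrow> c) F)"

end

theory Submission
  imports Defs "HOL-Complex_Analysis.Great_Picard"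
begin

text \<open>
  Write the wanted motion as \<open>x + t v + w t\<close> with \<open>v\<close> the prescribed asymptotic velocity; time reversal
  reduces the past to the future. Minimise \<open>\<integral> |w'|\<^sup>2 / 2 + U - k\<close> over all paths \<open>w\<close> on the half-line with
  \<open>w 0 = 0\<close> and free end, where \<open>k\<close> bounds the potential \<open>U\<close> from below up to distance \<open>B \<surd>t + 1\<close> from the
  uniform motion. Since \<open>U - k\<close> is integrable along a suitable reference path, with an integral linear in \<open>B\<close>,
  for large \<open>B\<close> the minimiser has energy at most \<open>B\<^sup>2\<close> and therefore \<open>|w t| \<le> B \<surd>t\<close>: it never feels the
  truncation, and the force decays like \<open>1 / t\<^sup>2\<close>, which gives \<open>w' t \<rightarrow> 0\<close>.

  The energy of a path is the supremum of \<open>\<Sum> |\<Delta>w|\<^sup>2 / \<Delta>t\<close> over partitions, which is lower semicontinuous under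
  pointwise convergence and needs no Sobolev spaces.

  A minimiser has no collision at a positive time: the action of a passage through a centre at distance
  \<open>r\<close> and back is at least the Jacobi length \<open>4 \<surd>(2 m r)\<close>, whereas half a turn on the circle of radius \<open>r\<close>
  at the parabolic speed costs \<open>\<pi> \<surd>(2 m r)\<close>, and \<open>\<pi> < 4\<close>. The mismatch in duration is
  absorbed by reparametrising the motion relative to the centre, at a cost of lower order in \<open>r\<close>.
\<close>

section \<open>Energy of paths\<close>

text \<open>The potential along the uniform motion decays only like \<open>1 / t\<close>, and a path
  \<open>w\<close> of finite energy grows at most like \<open>sqrt t\<close>, so the action of every
  candidate diverges logarithmically. The function \<open>k\<close> has the same leading term; what
  remains is of order \<open>t powr (-3/2)\<close> with a factor affine in \<open>B\<close>, which
  the quadratic bound on the energy beats. The asymptotic velocity is never imposed as a boundary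
  condition: it sits in the frame, and sublinear growth of \<open>w\<close> recovers it. The numbers
  4 and \<open>pi\<close>: the Jacobi length from radius \<open>r\<close> to the centre is the
  integral of \<open>sqrt (2 * m / s)\<close> over \<open>s\<close> from 0 to \<open>r\<close>, that
  is \<open>2 * sqrt (2 * m * r)\<close>, and it is paid twice. At the parabolic speed
  \<open>sqrt (2 * m / r)\<close> kinetic and potential part agree, so the half turn has density
  \<open>2 * m / r\<close> during the time \<open>pi * r / sqrt (2 * m / r)\<close>. The code
  doubles the action, whence 8 against \<open>2 * pi\<close>. Collisions must be excluded before any
  equation holds, for a \<open>w\<close> that is merely continuous with finite action; hence the
  discrete estimates below.\<close>

fun energy_sum :: "(real \<Rightarrow> 'a::real_normed_vector) \<Rightarrow> real list \<Rightarrow> real" where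
  "energy_sum f (s # t # ts) = (norm (f t - f s))\<^sup>2 / (t - s) + energy_sum f (t # ts)"
| "energy_sum f _ = 0"

text \<open>On an interval this is the integral of |f'|^2, by F. Riesz's characterisation of
  primitives of square integrable functions. Lists need only be sorted: a repeated point contributes
  0 / 0 = 0.\<close>

definition energy :: "(real \<Rightarrow> 'a::real_normed_vector) \<Rightarrow> real set \<Rightarrow> ennreal" where
  "energy f S = (SUP ts\<in>{ts. sorted ts \<and> set ts \<subseteq> S}. ennreal (energy_sum f ts))"

lemma energy_sum_nonneg: "sorted ts \<Longrightarrow> energy_sum f ts \<ge> 0"
  by (induction f ts rule: energy_sum.induct) auto

lemma energy_sum_Cons_ge: "sorted (t # ts) \<Longrightarrow> energy_sum f ts \<le> energy_sum f (t # ts)"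
  by (cases ts) auto

lemma energy_sum_append:
  "energy_sum f (xs @ b # ys) = energy_sum f (xs @ [b]) + energy_sum f (b # ys)"
proof (induction xs)
  case (Cons a xs)
  then show ?case by (cases xs) auto
qed simp

lemma energy_sum_snoc_ge: "sorted (ts @ [t]) \<Longrightarrow> energy_sum f ts \<le> energy_sum f (ts @ [t])"
proof (induction ts)
  case (Cons a ts)
  then show ?case by (cases ts) auto
qed simp

text \<open>Cauchy-Schwarz in the form that makes the refinement of a partition increase its
  sum.\<close>

lemma norm_add_power2_divide_le:
  fixes a b :: "'a::real_normed_vector"
  assumes "s > 0" "t > 0"
  shows "(norm (a + b))\<^sup>2 / (s + t) \<le> (norm a)\<^sup>2 / s + (norm b)\<^sup>2 / t"
proof -
  have "(norm (a + b))\<^sup>2 \<le> (norm a + norm b)\<^sup>2"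
    by (intro power_mono norm_triangle_ineq) auto
  also have "\<dots> \<le> (s + t) * ((norm a)\<^sup>2 / s + (norm b)\<^sup>2 / t)"
  proof -
    have "(s + t) * ((norm a)\<^sup>2 / s + (norm b)\<^sup>2 / t) - (norm a + norm b)\<^sup>2
          = (t * norm a - s * norm b)\<^sup>2 / (s * t)"
      using assms by (simp add: field_simps power2_eq_square)
    moreover have "\<dots> \<ge> 0" using assms by simp
    ultimately show ?thesis by linarith
  qed
  finally show ?thesis using assms by (simp add: divide_le_eq mult.commute)
qed

lemma energy_sum_insort:
  "sorted ts \<Longrightarrow> energy_sum f ts \<le> energy_sum f (insort b ts)"
proof (induction f ts rule: energy_sum.induct)
  case (1 f s t ts)
  show ?case
  proof (cases "b \<le> s")
    case True
    then show ?thesis using 1 by auto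
  next
    case False
    show ?thesis
    proof (cases "b \<le> t")
      case True
      have "(norm (f t - f s))\<^sup>2 / (t - s) \<le> (norm (f b - f s))\<^sup>2 / (b - s) + (norm (f t - f b))\<^sup>2 / (t - b)"
      proof (cases "b = t")
        case False
        then show ?thesis
          using norm_add_power2_divide_le[of "b - s" "t - b" "f b - f s" "f t - f b"] True \<open>\<not> b \<le> s\<close> by simp
      qed simp
      then show ?thesis using 1 True False by simp
    next
      case False
      then show ?thesis using 1 \<open>\<not> b \<le> s\<close> by auto
    qed
  qed
next
  case ("2_2" f v)
  then show ?case using energy_sum_nonneg[of "insort b [v]" f] by (simp add: sorted_insort)
qed simp_all

lemma energy_geI: "sorted ts \<Longrightarrow> set ts \<subseteq> S \<Longrightarrow> ennreal (energy_sum f ts) \<le> energy f S"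
  unfolding energy_def by (rule SUP_upper) auto

lemma energy_leI: "(\<And>ts. sorted ts \<Longrightarrow> set ts \<subseteq> S \<Longrightarrow> ennreal (energy_sum f ts) \<le> c) \<Longrightarrow> energy f S \<le> c"
  unfolding energy_def by (rule SUP_least) auto

lemma energy_ge_pair:
  assumes "s \<in> S" "t \<in> S" "s \<le> t"
  shows "ennreal ((norm (f t - f s))\<^sup>2 / (t - s)) \<le> energy f S"
  using energy_geI[of "[s, t]" S f] assms by simp

lemma energy_sum_cong: "(\<And>t. t \<in> set ts \<Longrightarrow> f t = g t) \<Longrightarrow> energy_sum f ts = energy_sum g ts"
  by (induction f ts rule: energy_sum.induct) auto

lemma energy_cong: "(\<And>t. t \<in> S \<Longrightarrow> f t = g t) \<Longrightarrow> energy f S = energy g S"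
  unfolding energy_def by (intro SUP_cong refl arg_cong[where f = ennreal] energy_sum_cong) auto

lemma energy_mono: "S \<subseteq> T \<Longrightarrow> energy f S \<le> energy f T"
  by (rule energy_leI) (auto intro: energy_geI)

text \<open>One inequality refines a partition by the point \<open>b\<close>, the other concatenates
  two partitions at \<open>b\<close>. With \<open>S\<close> arbitrary, the same fact cuts compact
  intervals and half-lines.\<close>

lemma energy_split:
  assumes "b \<in> S"
  shows "energy f S = energy f (S \<inter> {..b}) + energy f (S \<inter> {b..})"
proof (rule antisym)
  show "energy f S \<le> energy f (S \<inter> {..b}) + energy f (S \<inter> {b..})"
  proof (rule energy_leI)
    fix ts :: "real list" assume ts: "sorted ts" "set ts \<subseteq> S"
    define us where "us = insort b ts"
    have us: "sorted us" "set us \<subseteq> S" "b \<in> set us"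
      using ts assms by (auto simp: us_def sorted_insort set_insort_key)
    obtain xs ys where xy: "us = xs @ b # ys" using us(3) by (meson split_list)
    have "ennreal (energy_sum f ts) \<le> ennreal (energy_sum f us)"
      unfolding us_def using ts by (intro ennreal_leI energy_sum_insort)
    also have "\<dots> = ennreal (energy_sum f (xs @ [b])) + ennreal (energy_sum f (b # ys))"
      unfolding xy using us(1) xy
      by (subst energy_sum_append) (auto intro!: ennreal_plus energy_sum_nonneg simp: sorted_append)
    also have "\<dots> \<le> energy f (S \<inter> {..b}) + energy f (S \<inter> {b..})"
      using us xy by (intro add_mono energy_geI) (auto simp: sorted_append)
    finally show "ennreal (energy_sum f ts) \<le> \<dots>" .
  qed
next
  have *: "ennreal (energy_sum f xs) + ennreal (energy_sum f ys) \<le> energy f S"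
    if "sorted xs" "set xs \<subseteq> S \<inter> {..b}" "sorted ys" "set ys \<subseteq> S \<inter> {b..}" for xs ys
  proof -
    have 1: "sorted (xs @ [b])" "sorted (b # ys)" using that by (auto simp: sorted_append)
    have "ennreal (energy_sum f xs) + ennreal (energy_sum f ys)
        \<le> ennreal (energy_sum f (xs @ [b])) + ennreal (energy_sum f (b # ys))"
      using 1 by (intro add_mono ennreal_leI energy_sum_snoc_ge energy_sum_Cons_ge)
    also have "\<dots> = ennreal (energy_sum f (xs @ b # ys))"
      using 1 by (subst (2) energy_sum_append) (auto intro!: ennreal_plus[symmetric] energy_sum_nonneg)
    also have "\<dots> \<le> energy f S"
      using that assms by (intro energy_geI) (fastforce simp: sorted_append)+
    finally show ?thesis .
  qed
  have "energy f (S \<inter> {..b}) + ennreal (energy_sum f ys) \<le> energy f S"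
    if "sorted ys" "set ys \<subseteq> S \<inter> {b..}" for ys
  proof -
    have "energy f (S \<inter> {..b}) + ennreal (energy_sum f ys) =
       (SUP xs\<in>{ts. sorted ts \<and> set ts \<subseteq> S \<inter> {..b}}. ennreal (energy_sum f xs) + ennreal (energy_sum f ys))"
      unfolding energy_def by (rule ennreal_SUP_add_left[symmetric]) (auto intro: exI[of _ "[]"])
    also have "\<dots> \<le> energy f S" using * that by (intro SUP_least) auto
    finally show ?thesis .
  qed
  moreover have "energy f (S \<inter> {..b}) + energy f (S \<inter> {b..}) =
       (SUP ys\<in>{ts. sorted ts \<and> set ts \<subseteq> S \<inter> {b..}}. energy f (S \<inter> {..b}) + ennreal (energy_sum f ys))"
    unfolding energy_def[of f "S \<inter> {b..}"] by (subst ennreal_SUP_add_right) (auto intro: exI[of _ "[]"])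
  ultimately show "energy f (S \<inter> {..b}) + energy f (S \<inter> {b..}) \<le> energy f S"
    by (auto intro!: SUP_least)
qed

lemma energy_Icc_split:
  assumes "a \<le> b" "b \<le> c"
  shows "energy f {a..c} = energy f {a..b} + energy f {b..c}"
proof -
  have "{a..c} \<inter> {..b} = {a..b}" "{a..c} \<inter> {b..} = {b..c}" using assms by auto
  then show ?thesis using energy_split[of b "{a..c}" f] assms by simp
qed

lemma energy_Ici_split:
  assumes "a \<le> b"
  shows "energy f {a..} = energy f {a..b} + energy f {b..}"
proof -
  have "{a..} \<inter> {..b} = {a..b}" "{a..} \<inter> {b..} = {b..}" using assms by auto
  then show ?thesis using energy_split[of b "{a..}" f] assms by simp
qed

text \<open>The bounds telescope. \<open>\<Phi>\<close> plays the role of a primitive of |f'|^2, for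
  which the hypothesis is Cauchy-Schwarz; energies are thus bounded above without derivatives or
  integrals.\<close>

lemma energy_sum_le_increment:
  assumes "\<And>s t. s \<in> S \<Longrightarrow> t \<in> S \<Longrightarrow> s \<le> t \<Longrightarrow> (norm (f t - f s))\<^sup>2 \<le> (t - s) * (\<Phi> t - \<Phi> s)"
  shows "sorted ts \<Longrightarrow> set ts \<subseteq> S \<Longrightarrow> ts \<noteq> [] \<Longrightarrow> energy_sum f ts \<le> \<Phi> (last ts) - \<Phi> (hd ts)"
proof (induction ts)
  case (Cons s ts)
  show ?case
  proof (cases ts)
    case (Cons t us)
    have "(norm (f t - f s))\<^sup>2 / (t - s) \<le> \<Phi> t - \<Phi> s"
    proof (cases "s = t")
      case False
      then show ?thesis using assms[of s t] Cons.prems Cons by (auto simp: divide_le_eq mult.commute)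
    qed simp
    then show ?thesis using Cons.IH Cons.prems Cons by auto
  qed simp
qed simp

lemma energy_le_increment:
  assumes "a \<le> b"
    and "\<And>s t. a \<le> s \<Longrightarrow> s \<le> t \<Longrightarrow> t \<le> b \<Longrightarrow> (norm (f t - f s))\<^sup>2 \<le> (t - s) * (\<Phi> t - \<Phi> s)"
  shows "energy f {a..b} \<le> ennreal (\<Phi> b - \<Phi> a)"
proof (rule energy_leI)
  fix ts :: "real list" assume ts: "sorted ts" "set ts \<subseteq> {a..b}"
  then have 1: "sorted (a # ts @ [b])" "set (a # ts @ [b]) \<subseteq> {a..b}" using assms(1) by (auto simp: sorted_append)
  have "energy_sum f ts \<le> energy_sum f (a # ts @ [b])"
    using 1 energy_sum_snoc_ge[of ts b f] energy_sum_Cons_ge[of a "ts @ [b]" f] by auto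
  also have "\<dots> \<le> \<Phi> (last (a # ts @ [b])) - \<Phi> (hd (a # ts @ [b]))"
    by (rule energy_sum_le_increment[of "{a..b}"]) (use 1 assms in auto)
  finally show "ennreal (energy_sum f ts) \<le> ennreal (\<Phi> b - \<Phi> a)" by (auto intro!: ennreal_leI)
qed

lemma energy_le_Lipschitz:
  assumes "a \<le> b" "\<And>s t. a \<le> s \<Longrightarrow> s \<le> t \<Longrightarrow> t \<le> b \<Longrightarrow> norm (f t - f s) \<le> u * (t - s)"
  shows "energy f {a..b} \<le> ennreal (u\<^sup>2 * (b - a))"
proof -
  have "(norm (f t - f s))\<^sup>2 \<le> (t - s) * (u\<^sup>2 * t - u\<^sup>2 * s)" if "a \<le> s" "s \<le> t" "t \<le> b" for s t
  proof -
    have "(norm (f t - f s))\<^sup>2 \<le> (u * (t - s))\<^sup>2" using assms(2)[OF that] by (intro power_mono) auto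
    then show ?thesis by (simp add: power2_eq_square algebra_simps)
  qed
  from energy_le_increment[OF assms(1) this] show ?thesis by (simp add: algebra_simps)
qed

lemma tendsto_energy_sum:
  assumes "\<And>t. t \<in> set ts \<Longrightarrow> (\<lambda>n. f n t) \<longlonglongrightarrow> g t"
  shows "(\<lambda>n. energy_sum (f n) ts) \<longlonglongrightarrow> energy_sum g ts"
  using assms
proof (induction ts)
  case (Cons s ts)
  then show ?case by (cases ts) (auto intro!: tendsto_intros simp: divide_inverse)
qed simp

text \<open>The two-point partition already gives Hoelder continuity of exponent 1/2. This supplies
  both the equicontinuity of minimising sequences and, with \<open>s = 0\<close>, the growth bound
  \<open>B * sqrt t\<close>.\<close>

lemma norm_diff_le_sqrt_energy:
  assumes "energy f S \<le> ennreal (B\<^sup>2)" "B \<ge> 0" "s \<in> S" "t \<in> S"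
  shows "norm (f t - f s) \<le> B * sqrt \<bar>t - s\<bar>"
proof -
  have *: "norm (f t - f s) \<le> B * sqrt (t - s)" if "s \<in> S" "t \<in> S" "s < t" for s t
  proof -
    have "ennreal ((norm (f t - f s))\<^sup>2 / (t - s)) \<le> ennreal (B\<^sup>2)"
      using order_trans[OF energy_ge_pair[of s S t f] assms(1)] that by simp
    then have "(norm (f t - f s))\<^sup>2 / (t - s) \<le> B\<^sup>2" by (rule iffD1[OF ennreal_le_iff, rotated]) simp
    then have "(norm (f t - f s))\<^sup>2 \<le> (B * sqrt (t - s))\<^sup>2"
      using that by (simp add: divide_le_eq power_mult_distrib)
    then show ?thesis using that assms(2) by (simp add: power2_le_iff_abs_le)
  qed
  show ?thesis
    using *[of s t] *[of t s] assms(3,4) by (cases s t rule: linorder_cases) (auto simp: norm_minus_commute)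
qed

text \<open>Adding an affine function changes every partition sum by the same telescoping amount.\<close>

lemma energy_sum_add_affine:
  fixes f :: "real \<Rightarrow> 'a::real_inner"
  shows "ts \<noteq> [] \<Longrightarrow> energy_sum (\<lambda>t. f t + (\<alpha> + t *\<^sub>R \<beta>)) ts
     = energy_sum f ts + 2 * (\<beta> \<bullet> (f (last ts) - f (hd ts))) + (norm \<beta>)\<^sup>2 * (last ts - hd ts)"
proof (induction ts)
  case (Cons s ts)
  show ?case
  proof (cases ts)
    case (Cons t us)
    have "(norm (f t + (\<alpha> + t *\<^sub>R \<beta>) - (f s + (\<alpha> + s *\<^sub>R \<beta>))))\<^sup>2 / (t - s)
      = (norm (f t - f s))\<^sup>2 / (t - s) + 2 * (\<beta> \<bullet> (f t - f s)) + (norm \<beta>)\<^sup>2 * (t - s)"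
    proof (cases "t = s")
      case False
      have eq: "f t + (\<alpha> + t *\<^sub>R \<beta>) - (f s + (\<alpha> + s *\<^sub>R \<beta>)) = (f t - f s) + (t - s) *\<^sub>R \<beta>"
        by (simp add: algebra_simps)
      have "(norm (x + d *\<^sub>R \<beta>))\<^sup>2 = (norm x)\<^sup>2 + 2 * d * (\<beta> \<bullet> x) + d\<^sup>2 * (norm \<beta>)\<^sup>2" for x :: 'a and d
        unfolding power2_norm_eq_inner by (simp add: inner_add_left inner_add_right inner_commute power2_eq_square)
      note expand = this[of "f t - f s" "t - s"]
      show ?thesis unfolding eq expand using False by (simp add: power2_eq_square divide_simps)
    qed simp
    then show ?thesis using Cons.IH Cons by (simp add: inner_diff_right algebra_simps)
  qed simp
qed simp

lemma energy_add_affine_le: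
  fixes f :: "real \<Rightarrow> 'a::real_inner"
  assumes "a \<le> b" "energy f {a..b} \<le> ennreal e" "e \<ge> 0"
  shows "energy (\<lambda>t. f t + (\<alpha> + t *\<^sub>R \<beta>)) {a..b}
      \<le> ennreal (e + 2 * (\<beta> \<bullet> (f b - f a)) + (norm \<beta>)\<^sup>2 * (b - a))" (is "energy ?g _ \<le> _")
proof (rule energy_leI)
  fix ts :: "real list" assume ts: "sorted ts" "set ts \<subseteq> {a..b}"
  \<comment> \<open>With both endpoints in the partition, the telescoping amount is the same for
    every partition.\<close>
  then have 1: "sorted (a # ts @ [b])" "set (a # ts @ [b]) \<subseteq> {a..b}" using assms(1) by (auto simp: sorted_append)
  have "energy_sum ?g ts \<le> energy_sum ?g (a # ts @ [b])"
    using 1 energy_sum_snoc_ge[of ts b ?g] energy_sum_Cons_ge[of a "ts @ [b]" ?g] by auto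
  also have "\<dots> = energy_sum f (a # ts @ [b]) + 2 * (\<beta> \<bullet> (f b - f a)) + (norm \<beta>)\<^sup>2 * (b - a)"
    using energy_sum_add_affine[of "a # ts @ [b]" f \<alpha> \<beta>] by simp
  also have "energy_sum f (a # ts @ [b]) \<le> e"
    using order_trans[OF energy_geI[OF 1, of f] assms(2)] assms(3) by (subst (asm) ennreal_le_iff) auto
  finally show "ennreal (energy_sum ?g ts) \<le> ennreal (e + 2 * (\<beta> \<bullet> (f b - f a)) + (norm \<beta>)\<^sup>2 * (b - a))"
    by (auto intro!: ennreal_leI)
qed

text \<open>\<open>g\<close> is \<open>f\<close> after an affine time change of slope
  \<open>\<sigma>\<close>, up to a perturbation with Lipschitz constant \<open>\<kappa>\<close>. The
  time change multiplies the energy by \<open>\<sigma>\<close>; the cross term of the perturbation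
  is split by AM-GM, so that the error is of first order in \<open>\<kappa>\<close>.\<close>

lemma energy_reparametrize_le:
  fixes f g :: "real \<Rightarrow> 'a::real_normed_vector"
  assumes "\<sigma> > 0" "\<kappa> \<ge> 0" "a \<le> b"
    and dev: "\<And>s t. a \<le> s \<Longrightarrow> s \<le> t \<Longrightarrow> t \<le> b \<Longrightarrow>
      norm ((g t - g s) - (f (c + \<sigma> * t) - f (c + \<sigma> * s))) \<le> \<kappa> * (t - s)"
  shows "energy g {a..b} \<le> ennreal ((1 + \<kappa>) * \<sigma>) * energy f {c + \<sigma> * a..c + \<sigma> * b} + ennreal ((\<kappa> + \<kappa>\<^sup>2) * (b - a))"
proof (rule energy_leI)
  let ?\<phi> = "\<lambda>t. c + \<sigma> * t"
  fix ts :: "real list" assume ts: "sorted ts" "set ts \<subseteq> {a..b}"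
  have step: "(norm (g t - g s))\<^sup>2 / (t - s) \<le>
      (1 + \<kappa>) * \<sigma> * ((norm (f (?\<phi> t) - f (?\<phi> s)))\<^sup>2 / (?\<phi> t - ?\<phi> s)) + (\<kappa> + \<kappa>\<^sup>2) * (t - s)"
    if "a \<le> s" "s \<le> t" "t \<le> b" for s t
  proof (cases "s = t")
    case False
    then have st: "t - s > 0" using that by auto
    let ?X = "norm (f (?\<phi> t) - f (?\<phi> s))" and ?d = "t - s"
    have "norm (g t - g s) \<le> ?X + \<kappa> * ?d"
      using dev[OF that] norm_triangle_sub[of "g t - g s" "f (?\<phi> t) - f (?\<phi> s)"] by linarith
    then have "(norm (g t - g s))\<^sup>2 \<le> (?X + \<kappa> * ?d)\<^sup>2" by (intro power_mono) auto
    also have "\<dots> \<le> (1 + \<kappa>) * ?X\<^sup>2 + (\<kappa> + \<kappa>\<^sup>2) * ?d\<^sup>2"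
    proof -
      have "(1 + \<kappa>) * ?X\<^sup>2 + (\<kappa> + \<kappa>\<^sup>2) * ?d\<^sup>2 - (?X + \<kappa> * ?d)\<^sup>2 = \<kappa> * (?X - ?d)\<^sup>2"
        by (simp add: power2_eq_square algebra_simps)
      moreover have "\<dots> \<ge> 0" using assms(2) by simp
      ultimately show ?thesis by linarith
    qed
    finally have "(norm (g t - g s))\<^sup>2 / ?d \<le> ((1 + \<kappa>) * ?X\<^sup>2 + (\<kappa> + \<kappa>\<^sup>2) * ?d\<^sup>2) / ?d"
      using st by (intro divide_right_mono) auto
    also have "\<dots> = (1 + \<kappa>) * \<sigma> * (?X\<^sup>2 / (\<sigma> * ?d)) + (\<kappa> + \<kappa>\<^sup>2) * ?d"
      using st assms(1) by (simp add: field_simps power2_eq_square)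
    finally show ?thesis by (simp add: algebra_simps)
  qed simp
  have "sorted ts \<Longrightarrow> set ts \<subseteq> {a..b} \<Longrightarrow> ts \<noteq> [] \<Longrightarrow>
      energy_sum g ts \<le> (1 + \<kappa>) * \<sigma> * energy_sum f (map ?\<phi> ts) + (\<kappa> + \<kappa>\<^sup>2) * (last ts - hd ts)" for ts
  proof (induction ts)
    case (Cons s ts)
    show ?case
    proof (cases ts)
      case (Cons t us)
      then show ?thesis using step[of s t] Cons.prems Cons.IH by (simp add: algebra_simps)
    qed simp
  qed simp
  note main = this[OF ts]
  have nn: "energy_sum f (map ?\<phi> ts) \<ge> 0"
    using ts assms(1) by (intro energy_sum_nonneg) (simp add: sorted_map sorted_wrt_iff_nth_less sorted_iff_nth_mono)
  have "ennreal (energy_sum g ts) \<le> ennreal ((1 + \<kappa>) * \<sigma> * energy_sum f (map ?\<phi> ts) + (\<kappa> + \<kappa>\<^sup>2) * (b - a))"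
  proof (cases "ts = []")
    case False
    have "last ts - hd ts \<le> b - a" using ts False by (meson atLeastAtMost_iff diff_mono hd_in_set last_in_set subsetD)
    then have "(\<kappa> + \<kappa>\<^sup>2) * (last ts - hd ts) \<le> (\<kappa> + \<kappa>\<^sup>2) * (b - a)" using assms(2) by (intro mult_left_mono) auto
    then show ?thesis using main[OF False] by (intro ennreal_leI) linarith
  qed simp
  also have "\<dots> = ennreal ((1 + \<kappa>) * \<sigma>) * ennreal (energy_sum f (map ?\<phi> ts)) + ennreal ((\<kappa> + \<kappa>\<^sup>2) * (b - a))"
    using nn assms by (subst ennreal_plus) (auto simp: ennreal_mult')
  also have "ennreal (energy_sum f (map ?\<phi> ts)) \<le> energy f {?\<phi> a..?\<phi> b}"
    using ts assms(1) by (intro energy_geI) (auto simp: sorted_map sorted_wrt_iff_nth_less sorted_iff_nth_mono)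
  finally show "ennreal (energy_sum g ts) \<le> ennreal ((1 + \<kappa>) * \<sigma>) * energy f {?\<phi> a..?\<phi> b} + ennreal ((\<kappa> + \<kappa>\<^sup>2) * (b - a))"
    by (simp add: mult_left_mono)
qed

section \<open>Cost of a collision\<close>

lemma has_vector_derivative_diff_bound:
  fixes f :: "real \<Rightarrow> 'a::real_normed_vector"
  assumes "convex S" "\<And>t. t \<in> S \<Longrightarrow> (f has_vector_derivative f' t) (at t within S)"
    and "\<And>t. t \<in> S \<Longrightarrow> norm (f' t) \<le> B" "s \<in> S" "t \<in> S"
  shows "norm (f t - f s) \<le> B * \<bar>t - s\<bar>"
proof -
  have "norm (f t - f s) \<le> B * norm (t - s)"
    by (rule differentiable_bound[OF assms(1), of f "\<lambda>t h. h *\<^sub>R f' t"])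
       (use assms in \<open>auto simp: has_vector_derivative_def onorm_scaleR_left bounded_linear_ident onorm_id\<close>)
  then show ?thesis by simp
qed

lemma ennreal_divide_norm_le:
  assumes "0 \<le> c" "0 < r" "r \<le> norm y"
  shows "ennreal c / ennreal (norm y) \<le> ennreal (c / r)"
proof -
  have "ennreal c / ennreal (norm y) = ennreal (c / norm y)" using assms by (intro divide_ennreal) auto
  also have "\<dots> \<le> ennreal (c / r)" using assms by (intro ennreal_leI divide_left_mono mult_pos_pos) auto
  finally show ?thesis .
qed

lemma ennreal_divide_norm_ge:
  assumes "0 < c" "0 < r" "norm y \<le> r"
  shows "ennreal (c / r) \<le> ennreal c / ennreal (norm y)"
proof (cases "norm y = 0")
  case True
  then show ?thesis using assms by (simp add: divide_ennreal_def ennreal_mult_top)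
next
  case False
  then show ?thesis using assms
    by (simp add: divide_ennreal) (auto intro!: ennreal_leI divide_left_mono)
qed

text \<open>Only uniform bounds on the bodies enter. Up to the value of \<open>L\<close>, they
  survive time reversal and the passage to a uniformly moving frame, and the locale is instantiated
  in both situations.\<close>

locale moving_centers =
  fixes I :: "'i set" and m :: "'i \<Rightarrow> real" and p p' :: "'i \<Rightarrow> real \<Rightarrow> complex" and L C d :: real
  assumes finite_I: "finite I"
    and m_pos: "i \<in> I \<Longrightarrow> m i > 0"
    and p_deriv: "i \<in> I \<Longrightarrow> (p i has_vector_derivative p' i t) (at t)"
    and p'_le: "i \<in> I \<Longrightarrow> norm (p' i t) \<le> L"
    and p'_Lipschitz: "i \<in> I \<Longrightarrow> norm (p' i t - p' i s) \<le> C * \<bar>t - s\<bar>"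
    and p_separated: "i \<in> I \<Longrightarrow> j \<in> I \<Longrightarrow> i \<noteq> j \<Longrightarrow> d \<le> norm (p i t - p j t)"
    and d_pos: "d > 0" and L_nonneg: "L \<ge> 0" and C_nonneg: "C \<ge> 0"
begin

text \<open>Energy and potential are both doubled, so that the kinetic part is \<^const>\<open>energy\<close> without a factor.
  Division in \<^typ>\<open>ennreal\<close> makes the potential infinite at a centre.\<close>

definition potential :: "real \<Rightarrow> complex \<Rightarrow> ennreal" where
  "potential t y = (\<Sum>i\<in>I. ennreal (2 * m i) / ennreal (norm (y - p i t)))"

abbreviation potential_integral :: "(real \<Rightarrow> complex) \<Rightarrow> real set \<Rightarrow> ennreal" where
  "potential_integral w S \<equiv> \<integral>\<^sup>+t\<in>S. potential t (w t) \<partial>lborel"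

definition action :: "(real \<Rightarrow> complex) \<Rightarrow> real set \<Rightarrow> ennreal" where
  "action w S = energy w S + potential_integral w S"

text \<open>Competitors stay within distance 1 of \<open>w\<close> because the global problem has a
  truncated potential, which is guaranteed to differ from the true one by a mere function of time
  only that close to the minimiser.\<close>

definition local_minimizer :: "(real \<Rightarrow> complex) \<Rightarrow> bool" where
  "local_minimizer w \<longleftrightarrow> continuous_on UNIV w \<and>
     (\<forall>a b. 0 \<le> a \<longrightarrow> action w {a..b} < \<infinity>) \<and>
     (\<forall>a b g. 0 \<le> a \<longrightarrow> a < b \<longrightarrow> continuous_on UNIV g \<longrightarrow> g a = w a \<longrightarrow> g b = w b \<longrightarrow>
        (\<forall>t\<in>{a..b}. norm (g t - w t) \<le> 1) \<longrightarrow> action w {a..b} \<le> action g {a..b})"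

lemma p_continuous: "i \<in> I \<Longrightarrow> continuous_on S (p i)"
  using p_deriv by (meson continuous_at_imp_continuous_on has_vector_derivative_continuous)

lemma p_Lipschitz:
  assumes "i \<in> I"
  shows "norm (p i t - p i s) \<le> L * \<bar>t - s\<bar>"
  by (rule has_vector_derivative_diff_bound[of UNIV _ "p' i"]) (use assms p_deriv p'_le in auto)

lemma measurable_potential [measurable]:
  assumes "continuous_on UNIV w"
  shows "(\<lambda>t. potential t (w t)) \<in> borel_measurable borel"
proof -
  have [measurable]: "w \<in> borel_measurable borel" using assms by (rule borel_measurable_continuous_onI)
  have [measurable]: "p i \<in> borel_measurable borel" if "i \<in> I" for i
    using p_continuous[OF that] by (rule borel_measurable_continuous_onI)
  show ?thesis unfolding potential_def divide_ennreal_def by measurable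
qed

lemma action_split:
  assumes "continuous_on UNIV w" "a \<le> b" "b \<le> c"
  shows "action w {a..c} = action w {a..b} + action w {b..c}"
proof -
  have [measurable]: "(\<lambda>t. potential t (w t)) \<in> borel_measurable borel" using assms(1) by measurable
  have "potential_integral w {a..c}
     = (\<integral>\<^sup>+t. potential t (w t) * indicator {a..b} t + potential t (w t) * indicator {b..c} t \<partial>lborel)"
  proof (rule nn_integral_cong_AE)
    have "AE t in lborel. t \<noteq> b" by (rule AE_lborel_singleton)
    then show "AE t in lborel. potential t (w t) * indicator {a..c} t =
        potential t (w t) * indicator {a..b} t + potential t (w t) * indicator {b..c} t"
      by eventually_elim (use assms in \<open>auto simp: indicator_def\<close>)
  qed
  also have "\<dots> = potential_integral w {a..b}
      + potential_integral w {b..c}"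
    by (intro nn_integral_add) measurable
  finally show ?thesis using energy_Icc_split[OF assms(2,3), of w] by (simp add: action_def ac_simps)
qed

lemma potential_ge:
  assumes "i \<in> I" "norm (y - p i t) \<le> R" "R > 0"
  shows "ennreal (2 * m i / R) \<le> potential t y"
proof -
  have "ennreal (2 * m i / R) \<le> ennreal (2 * m i) / ennreal (norm (y - p i t))"
    using assms m_pos by (intro ennreal_divide_norm_ge) auto
  also have "\<dots> \<le> potential t y"
    unfolding potential_def using assms finite_I by (intro member_le_sum) auto
  finally show ?thesis .
qed

lemma action_ge_dwell:
  assumes "i \<in> I" "R > 0" "a \<le> b" "\<And>t. t \<in> {a..b} \<Longrightarrow> norm (w t - p i t) \<le> R"
  shows "ennreal (2 * m i * (b - a) / R) \<le> potential_integral w {a..b}"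
proof -
  have "ennreal (2 * m i * (b - a) / R) = (\<integral>\<^sup>+t\<in>{a..b}. ennreal (2 * m i / R) \<partial>lborel)"
    using assms m_pos[OF assms(1)] by (simp add: nn_integral_cmult_indicator ennreal_mult'[symmetric])
  also have "\<dots> \<le> potential_integral w {a..b}"
    by (intro nn_integral_mono) (use assms in \<open>auto simp: indicator_def intro!: potential_ge\<close>)
  finally show ?thesis .
qed

text \<open>AM-GM between the kinetic and the potential part: a discrete form of the bound of the
  action by the Jacobi length. The correction \<open>2 * L * D\<close> pays for the motion of the centre.\<close>

lemma action_ge_radial_step:
  assumes "i \<in> I" "R > 0" "a \<le> b" "\<And>t. t \<in> {a..b} \<Longrightarrow> norm (w t - p i t) \<le> R"
    and D: "D = \<bar>norm (w b - p i b) - norm (w a - p i a)\<bar>"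
  shows "ennreal (2 * sqrt (2 * m i) * D / sqrt R - 2 * L * D) \<le> action w {a..b}"
proof (cases "a = b")
  case True
  then show ?thesis using D by simp
next
  case False
  define \<tau> where "\<tau> = b - a"
  have \<tau>: "\<tau> > 0" using False assms(3) by (simp add: \<tau>_def)
  have D0: "D \<ge> 0" using D by simp
  have "D \<le> norm (w b - w a) + L * \<tau>"
  proof -
    have "D \<le> norm ((w b - p i b) - (w a - p i a))" unfolding D by (rule norm_triangle_ineq3)
    also have "\<dots> = norm ((w b - w a) - (p i b - p i a))" by (simp add: algebra_simps)
    also have "\<dots> \<le> norm (w b - w a) + norm (p i b - p i a)" by (rule norm_triangle_ineq4)
    finally show ?thesis using p_Lipschitz[OF assms(1), of b a] \<tau> by (simp add: \<tau>_def)
  qed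
  \<comment> \<open>The increment of \<open>w\<close> is at least \<open>D - L * \<tau>\<close>; if
    this is negative, the left-hand side is at most 0.\<close>
  have kin: "D\<^sup>2 / \<tau> - 2 * L * D \<le> (norm (w b - w a))\<^sup>2 / \<tau>"
  proof (cases "D \<ge> L * \<tau>")
    case True
    have "(D - L * \<tau>)\<^sup>2 \<le> (norm (w b - w a))\<^sup>2" using True \<open>D \<le> _\<close> by (intro power_mono) auto
    moreover have "(D - L * \<tau>)\<^sup>2 = D\<^sup>2 - 2 * L * D * \<tau> + (L * \<tau>)\<^sup>2" by (simp add: power2_eq_square algebra_simps)
    ultimately have "D\<^sup>2 - 2 * L * D * \<tau> \<le> (norm (w b - w a))\<^sup>2" using zero_le_power2[of "L * \<tau>"] by linarith
    then have "(D\<^sup>2 - 2 * L * D * \<tau>) / \<tau> \<le> (norm (w b - w a))\<^sup>2 / \<tau>" using \<tau> by (intro divide_right_mono) auto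
    then show ?thesis using \<tau> by (simp add: diff_divide_distrib)
  next
    case False
    then have "D\<^sup>2 \<le> D * (L * \<tau>)" using D0 by (simp add: power2_eq_square mult_left_mono)
    also have "\<dots> \<le> 2 * L * D * \<tau>" using D0 L_nonneg \<tau> by (simp add: ac_simps)
    finally have "D\<^sup>2 / \<tau> \<le> 2 * L * D" using \<tau> by (simp add: divide_le_eq)
    moreover have "0 \<le> (norm (w b - w a))\<^sup>2 / \<tau>" using \<tau> by simp
    ultimately show ?thesis by linarith
  qed
  have mi: "m i > 0" by (rule m_pos[OF assms(1)])
  have amgm: "2 * sqrt (2 * m i) * D / sqrt R \<le> D\<^sup>2 / \<tau> + 2 * m i * \<tau> / R"
  proof -
    have "0 \<le> (D / sqrt \<tau> - sqrt (2 * m i) * sqrt \<tau> / sqrt R)\<^sup>2" by simp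
    also have "\<dots> = D\<^sup>2 / \<tau> + 2 * m i * \<tau> / R - 2 * sqrt (2 * m i) * D / sqrt R"
      using \<tau> assms(2) mi by (simp add: power2_diff power_mult_distrib power_divide)
    finally show ?thesis by linarith
  qed
  have "ennreal (2 * sqrt (2 * m i) * D / sqrt R - 2 * L * D)
      \<le> ennreal ((norm (w b - w a))\<^sup>2 / \<tau> + 2 * m i * \<tau> / R)"
    using kin amgm by (intro ennreal_leI) linarith
  also have "\<dots> = ennreal ((norm (w b - w a))\<^sup>2 / \<tau>) + ennreal (2 * m i * \<tau> / R)"
    using \<tau> mi assms(2) by (intro ennreal_plus) auto
  also have "\<dots> \<le> action w {a..b}"
    unfolding action_def using energy_ge_pair[of a "{a..b}" b w] action_ge_dwell[OF assms(1-4)] assms(3)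
    by (intro add_mono) (auto simp: \<tau>_def)
  finally show ?thesis .
qed

end

section \<open>Level crossings and the cost of falling into a centre\<close>

lemma last_time_at_level:
  fixes \<rho> :: "real \<Rightarrow> real"
  assumes "continuous_on {a..b} \<rho>" "a \<le> b" "\<rho> b \<le> c" "c \<le> \<rho> a"
  obtains t where "a \<le> t" "t \<le> b" "\<rho> t = c" "\<And>u. t \<le> u \<Longrightarrow> u \<le> b \<Longrightarrow> \<rho> u \<le> c"
proof -
  define T where "T = {u \<in> {a..b}. \<rho> u = c}"
  have "T \<noteq> {}" using IVT2'[of \<rho> b c a] assms unfolding T_def by auto
  moreover have "compact T"
  proof -
    have "closed T" unfolding T_def
      by (rule continuous_closed_preimage_constant[OF assms(1)]) simp
    moreover have "bounded T" by (rule bounded_subset[of "{a..b}"]) (auto simp: T_def)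
    ultimately show ?thesis by (simp add: compact_eq_bounded_closed)
  qed
  ultimately obtain t where t: "t \<in> T" "\<And>u. u \<in> T \<Longrightarrow> u \<le> t"
    using compact_attains_sup[of T] by blast
  \<comment> \<open>Exceeding the level after its last crossing would force yet another crossing,
    since the path ends at or below \<open>c\<close>.\<close>
  have "\<rho> u \<le> c" if u: "t \<le> u" "u \<le> b" for u
  proof (rule ccontr)
    assume "\<not> \<rho> u \<le> c"
    moreover have "continuous_on {u..b} \<rho>"
      by (rule continuous_on_subset[OF assms(1)]) (use u t(1) in \<open>auto simp: T_def\<close>)
    ultimately obtain v where v: "u \<le> v" "v \<le> b" "\<rho> v = c"
      using IVT2'[of \<rho> b c u] assms(3) u by force
    then have "v \<in> T" using u t(1) by (auto simp: T_def)
    then have "v \<le> t" by (rule t(2))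
    then have "v = u" using v u by linarith
    then show False using v \<open>\<not> \<rho> u \<le> c\<close> by simp
  qed
  with t(1) that show ?thesis by (auto simp: T_def)
qed

lemma first_time_at_level:
  fixes \<rho> :: "real \<Rightarrow> real"
  assumes "continuous_on {a..b} \<rho>" "a \<le> b" "\<rho> a \<le> c" "c \<le> \<rho> b"
  obtains t where "a \<le> t" "t \<le> b" "\<rho> t = c" "\<And>u. a \<le> u \<Longrightarrow> u \<le> t \<Longrightarrow> \<rho> u \<le> c"
proof -
  have "continuous_on {-b..-a} (\<lambda>u. \<rho> (- u))"
    by (rule continuous_on_compose2[OF assms(1)]) (auto intro!: continuous_intros)
  then obtain t where t: "-b \<le> t" "t \<le> -a" "\<rho> (- t) = c" "\<And>u. t \<le> u \<Longrightarrow> u \<le> -a \<Longrightarrow> \<rho> (- u) \<le> c"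
    using last_time_at_level[of "-b" "-a" "\<lambda>u. \<rho> (- u)" c] assms by auto
  show ?thesis using t(1-3) t(4)[of "- u" for u] by (intro that[of "-t"]) (auto simp: minus_le_iff)
qed

text \<open>Cutting at the level \<open>r * c\<^sup>2 / 4\<close> improves the constant \<open>c\<close> to \<open>1 + c\<^sup>2 / 4\<close>; iterating
  from \<open>c = 1\<close> gives \<open>2\<close> in the limit, the sharp constant of the parabolic collision orbit.\<close>

lemma collision_cost:
  fixes \<rho> :: "real \<Rightarrow> real" and Act :: "real \<Rightarrow> real \<Rightarrow> real"
  assumes cont: "continuous_on {a..b} \<rho>" and "\<rho> b = 0" and "K \<ge> 0"
    and add: "\<And>s t. a \<le> s \<Longrightarrow> s \<le> t \<Longrightarrow> t \<le> b \<Longrightarrow> Act s b = Act s t + Act t b"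
    and step: "\<And>s t R. a \<le> s \<Longrightarrow> s \<le> t \<Longrightarrow> t \<le> b \<Longrightarrow> R > 0 \<Longrightarrow> (\<And>u. s \<le> u \<Longrightarrow> u \<le> t \<Longrightarrow> \<rho> u \<le> R) \<Longrightarrow>
        K * \<bar>\<rho> t - \<rho> s\<bar> / sqrt R - l * \<bar>\<rho> t - \<rho> s\<bar> \<le> Act s t"
    and "a \<le> b" "\<rho> a = r" "r > 0" "\<And>u. a \<le> u \<Longrightarrow> u \<le> b \<Longrightarrow> \<rho> u \<le> r"
  shows "2 * K * sqrt r - l * r \<le> Act a b"
proof -
  \<comment> \<open>An explicit minorant of the iteration of \<open>1 + c^2 / 4\<close> from
    \<open>c = 1\<close>: with \<open>c = 2 - e\<close> the error becomes
    \<open>e - e^2 / 4\<close>, and for \<open>e = 4 / k\<close> this is at most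
    \<open>4 / (k + 1)\<close>.\<close>
  have claim: "(2 - 4 / (real n + 4)) * (K * sqrt r) - l * r \<le> Act s b"
    if "a \<le> s" "s \<le> b" "\<rho> s = r" "r > 0" "\<And>u. s \<le> u \<Longrightarrow> u \<le> b \<Longrightarrow> \<rho> u \<le> r" for n s r
    using that
  proof (induction n arbitrary: s r)
    case 0
    have "K * r / sqrt r - l * r \<le> Act s b"
      using step[of s b r] 0 assms(2) by auto
    moreover have "K * r / sqrt r = K * sqrt r" using \<open>r > 0\<close> real_div_sqrt[of r] by (metis less_imp_le times_divide_eq_right)
    ultimately show ?case by simp
  next
    case (Suc n)
    define c where "c = 2 - 4 / (real n + 4)"
    \<comment> \<open>The part from radius \<open>r\<close> to \<open>r * y\<close> contributes
      \<open>K * sqrt r * (1 - y)\<close>, the rest \<open>c * K * sqrt r * sqrt y\<close>. The sum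
      \<open>1 - y + c * sqrt y\<close> is largest at \<open>sqrt y = c / 2\<close>.\<close>
    define y where "y = c\<^sup>2 / 4"
    have c: "c \<ge> 1" "c \<le> 2" by (auto simp: c_def divide_simps)
    have "c\<^sup>2 \<le> 2\<^sup>2" using c by (intro power_mono) auto
    then have y: "y > 0" "y \<le> 1" using c by (auto simp: y_def)
    have "sqrt y = sqrt ((c / 2)\<^sup>2)" by (simp add: y_def power_divide)
    then have sqrt_y: "sqrt y = c / 2" using c by simp
    have "r * y \<le> r" using y(2) Suc.prems(4) by (simp add: mult_left_le)
    obtain t where t: "s \<le> t" "t \<le> b" "\<rho> t = r * y" "\<And>u. t \<le> u \<Longrightarrow> u \<le> b \<Longrightarrow> \<rho> u \<le> r * y"
    proof (rule last_time_at_level[of s b \<rho> "r * y"])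
      show "continuous_on {s..b} \<rho>" by (rule continuous_on_subset[OF cont]) (use Suc.prems in auto)
      show "\<rho> b \<le> r * y" using assms(2) Suc.prems(4) y by simp
    qed (use Suc.prems \<open>r * y \<le> r\<close> in auto)
    have 1: "K * (r - r * y) / sqrt r - l * (r - r * y) \<le> Act s t"
      using step[of s t r] Suc.prems t \<open>r * y \<le> r\<close> by simp
    have 2: "c * (K * sqrt (r * y)) - l * (r * y) \<le> Act t b"
      unfolding c_def by (rule Suc.IH) (use t Suc.prems y in auto)
    have e1: "K * (r - r * y) / sqrt r = K * sqrt r * (1 - y)"
      using Suc.prems(4) by (simp add: field_simps)
    have e2: "c * (K * sqrt (r * y)) = K * sqrt r * (2 * y)"
      by (simp only: real_sqrt_mult sqrt_y) (simp add: y_def power2_eq_square)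
    have "K * sqrt r * (1 + y) - l * r \<le> Act s b"
      using 1[unfolded e1] 2[unfolded e2] add[of s t] t Suc.prems(1) by (simp add: algebra_simps)
    moreover have "2 - 4 / (real (Suc n) + 4) \<le> 1 + y"
    proof -
      define k where "k = real n + 4"
      have k: "k > 0" by (simp add: k_def)
      have "1 + y - (2 - 4 / (k + 1)) = 4 / (k\<^sup>2 * (k + 1))"
        unfolding y_def c_def k_def[symmetric] using k by (simp add: field_simps power2_eq_square) 
      moreover have "\<dots> \<ge> 0" using k by simp
      ultimately have "2 - 4 / (k + 1) \<le> 1 + y" by linarith
      then show ?thesis by (simp add: k_def algebra_simps)
    qed
    then have "(2 - 4 / (real (Suc n) + 4)) * (K * sqrt r) \<le> (1 + y) * (K * sqrt r)"
      using assms(3) Suc.prems by (intro mult_right_mono) auto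
    ultimately show ?case by (simp add: algebra_simps)
  qed
  have "(\<lambda>n. 4 / (real n + 4)) \<longlonglongrightarrow> 0"
    using LIMSEQ_ignore_initial_segment[OF lim_const_over_n[of "4::real"], of 4] by simp
  then have "(\<lambda>n. (2 - 4 / (real n + 4)) * (K * sqrt r) - l * r) \<longlonglongrightarrow> (2 - 0) * (K * sqrt r) - l * r"
    by (intro tendsto_intros)
  then have "(2 - 0) * (K * sqrt r) - l * r \<le> Act a b"
    by (rule LIMSEQ_le_const2) (use claim[OF order_refl \<open>a \<le> b\<close> assms(7-9)] in blast)
  then show ?thesis by simp
qed

section \<open>Comparison paths near a centre, and the absence of collisions\<close>

context moving_centers
begin

lemma m_nonneg: "i \<in> I \<Longrightarrow> 0 \<le> m i"
  using m_pos by (simp add: less_imp_le)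

lemma other_centers_far:
  assumes "i \<in> I" "j \<in> I" "j \<noteq> i" "norm (y - p i t) \<le> d / 2"
  shows "d / 2 \<le> norm (y - p j t)"
proof -
  have "d \<le> norm (p j t - p i t)" using p_separated assms by blast
  also have "\<dots> \<le> norm (y - p i t) + norm (y - p j t)"
    using norm_triangle_ineq4[of "y - p i t" "y - p j t"] by (simp add: algebra_simps)
  finally show ?thesis using assms(4) by linarith
qed

lemma potential_near_center:
  assumes "i \<in> I" "norm (y - p i t) \<le> d / 2"
  shows "potential t y = ennreal (2 * m i) / ennreal (norm (y - p i t))
     + ennreal (\<Sum>j\<in>I - {i}. 2 * m j / norm (y - p j t))"
proof -
  have "(\<Sum>j\<in>I - {i}. ennreal (2 * m j) / ennreal (norm (y - p j t)))
      = (\<Sum>j\<in>I - {i}. ennreal (2 * m j / norm (y - p j t)))"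
  proof (rule sum.cong)
    fix j assume j: "j \<in> I - {i}"
    then have "0 < norm (y - p j t)" using other_centers_far[of i j y t] assms d_pos by fastforce
    then show "ennreal (2 * m j) / ennreal (norm (y - p j t)) = ennreal (2 * m j / norm (y - p j t))"
      using m_pos[of j] j by (intro divide_ennreal) auto
  qed simp
  also have "\<dots> = ennreal (\<Sum>j\<in>I - {i}. 2 * m j / norm (y - p j t))"
    by (intro sum_ennreal) (auto simp: m_nonneg)
  finally show ?thesis
    unfolding potential_def by (subst sum.remove[OF finite_I assms(1)]) simp
qed

lemma potential_le_near_center:
  assumes "i \<in> I" "norm (y - p i t) = r" "0 < r" "r \<le> d / 2"
  shows "potential t y \<le> ennreal (2 * m i / r + (\<Sum>j\<in>I. 4 * m j / d))"
proof -
  have nonneg: "0 \<le> 4 * m j / d" if "j \<in> I" for j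
    using m_pos[OF that] d_pos by simp
  have "(\<Sum>j\<in>I - {i}. 2 * m j / norm (y - p j t)) \<le> (\<Sum>j\<in>I - {i}. 4 * m j / d)"
  proof (rule sum_mono)
    fix j assume j: "j \<in> I - {i}"
    then have "d / 2 \<le> norm (y - p j t)" using other_centers_far[of i j y t] assms by auto
    moreover from this d_pos have "0 < norm (y - p j t)" by linarith
    ultimately have "2 * m j / norm (y - p j t) \<le> 2 * m j / (d / 2)"
      using m_pos[of j] j d_pos by (intro divide_left_mono mult_pos_pos) auto
    then show "2 * m j / norm (y - p j t) \<le> 4 * m j / d" by simp
  qed
  also have "\<dots> \<le> (\<Sum>j\<in>I. 4 * m j / d)" using finite_I nonneg by (intro sum_mono2) auto
  finally have *: "(\<Sum>j\<in>I - {i}. 2 * m j / norm (y - p j t)) \<le> (\<Sum>j\<in>I. 4 * m j / d)" .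
  have nn: "0 \<le> (\<Sum>j\<in>I. 4 * m j / d)" by (intro sum_nonneg nonneg)
  have "potential t y = ennreal (2 * m i / r) + ennreal (\<Sum>j\<in>I - {i}. 2 * m j / norm (y - p j t))"
    using potential_near_center[of i y t] assms m_pos[OF assms(1)] by (simp add: divide_ennreal)
  also have "\<dots> \<le> ennreal (2 * m i / r) + ennreal (\<Sum>j\<in>I. 4 * m j / d)"
    using * by (intro add_left_mono ennreal_leI)
  also have "\<dots> = ennreal (2 * m i / r + (\<Sum>j\<in>I. 4 * m j / d))"
    using m_pos[OF assms(1)] assms nn by (intro ennreal_plus[symmetric]) auto
  finally show ?thesis .
qed

text \<open>The singular term depends only on the position relative to centre \<open>i\<close>,
  which is the same at both times. The distance to another centre changes by at most
  \<open>2 * L\<close> per unit time and is at least \<open>d / 2\<close> throughout, so its term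
  \<open>2 * m j / norm _\<close> changes by at most \<open>2 * m j * 2 * L / (d / 2)^2\<close> per
  unit time.\<close>

lemma potential_comoving_le:
  assumes "i \<in> I" "y - p i t = y' - p i s" "norm (y - p i t) \<le> d / 2"
  shows "potential t y \<le> potential s y' + ennreal ((\<Sum>j\<in>I. 16 * m j * L / d\<^sup>2) * \<bar>t - s\<bar>)"
proof -
  define \<Delta> where "\<Delta> = \<bar>t - s\<bar>"
  have nonneg: "0 \<le> 16 * m j * L / d\<^sup>2 * \<Delta>" if "j \<in> I" for j
    using m_pos[OF that] L_nonneg by (simp add: \<Delta>_def)
  have "(\<Sum>j\<in>I - {i}. 2 * m j / norm (y - p j t))
      \<le> (\<Sum>j\<in>I - {i}. 2 * m j / norm (y' - p j s) + 16 * m j * L / d\<^sup>2 * \<Delta>)"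
  proof (rule sum_mono)
    fix j assume j: "j \<in> I - {i}"
    define \<alpha> \<beta> where "\<alpha> = norm (y - p j t)" and "\<beta> = norm (y' - p j s)"
    have ab: "d / 2 \<le> \<alpha>" "d / 2 \<le> \<beta>"
      using other_centers_far[of i j y t] other_centers_far[of i j y' s] assms j by (auto simp: \<alpha>_def \<beta>_def)
    have "y = y' - p i s + p i t" using assms(2) by (simp add: algebra_simps)
    then have "(y' - p j s) - (y - p j t) = (p j t - p j s) - (p i t - p i s)" by simp
    then have "\<beta> - \<alpha> \<le> norm ((p j t - p j s) - (p i t - p i s))"
      unfolding \<alpha>_def \<beta>_def by (metis norm_triangle_ineq2)
    also have "\<dots> \<le> norm (p j t - p j s) + norm (p i t - p i s)" by (rule norm_triangle_ineq4)
    also have "\<dots> \<le> L * \<Delta> + L * \<Delta>" unfolding \<Delta>_def using j assms(1) by (intro add_mono p_Lipschitz) auto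
    finally have d1: "\<beta> - \<alpha> \<le> 2 * L * \<Delta>" by simp
    have pos: "\<alpha> > 0" "\<beta> > 0" using ab d_pos by linarith+
    have "1 / \<alpha> - 1 / \<beta> = (\<beta> - \<alpha>) / (\<alpha> * \<beta>)" using pos by (simp add: field_simps)
    also have "\<dots> \<le> (2 * L * \<Delta>) / (\<alpha> * \<beta>)" using d1 pos by (intro divide_right_mono) auto
    also have "\<dots> \<le> (2 * L * \<Delta>) / (d / 2 * (d / 2))"
      using ab d_pos pos L_nonneg by (intro divide_left_mono mult_mono) (auto simp: \<Delta>_def)
    also have "\<dots> = 8 * L / d\<^sup>2 * \<Delta>" by (simp add: power2_eq_square)
    finally have "1 / \<alpha> \<le> 1 / \<beta> + 8 * L / d\<^sup>2 * \<Delta>" by simp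
    then have "2 * m j * (1 / \<alpha>) \<le> 2 * m j * (1 / \<beta> + 8 * L / d\<^sup>2 * \<Delta>)"
      using m_pos[of j] j by (intro mult_left_mono) auto
    then show "2 * m j / norm (y - p j t) \<le> 2 * m j / norm (y' - p j s) + 16 * m j * L / d\<^sup>2 * \<Delta>"
      by (simp add: \<alpha>_def \<beta>_def algebra_simps)
  qed
  also have "\<dots> \<le> (\<Sum>j\<in>I - {i}. 2 * m j / norm (y' - p j s)) + (\<Sum>j\<in>I. 16 * m j * L / d\<^sup>2 * \<Delta>)"
    unfolding sum.distrib using finite_I nonneg by (intro add_left_mono sum_mono2) auto
  finally have *: "(\<Sum>j\<in>I - {i}. 2 * m j / norm (y - p j t))
      \<le> (\<Sum>j\<in>I - {i}. 2 * m j / norm (y' - p j s)) + (\<Sum>j\<in>I. 16 * m j * L / d\<^sup>2) * \<Delta>"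
    by (simp add: sum_distrib_right)
  have nn: "0 \<le> (\<Sum>j\<in>I - {i}. 2 * m j / norm (y' - p j s))"
    by (intro sum_nonneg) (auto simp: m_nonneg)
  have "0 \<le> (\<Sum>j\<in>I. 16 * m j * L / d\<^sup>2) * \<Delta>"
    unfolding sum_distrib_right by (intro sum_nonneg nonneg)
  with * nn have "ennreal (\<Sum>j\<in>I - {i}. 2 * m j / norm (y - p j t))
      \<le> ennreal (\<Sum>j\<in>I - {i}. 2 * m j / norm (y' - p j s)) + ennreal ((\<Sum>j\<in>I. 16 * m j * L / d\<^sup>2) * \<Delta>)"
    using ennreal_leI[OF *] by (simp only: ennreal_plus)
  then show ?thesis
    using potential_near_center[of i y t] potential_near_center[of i y' s] assms
    by (simp add: \<Delta>_def add.assoc add_left_mono)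
qed

text \<open>Seen from centre \<open>i\<close>, the stretch of \<open>w\<close> on
  \<open>{a..b}\<close> is run on \<open>{a'..b}\<close> instead, rejoining \<open>w\<close> at
  \<open>b\<close>. The condition on intermediate times keeps the new path as near to the centre as
  \<open>w\<close>, so that it can serve as a competitor.\<close>

definition comoving_extension ::
    "(real \<Rightarrow> complex) \<Rightarrow> 'i \<Rightarrow> real \<Rightarrow> real \<Rightarrow> real \<Rightarrow> real \<Rightarrow> bool" where
  "comoving_extension w i c b a a' \<longleftrightarrow>
    (\<exists>g. continuous_on UNIV g \<and> g b = w b \<and> g a' = w a - p i a + p i a' \<and>
      (\<forall>t. a' \<le> t \<longrightarrow> t \<le> b \<longrightarrow> (\<exists>s. a \<le> s \<and> s \<le> b \<and> g t - p i t = w s - p i s)) \<and>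
      action g {a'..b} \<le> action w {a..b} + ennreal (c * \<bar>a' - a\<bar>))"

text \<open>The relative motion is composed with the affine \<open>\<phi>\<close> that fixes
  \<open>b\<close> and sends \<open>a'\<close> to \<open>a\<close>. Since \<open>hi < b\<close>,
  both intervals are at least as long as \<open>\<eta>\<close>, so \<open>\<phi>\<close> differs
  from the identity by an amount linear in \<open>\<bar>a' - a\<bar>\<close>, uniformly in
  \<open>a\<close> and \<open>a'\<close>; every error term inherits this.\<close>

lemma action_comoving_reparametrization:
  assumes i: "i \<in> I" and w: "continuous_on UNIV w" and lo: "lo \<le> hi" "hi < b"
    and near: "\<And>t. lo \<le> t \<Longrightarrow> t \<le> b \<Longrightarrow> norm (w t - p i t) \<le> d / 2"
    and fin: "action w {lo..b} < \<infinity>"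
  obtains C1 where "C1 \<ge> 0" and "\<And>a a'. lo \<le> a \<Longrightarrow> a \<le> hi \<Longrightarrow> lo \<le> a' \<Longrightarrow> a' \<le> hi \<Longrightarrow>
    comoving_extension w i C1 b a a'"
proof -
  define \<eta> where "\<eta> = b - hi"
  define \<Delta> where "\<Delta> = b - lo"
  define k where "k = C + L / \<eta>"
  define k2 where "k2 = (\<Sum>j\<in>I. 16 * m j * L / d\<^sup>2)"
  obtain A where A: "A \<ge> 0" "action w {lo..b} = ennreal A"
    using fin by (cases "action w {lo..b}") auto
  have \<eta>: "\<eta> > 0" "\<eta> \<le> \<Delta>" using lo by (auto simp: \<eta>_def \<Delta>_def)
  have k: "k \<ge> 0" using C_nonneg L_nonneg \<eta> by (simp add: k_def)
  have k2: "k2 \<ge> 0" unfolding k2_def by (intro sum_nonneg) (auto simp: m_nonneg L_nonneg)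
  define k1 where "k1 = k + 1 / \<eta> + k * \<Delta> / \<eta>"
  have k1: "k1 \<ge> 1 / \<eta>" "k1 \<ge> 0" using k \<eta> by (auto simp: k1_def)
  define C1 where "C1 = k1 * A + (k + k\<^sup>2 * \<Delta>) * \<Delta> + k2 * \<Delta>"
  show thesis
  proof (rule that[of C1])
    show "C1 \<ge> 0" using k1 A k k2 \<eta> by (auto simp: C1_def intro!: add_nonneg_nonneg mult_nonneg_nonneg)
    fix a a' assume a: "lo \<le> a" "a \<le> hi" "lo \<le> a'" "a' \<le> hi"
    define \<delta> where "\<delta> = \<bar>a' - a\<bar>"
    define \<sigma> where "\<sigma> = (b - a) / (b - a')"
    define c where "c = b - \<sigma> * b"
    define \<phi> where "\<phi> t = c + \<sigma> * t" for t
    have ab: "\<eta> \<le> b - a" "\<eta> \<le> b - a'" "b - a' \<le> \<Delta>" "b - a \<le> \<Delta>" using a by (auto simp: \<eta>_def \<Delta>_def)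
    have \<delta>: "0 \<le> \<delta>" "\<delta> \<le> \<Delta>" using a lo by (auto simp: \<delta>_def \<Delta>_def)
    have \<sigma>: "\<sigma> > 0" using ab \<eta> by (simp add: \<sigma>_def)
    have \<phi>b: "\<phi> b = b" by (simp add: \<phi>_def c_def)
    have \<phi>_eq: "\<phi> t = b - \<sigma> * (b - t)" for t by (simp add: \<phi>_def c_def algebra_simps)
    have \<phi>a: "\<phi> a' = a" using ab \<eta> by (simp add: \<phi>_eq \<sigma>_def)
    have \<phi>_range: "a \<le> \<phi> t" "\<phi> t \<le> b" if "a' \<le> t" "t \<le> b" for t
    proof -
      have "\<sigma> * (b - t) \<le> \<sigma> * (b - a')" using \<sigma> that by (intro mult_left_mono) auto
      then show "a \<le> \<phi> t" using \<phi>a by (simp add: \<phi>_eq)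
      show "\<phi> t \<le> b" using \<sigma> that by (simp add: \<phi>_eq)
    qed
    have "\<sigma> - 1 = (a' - a) / (b - a')" using ab \<eta> by (simp add: \<sigma>_def field_simps)
    then have s1: "\<bar>\<sigma> - 1\<bar> = \<delta> / (b - a')" using ab \<eta> by (simp add: \<delta>_def abs_divide)
    then have s2: "\<bar>\<sigma> - 1\<bar> \<le> \<delta> / \<eta>" using ab \<eta> \<delta> by (auto intro!: divide_left_mono)
    have "1 / \<sigma> - 1 = (a - a') / (b - a)" using ab \<eta> by (simp add: \<sigma>_def field_simps)
    then have "1 / \<sigma> - 1 \<le> \<delta> / (b - a)" using ab \<eta> by (auto simp: \<delta>_def intro!: divide_right_mono)
    also have "\<dots> \<le> \<delta> / \<eta>" using ab \<eta> \<delta> by (intro divide_left_mono) auto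
    finally have s3: "1 / \<sigma> \<le> 1 + \<delta> / \<eta>" by simp
    have \<phi>_diff: "\<bar>t - \<phi> t\<bar> \<le> \<delta>" if "a' \<le> t" "t \<le> b" for t
    proof -
      have eq: "(\<sigma> - 1) * (b - t) = t - \<phi> t" by (simp add: \<phi>_eq algebra_simps)
      have "\<bar>t - \<phi> t\<bar> = \<bar>\<sigma> - 1\<bar> * (b - t)"
        using that by (simp add: abs_mult flip: eq)
      also have "\<dots> \<le> \<bar>\<sigma> - 1\<bar> * (b - a')" using that by (intro mult_left_mono) auto
      also have "\<dots> = \<delta>" using s1 ab \<eta> by simp
      finally show ?thesis .
    qed
    define g where "g t = w (\<phi> t) - p i (\<phi> t) + p i t" for t
    have g_cont: "continuous_on UNIV g"
      unfolding g_def \<phi>_def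
      by (intro continuous_intros continuous_on_compose2[OF w] continuous_on_compose2[OF p_continuous[OF i, of UNIV]] p_continuous[OF i]) auto
    define \<kappa> where "\<kappa> = k * \<delta>"
    have \<kappa>: "\<kappa> \<ge> 0" using k \<delta> by (simp add: \<kappa>_def)
    have dev: "norm ((g t - g s) - (w (c + \<sigma> * t) - w (c + \<sigma> * s))) \<le> \<kappa> * (t - s)"
      if "a' \<le> s" "s \<le> t" "t \<le> b" for s t
    proof -
      \<comment> \<open>\<open>h\<close> is the deviation of \<open>g\<close> from the
        reparametrised \<open>w\<close>. Its derivative is small of order \<open>\<delta>\<close>
        because the velocity of the centre is \<open>C\<close>-Lipschitz and the slope
        \<open>\<sigma>\<close> is near 1; a bound on the velocity alone would not give
        this.\<close>
      define h where "h t = p i t - p i (\<phi> t)" for t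
      have h: "(h has_vector_derivative (p' i t - \<sigma> *\<^sub>R p' i (\<phi> t))) (at t within {a'..b})" for t
      proof -
        have "(\<phi> has_vector_derivative \<sigma>) (at t)"
          unfolding \<phi>_def by (auto intro!: derivative_eq_intros)
        then have "((p i \<circ> \<phi>) has_vector_derivative \<sigma> *\<^sub>R p' i (\<phi> t)) (at t)"
          by (rule vector_diff_chain_at) (rule p_deriv[OF i])
        from has_vector_derivative_diff[OF p_deriv[OF i, of t] this] show ?thesis
          unfolding h_def o_def by (rule has_vector_derivative_at_within)
      qed
      have "norm (h t - h s) \<le> \<kappa> * \<bar>t - s\<bar>"
      proof (rule has_vector_derivative_diff_bound[OF _ h])
        fix u assume u: "u \<in> {a'..b}"
        have "norm (p' i u - \<sigma> *\<^sub>R p' i (\<phi> u)) = norm ((p' i u - p' i (\<phi> u)) - (\<sigma> - 1) *\<^sub>R p' i (\<phi> u))"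
          by (simp add: algebra_simps)
        also have "\<dots> \<le> norm (p' i u - p' i (\<phi> u)) + norm ((\<sigma> - 1) *\<^sub>R p' i (\<phi> u))"
          by (rule norm_triangle_ineq4)
        also have "\<dots> \<le> C * \<bar>u - \<phi> u\<bar> + \<bar>\<sigma> - 1\<bar> * L"
          using p'_Lipschitz[OF i] p'_le[OF i] by (auto intro!: add_mono mult_left_mono)
        also have "\<dots> \<le> C * \<delta> + \<delta> / \<eta> * L"
          using \<phi>_diff[of u] u s2 C_nonneg L_nonneg by (intro add_mono mult_left_mono mult_right_mono) auto
        also have "\<dots> = \<kappa>" by (simp add: \<kappa>_def k_def algebra_simps)
        finally show "norm (p' i u - \<sigma> *\<^sub>R p' i (\<phi> u)) \<le> \<kappa>" .
      qed (use that in auto)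
      moreover have "(g t - g s) - (w (c + \<sigma> * t) - w (c + \<sigma> * s)) = h t - h s"
        by (simp add: g_def h_def \<phi>_def)
      ultimately show ?thesis using that by simp
    qed
    obtain e where e: "e \<ge> 0" "energy w {a..b} = ennreal e"
    proof -
      have "energy w {a..b} \<le> action w {lo..b}"
        unfolding action_def using energy_mono[of "{a..b}" "{lo..b}" w] a by (auto intro: order_trans)
      then have "energy w {a..b} < \<infinity>" using A by (simp add: order_le_less_trans)
      then show ?thesis using that by (cases "energy w {a..b}") auto
    qed
    obtain q where q: "q \<ge> 0" "potential_integral w {a..b} = ennreal q"
    proof -
      have "potential_integral w {a..b} \<le> potential_integral w {lo..b}"
        using a by (intro nn_integral_mono mult_left_mono) (auto simp: indicator_def)
      also have "\<dots> \<le> action w {lo..b}" by (simp add: action_def)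
      finally have "potential_integral w {a..b} < \<infinity>" using A by (simp add: order_le_less_trans)
      then show ?thesis using that by (cases "potential_integral w {a..b}") auto
    qed
    have act: "action w {a..b} = ennreal (e + q)" using e q by (simp add: action_def)
    have "action w {a..b} \<le> action w {lo..b}"
      using action_split[OF w a(1), of b] a lo by simp
    then have eA: "e + q \<le> A" unfolding act A(2) by (rule iffD1[OF ennreal_le_iff[OF A(1)]])
    have energy_g: "energy g {a'..b} \<le> ennreal ((1 + \<kappa>) * \<sigma> * e + (\<kappa> + \<kappa>\<^sup>2) * (b - a'))"
    proof -
      have "energy g {a'..b} \<le> ennreal ((1 + \<kappa>) * \<sigma>) * energy w {\<phi> a'..\<phi> b} + ennreal ((\<kappa> + \<kappa>\<^sup>2) * (b - a'))"
        unfolding \<phi>_def using ab \<eta> by (intro energy_reparametrize_le \<sigma> \<kappa> dev) auto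
      also have "\<dots> = ennreal ((1 + \<kappa>) * \<sigma> * e + (\<kappa> + \<kappa>\<^sup>2) * (b - a'))"
        using e \<kappa> \<sigma> ab \<eta> by (subst ennreal_plus) (auto simp: \<phi>a \<phi>b ennreal_mult)
      finally show ?thesis .
    qed
    have pot_g: "potential_integral g {a'..b} \<le> ennreal (q / \<sigma> + k2 * \<delta> * (b - a'))"
    proof -
      let ?F = "\<lambda>s. potential s (w s) * indicator {a..b} s"
      have [measurable]: "?F \<in> borel_measurable borel" using measurable_potential[OF w] by measurable
      have [measurable]: "(\<lambda>t. ?F (c + \<sigma> * t)) \<in> borel_measurable borel" by measurable
      have "potential_integral g {a'..b}
         \<le> (\<integral>\<^sup>+t. ?F (c + \<sigma> * t) + ennreal (k2 * \<delta>) * indicator {a'..b} t \<partial>lborel)"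
      proof (rule nn_integral_mono)
        fix t
        show "potential t (g t) * indicator {a'..b} t \<le> ?F (c + \<sigma> * t) + ennreal (k2 * \<delta>) * indicator {a'..b} t"
        proof (cases "t \<in> {a'..b}")
          case True
          then have r: "a \<le> \<phi> t" "\<phi> t \<le> b" using \<phi>_range by auto
          have "potential t (g t) \<le> potential (\<phi> t) (w (\<phi> t)) + ennreal (k2 * \<bar>t - \<phi> t\<bar>)"
            unfolding k2_def using near[of "\<phi> t"] r a by (intro potential_comoving_le[OF i]) (auto simp: g_def)
          also have "\<dots> \<le> potential (\<phi> t) (w (\<phi> t)) + ennreal (k2 * \<delta>)"
            using \<phi>_diff[of t] True k2 by (intro add_left_mono ennreal_leI mult_left_mono) auto
          finally show ?thesis using True r by (simp add: \<phi>_def)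
        qed simp
      qed
      also have "\<dots> = (\<integral>\<^sup>+t. ?F (c + \<sigma> * t) \<partial>lborel) + ennreal (k2 * \<delta>) * ennreal (b - a')"
        using ab \<eta> by (subst nn_integral_add) (auto simp: nn_integral_cmult_indicator)
      also have "(\<integral>\<^sup>+t. ?F (c + \<sigma> * t) \<partial>lborel) = ennreal (q / \<sigma>)"
      proof -
        have "ennreal q = ennreal \<sigma> * (\<integral>\<^sup>+t. ?F (c + \<sigma> * t) \<partial>lborel)"
          using nn_integral_real_affine[of ?F \<sigma> c] \<sigma> q by simp
        then have "ennreal (1 / \<sigma>) * ennreal q = ennreal (1 / \<sigma>) * ennreal \<sigma> * (\<integral>\<^sup>+t. ?F (c + \<sigma> * t) \<partial>lborel)"
          by (simp add: mult.assoc)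
        then show ?thesis using \<sigma> q by (simp add: ennreal_mult'[symmetric])
      qed
      also have "ennreal (q / \<sigma>) + ennreal (k2 * \<delta>) * ennreal (b - a') = ennreal (q / \<sigma> + k2 * \<delta> * (b - a'))"
        using q \<sigma> k2 \<delta> ab \<eta> by (subst ennreal_plus) (auto simp: ennreal_mult)
      finally show ?thesis .
    qed
    have main: "((1 + \<kappa>) * \<sigma> * e + (\<kappa> + \<kappa>\<^sup>2) * (b - a')) + (q / \<sigma> + k2 * \<delta> * (b - a')) \<le> (e + q) + C1 * \<delta>"
    proof -
      have "(1 + \<kappa>) * \<sigma> \<le> (1 + \<kappa>) * (1 + \<delta> / \<eta>)"
        using s2 \<kappa> by (intro mult_left_mono) auto
      also have "\<dots> = 1 + \<delta> * (k + 1 / \<eta> + k * \<delta> / \<eta>)" by (simp add: \<kappa>_def algebra_simps)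
      also have "\<dots> \<le> 1 + \<delta> * k1"
        unfolding k1_def using \<delta> \<eta> k by (intro add_left_mono mult_left_mono divide_right_mono) auto
      finally have x1: "(1 + \<kappa>) * \<sigma> * e \<le> (1 + \<delta> * k1) * e" using e by (intro mult_right_mono) auto
      have "q / \<sigma> = 1 / \<sigma> * q" by simp
      also have "\<dots> \<le> (1 + \<delta> * k1) * q"
        using s3 k1(1) \<delta> q mult_left_mono[OF k1(1) \<delta>(1)] by (intro mult_right_mono) auto
      finally have x2: "q / \<sigma> \<le> (1 + \<delta> * k1) * q" .
      have "(\<kappa> + \<kappa>\<^sup>2) = \<delta> * (k + k\<^sup>2 * \<delta>)" by (simp add: \<kappa>_def power2_eq_square algebra_simps)
      also have "\<dots> \<le> \<delta> * (k + k\<^sup>2 * \<Delta>)" using \<delta> by (intro mult_left_mono add_left_mono) auto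
      finally have x3: "(\<kappa> + \<kappa>\<^sup>2) * (b - a') \<le> \<delta> * (k + k\<^sup>2 * \<Delta>) * \<Delta>"
        using ab \<eta> \<delta> k by (intro mult_mono) auto
      have x4: "k2 * \<delta> * (b - a') \<le> k2 * \<delta> * \<Delta>" using ab k2 \<delta> by (intro mult_left_mono) auto
      have x5: "\<delta> * k1 * (e + q) \<le> \<delta> * k1 * A" using eA \<delta> k1 by (intro mult_left_mono) auto
      have "C1 * \<delta> = \<delta> * k1 * A + \<delta> * (k + k\<^sup>2 * \<Delta>) * \<Delta> + k2 * \<delta> * \<Delta>"
        by (simp add: C1_def algebra_simps)
      moreover have "(1 + \<delta> * k1) * e + (1 + \<delta> * k1) * q = (e + q) + \<delta> * k1 * (e + q)"
        by (simp add: algebra_simps)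
      ultimately show ?thesis using x1 x2 x3 x4 x5 by linarith
    qed
    have "action g {a'..b} \<le> ennreal ((1 + \<kappa>) * \<sigma> * e + (\<kappa> + \<kappa>\<^sup>2) * (b - a')) + ennreal (q / \<sigma> + k2 * \<delta> * (b - a'))"
      unfolding action_def using energy_g pot_g by (rule add_mono)
    also have "\<dots> = ennreal (((1 + \<kappa>) * \<sigma> * e + (\<kappa> + \<kappa>\<^sup>2) * (b - a')) + (q / \<sigma> + k2 * \<delta> * (b - a')))"
      using \<kappa> \<sigma> e q ab \<eta> k2 \<delta> by (intro ennreal_plus[symmetric]) auto
    also have "\<dots> \<le> ennreal ((e + q) + C1 * \<delta>)" using main by (rule ennreal_leI)
    also have "\<dots> = action w {a..b} + ennreal (C1 * \<bar>a' - a\<bar>)"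
      unfolding act \<delta>_def using e q \<open>C1 \<ge> 0\<close> by (subst ennreal_plus) auto
    finally have "action g {a'..b} \<le> action w {a..b} + ennreal (C1 * \<bar>a' - a\<bar>)" .
    moreover have "\<exists>s. a \<le> s \<and> s \<le> b \<and> g t - p i t = w s - p i s" if "a' \<le> t" "t \<le> b" for t
      using \<phi>_range[OF that] by (intro exI[of _ "\<phi> t"]) (simp add: g_def)
    ultimately show "comoving_extension w i C1 b a a'"
      unfolding comoving_extension_def using g_cont by (intro exI[of _ g]) (auto simp: g_def \<phi>a \<phi>b)
  qed
qed

end

lemma norm_cis_diff_le: "norm (cis x - cis y) \<le> \<bar>x - y\<bar>"
proof -
  have "(cis has_vector_derivative \<i> * cis t) (at t)" for t
    unfolding has_vector_derivative_def by (auto intro!: derivative_eq_intros)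
  then have "norm (cis x - cis y) \<le> 1 * \<bar>x - y\<bar>"
    by (intro has_vector_derivative_diff_bound[of UNIV cis "\<lambda>t. \<i> * cis t"]) (auto simp: norm_mult)
  then show ?thesis by simp
qed

lemma continuous_on_if_le:
  fixes f g :: "real \<Rightarrow> 'a::topological_space"
  assumes "continuous_on UNIV f" "continuous_on UNIV g" "f c = g c"
  shows "continuous_on UNIV (\<lambda>t. if t \<le> c then f t else g t)"
  using assms by (intro continuous_on_cases_le) (auto intro: continuous_on_subset)

context moving_centers
begin

lemma action_cong: "(\<And>t. t \<in> S \<Longrightarrow> f t = g t) \<Longrightarrow> action f S = action g S"
  unfolding action_def by (intro arg_cong2[where f = "(+)"] energy_cong nn_integral_cong) (auto simp: indicator_def)

text \<open>Uniform rotation about the moving centre. As \<open>\<bar>Arg _\<bar>\<close> is at most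
  \<open>pi\<close>, it takes the shorter way round, so the speed relative to the centre is at most
  \<open>pi * r / T\<close>.\<close>

lemma collision_arc:
  assumes i: "i \<in> I" and r: "0 < r" "r \<le> d / 2" "norm \<alpha> = r" "norm \<beta> = r" and T: "T > 0"
  obtains g where "continuous_on UNIV g" "g s = p i s + \<alpha>" "g (s + T) = p i (s + T) + \<beta>"
    "\<And>t. norm (g t - p i t) = r"
    "action g {s..s + T} \<le> ennreal ((pi * r / T + L)\<^sup>2 * T + (2 * m i / r + (\<Sum>j\<in>I. 4 * m j / d)) * T)"
proof -
  define \<omega> where "\<omega> = Arg (\<beta> / \<alpha>)"
  have \<alpha>: "\<alpha> \<noteq> 0" "\<beta> \<noteq> 0" using r by auto
  have "cis \<omega> = sgn (\<beta> / \<alpha>)" unfolding \<omega>_def using \<alpha> by (intro cis_Arg) auto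
  then have rot: "\<alpha> * cis \<omega> = \<beta>" using \<alpha> r by (simp add: sgn_div_norm norm_divide)
  have \<omega>: "\<bar>\<omega>\<bar> \<le> pi" using Arg_bounded[of "\<beta> / \<alpha>"] by (auto simp: \<omega>_def)
  define g where "g t = p i t + \<alpha> * cis (\<omega> * (t - s) / T)" for t
  have cont: "continuous_on UNIV g"
    unfolding g_def by (intro continuous_intros p_continuous[OF i]) (use T in auto)
  have gn: "norm (g t - p i t) = r" for t using r by (simp add: g_def norm_mult)
  have Mo: "0 \<le> (\<Sum>j\<in>I. 4 * m j / d)" using d_pos by (intro sum_nonneg) (auto simp: m_nonneg)
  have lip: "norm (g t - g u) \<le> (pi * r / T + L) * (t - u)" if "u \<le> t" for t u
  proof -
    have "g t - g u = (p i t - p i u) + \<alpha> * (cis (\<omega> * (t - s) / T) - cis (\<omega> * (u - s) / T))"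
      by (simp add: g_def algebra_simps)
    then have "norm (g t - g u) \<le> norm (p i t - p i u) + r * norm (cis (\<omega> * (t - s) / T) - cis (\<omega> * (u - s) / T))"
      using norm_triangle_ineq[of "p i t - p i u"] r by (metis norm_mult)
    also have "\<dots> \<le> L * \<bar>t - u\<bar> + r * \<bar>\<omega> * (t - s) / T - \<omega> * (u - s) / T\<bar>"
      using r by (intro add_mono p_Lipschitz[OF i] mult_left_mono norm_cis_diff_le) auto
    also have "\<omega> * (t - s) / T - \<omega> * (u - s) / T = \<omega> * (t - u) / T"
      by (simp add: diff_divide_distrib[symmetric] algebra_simps)
    also have "r * \<bar>\<omega> * (t - u) / T\<bar> \<le> r * (pi * (t - u) / T)"
      using r T that \<omega> by (intro mult_left_mono) (auto simp: abs_mult abs_divide intro!: divide_right_mono mult_right_mono)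
    finally show ?thesis using that by (simp add: algebra_simps)
  qed
  have "energy g {s..s + T} \<le> ennreal ((pi * r / T + L)\<^sup>2 * (s + T - s))"
    using T lip by (intro energy_le_Lipschitz) auto
  moreover have "potential_integral g {s..s + T}
      \<le> ennreal ((2 * m i / r + (\<Sum>j\<in>I. 4 * m j / d)) * T)"
  proof -
    let ?P = "2 * m i / r + (\<Sum>j\<in>I. 4 * m j / d)"
    have P: "?P \<ge> 0" using Mo r m_nonneg[OF i] by simp
    have "potential_integral g {s..s + T}
       \<le> (\<integral>\<^sup>+t\<in>{s..s + T}. ennreal ?P \<partial>lborel)"
      by (intro nn_integral_mono mult_right_mono potential_le_near_center[OF i gn r(1,2)]) auto
    also have "\<dots> = ennreal (?P * T)" using T P by (simp add: nn_integral_cmult_indicator ennreal_mult)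
    finally show ?thesis .
  qed
  ultimately have "action g {s..s + T} \<le> ennreal ((pi * r / T + L)\<^sup>2 * T) + ennreal ((2 * m i / r + (\<Sum>j\<in>I. 4 * m j / d)) * T)"
    unfolding action_def by (intro add_mono) auto
  also have "\<dots> = ennreal ((pi * r / T + L)\<^sup>2 * T + (2 * m i / r + (\<Sum>j\<in>I. 4 * m j / d)) * T)"
    using T Mo r m_nonneg[OF i] by (intro ennreal_plus[symmetric]) auto
  finally have act: "action g {s..s + T} \<le> ennreal ((pi * r / T + L)\<^sup>2 * T + (2 * m i / r + (\<Sum>j\<in>I. 4 * m j / d)) * T)" .
  have "g s = p i s + \<alpha>" "g (s + T) = p i (s + T) + \<beta>" using T by (simp_all add: g_def rot)
  from that[OF cont this gn act] show ?thesis .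
qed

lemma leaves_center:
  assumes "i \<in> I" "a < b" "action w {a..b} < \<infinity>"
  obtains t where "a \<le> t" "t \<le> b" "w t \<noteq> p i t"
proof (rule ccontr)
  assume "\<not> thesis"
  then have *: "\<And>t. t \<in> {a..b} \<Longrightarrow> norm (w t - p i t) = 0" using that by auto
  obtain A where A: "A \<ge> 0" "action w {a..b} = ennreal A" using assms(3) by (cases "action w {a..b}") auto
  have mi: "m i > 0" using m_pos assms by auto
  \<comment> \<open>Chosen so that a stay within distance \<open>R\<close> during all of
    \<open>{a..b}\<close> would cost \<open>A + 1\<close>.\<close>
  define R where "R = 2 * m i * (b - a) / (A + 1)"
  have R: "R > 0" using mi assms(2) A by (simp add: R_def)
  have "ennreal (2 * m i * (b - a) / R) \<le> potential_integral w {a..b}"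
    using * assms R by (intro action_ge_dwell) auto
  also have "\<dots> \<le> ennreal A" unfolding A(2)[symmetric] action_def by simp
  finally have "2 * m i * (b - a) / R \<le> A" by (rule iffD1[OF ennreal_le_iff[OF A(1)]])
  moreover have "2 * m i * (b - a) / R = A + 1" using mi assms(2) A by (simp add: R_def)
  ultimately show False by simp
qed

text \<open>The collision window is replaced by an arc of radius \<open>r\<close> run at the parabolic speed. Its
  duration differs from that of the window, and the difference is absorbed by reparametrising the
  motion relative to the centre on \<open>{s2..b}\<close>.\<close>

lemma collision_window_upper_bound:
  assumes w: "local_minimizer w" and i: "i \<in> I"
    and C1: "\<And>a a'. lo \<le> a \<Longrightarrow> a \<le> hi \<Longrightarrow> lo \<le> a' \<Longrightarrow> a' \<le> hi \<Longrightarrow>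
    comoving_extension w i C1 b a a'" "C1 \<ge> 0"
    and near: "\<And>t. lo \<le> t \<Longrightarrow> t \<le> b \<Longrightarrow> norm (w t - p i t) \<le> 1 / 2"
    and s: "0 \<le> lo" "lo \<le> s1" "s1 \<le> s2" "s2 \<le> hi" "hi < b" "s1 + T \<le> hi" "T > 0"
    and r: "0 < r" "r \<le> d / 2" "r \<le> 1 / 2" "norm (w s1 - p i s1) = r" "norm (w s2 - p i s2) = r"
  shows "enn2real (action w {s1..s2}) \<le>
     (pi * r / T + L)\<^sup>2 * T + (2 * m i / r + (\<Sum>j\<in>I. 4 * m j / d)) * T + C1 * (T + (s2 - s1))"
proof -
  have w_cont: "continuous_on UNIV w" using w by (simp add: local_minimizer_def)
  have w_fin: "action w {u..v} < \<infinity>" if "0 \<le> u" for u v using w that by (simp add: local_minimizer_def)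
  let ?X = "(pi * r / T + L)\<^sup>2 * T + (2 * m i / r + (\<Sum>j\<in>I. 4 * m j / d)) * T"
  have X: "?X \<ge> 0"
    using s r d_pos by (intro add_nonneg_nonneg mult_nonneg_nonneg sum_nonneg divide_nonneg_nonneg) (auto simp: m_nonneg i)
  let ?a' = "s1 + T"
  obtain f where f: "continuous_on UNIV f" "f s1 = p i s1 + (w s1 - p i s1)"
    "f ?a' = p i ?a' + (w s2 - p i s2)" "\<And>t. norm (f t - p i t) = r" "action f {s1..?a'} \<le> ennreal ?X"
    by (rule collision_arc[OF i r(1,2) r(4,5) s(7), of s1]) (rule that)
  obtain g where g: "continuous_on UNIV g" "g b = w b" "g ?a' = w s2 - p i s2 + p i ?a'"
    "\<And>t. ?a' \<le> t \<Longrightarrow> t \<le> b \<Longrightarrow> \<exists>s. s2 \<le> s \<and> s \<le> b \<and> g t - p i t = w s - p i s"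
    "action g {?a'..b} \<le> action w {s2..b} + ennreal (C1 * \<bar>?a' - s2\<bar>)"
    using C1(1)[of s2 ?a'] s unfolding comoving_extension_def by auto
  define h where "h t = (if t \<le> ?a' then f t else g t)" for t
  have h_cont: "continuous_on UNIV h"
    unfolding h_def using f g by (intro continuous_on_if_le) auto
  have h_g: "h t = g t" if "?a' \<le> t" for t using that f(3) g(3) by (auto simp: h_def)
  have close: "norm (h t - w t) \<le> 1" if tb: "t \<in> {s1..b}" for t
  proof -
    have "norm (h t - p i t) \<le> 1 / 2"
    proof (cases "t \<le> ?a'")
      case True
      then show ?thesis using f(4)[of t] r by (simp add: h_def)
    next
      case False
      then obtain u where "s2 \<le> u" "u \<le> b" "g t - p i t = w u - p i u" using g(4)[of t] tb by auto
      then show ?thesis using near[of u] s False by (simp add: h_def)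
    qed
    moreover have "norm (w t - p i t) \<le> 1 / 2" using near[of t] tb s by auto
    moreover have "norm (h t - w t) \<le> norm (h t - p i t) + norm (w t - p i t)"
      using norm_triangle_ineq4[of "h t - p i t" "w t - p i t"] by simp
    ultimately show ?thesis by linarith
  qed
  have "action w {s1..b} \<le> action h {s1..b}"
  proof -
    have "h s1 = w s1" "h b = w b" using f g h_g[of b] s by (auto simp: h_def)
    moreover have "0 \<le> s1" "s1 < b" using s by linarith+
    ultimately show ?thesis using w h_cont close unfolding local_minimizer_def by blast
  qed
  also have "\<dots> = action h {s1..?a'} + action h {?a'..b}" using s by (intro action_split h_cont) auto
  also have "action h {s1..?a'} = action f {s1..?a'}" by (rule action_cong) (auto simp: h_def)
  also have "action h {?a'..b} = action g {?a'..b}" by (rule action_cong) (auto simp: h_g)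
  also have "action f {s1..?a'} + action g {?a'..b} \<le> ennreal ?X + (action w {s2..b} + ennreal (C1 * \<bar>?a' - s2\<bar>))"
    by (rule add_mono[OF f(5) g(5)])
  also have "action w {s1..b} = action w {s1..s2} + action w {s2..b}" using s by (intro action_split w_cont) auto
  finally have *: "action w {s1..s2} + action w {s2..b} \<le> ennreal ?X + (action w {s2..b} + ennreal (C1 * \<bar>?a' - s2\<bar>))" .
  obtain A where A: "A \<ge> 0" "action w {s1..s2} = ennreal A"
    using w_fin[of s1 s2] s by (cases "action w {s1..s2}") auto
  obtain B where B: "B \<ge> 0" "action w {s2..b} = ennreal B"
    using w_fin[of s2 b] s by (cases "action w {s2..b}") auto
  have Cn: "C1 * \<bar>?a' - s2\<bar> \<ge> 0" using C1(2) by simp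
  have "ennreal (A + B) \<le> ennreal (?X + (B + C1 * \<bar>?a' - s2\<bar>))"
    using * A B X Cn by (simp only: ennreal_plus add_nonneg_nonneg)
  then have "A + B \<le> ?X + (B + C1 * \<bar>?a' - s2\<bar>)"
    by (rule iffD1[OF ennreal_le_iff, rotated]) (use X B Cn in \<open>auto intro!: add_nonneg_nonneg\<close>)
  moreover have "C1 * \<bar>?a' - s2\<bar> \<le> C1 * (T + (s2 - s1))" using C1(2) s by (intro mult_left_mono) auto
  ultimately show ?thesis using A by simp
qed

text \<open>The first bound applies \<open>collision_cost\<close> with
  \<open>K = 2 * sqrt (2 * m i)\<close> on both sides of \<open>t0\<close>, after reflecting time on
  the right-hand side. The second one controls the duration of the window by its action, so that an
  error linear in the duration can be charged to the action itself.\<close>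

lemma collision_window_lower_bounds:
  assumes w: "continuous_on UNIV w" and fin: "\<And>u v. s1 \<le> u \<Longrightarrow> action w {u..v} < \<infinity>" and i: "i \<in> I"
    and s: "s1 \<le> t0" "t0 \<le> s2" and r: "r > 0"
    and z: "w t0 = p i t0" "norm (w s1 - p i s1) = r" "norm (w s2 - p i s2) = r"
    and le: "\<And>t. s1 \<le> t \<Longrightarrow> t \<le> s2 \<Longrightarrow> norm (w t - p i t) \<le> r"
  shows "8 * sqrt (2 * m i) * sqrt r - 4 * L * r \<le> enn2real (action w {s1..s2})"
    and "2 * m i * (s2 - s1) / r \<le> enn2real (action w {s1..s2})"
proof -
  define Act where "Act s t = enn2real (action w {s..t})" for s t
  have Act: "action w {u..v} = ennreal (Act u v)" "Act u v \<ge> 0" if "s1 \<le> u" for u v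
    using fin[OF that, of v] by (auto simp: Act_def)
  define \<rho> where "\<rho> t = norm (w t - p i t)" for t
  have \<rho>_cont: "continuous_on S \<rho>" for S
    unfolding \<rho>_def by (intro continuous_intros continuous_on_subset[OF w] p_continuous[OF i]) auto
  have add: "Act u t = Act u v + Act v t" if "s1 \<le> u" "u \<le> v" "v \<le> t" for u v t
  proof -
    have "ennreal (Act u t) = ennreal (Act u v + Act v t)"
      using action_split[OF w that(2,3)] Act[of u] Act[of v] that by simp
    then show ?thesis using Act[of u] Act[of v] that by (subst (asm) ennreal_inj) auto
  qed
  have step: "2 * sqrt (2 * m i) * \<bar>\<rho> v - \<rho> u\<bar> / sqrt R - 2 * L * \<bar>\<rho> v - \<rho> u\<bar> \<le> Act u v"
    if "s1 \<le> u" "u \<le> v" "R > 0" "\<And>t. u \<le> t \<Longrightarrow> t \<le> v \<Longrightarrow> \<rho> t \<le> R" for u v R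
    using action_ge_radial_step[OF i that(3,2), of w "\<bar>\<rho> v - \<rho> u\<bar>"] that(4) Act[OF that(1), of v]
    by (simp add: \<rho>_def)
  have K: "0 \<le> 2 * sqrt (2 * m i)" using m_nonneg[OF i] by simp
  have \<rho>: "\<rho> t0 = 0" "\<rho> s1 = r" "\<rho> s2 = r" using z by (simp_all add: \<rho>_def)
  have \<rho>_le: "\<rho> t \<le> r" if "s1 \<le> t" "t \<le> s2" for t using le[OF that] by (simp add: \<rho>_def)
  have "2 * (2 * sqrt (2 * m i)) * sqrt r - 2 * L * r \<le> Act s1 t0"
  proof (rule collision_cost[where \<rho> = \<rho> and Act = Act, OF \<rho>_cont \<rho>(1) K])
    show "\<rho> u \<le> r" if "s1 \<le> u" "u \<le> t0" for u using \<rho>_le that s by simp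
    show "2 * sqrt (2 * m i) * \<bar>\<rho> t - \<rho> s\<bar> / sqrt R - 2 * L * \<bar>\<rho> t - \<rho> s\<bar> \<le> Act s t"
      if "s1 \<le> s" "s \<le> t" "t \<le> t0" "R > 0" "\<And>u. s \<le> u \<Longrightarrow> u \<le> t \<Longrightarrow> \<rho> u \<le> R" for s t R
      by (rule step) (use that in auto)
    show "Act s t0 = Act s t + Act t t0" if "s1 \<le> s" "s \<le> t" "t \<le> t0" for s t
      by (rule add) (use that in auto)
  qed (use s r \<rho> in simp_all)
  moreover have "2 * (2 * sqrt (2 * m i)) * sqrt r - 2 * L * r \<le> (\<lambda>u v. Act (- v) (- u)) (- s2) (- t0)"
  proof (rule collision_cost[where \<rho> = "\<lambda>t. \<rho> (- t)" and Act = "\<lambda>u v. Act (- v) (- u)"])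
    show "continuous_on {- s2..- t0} (\<lambda>t. \<rho> (- t))"
      by (rule continuous_on_compose2[OF \<rho>_cont[of UNIV]]) (auto intro!: continuous_intros)
    show "2 * sqrt (2 * m i) * \<bar>\<rho> (- t) - \<rho> (- s)\<bar> / sqrt R - 2 * L * \<bar>\<rho> (- t) - \<rho> (- s)\<bar> \<le> Act (- t) (- s)"
      if "- s2 \<le> s" "s \<le> t" "t \<le> - t0" "R > 0" "\<And>u. s \<le> u \<Longrightarrow> u \<le> t \<Longrightarrow> \<rho> (- u) \<le> R" for s t R
    proof -
      have "\<rho> u \<le> R" if "- t \<le> u" "u \<le> - s" for u using \<open>\<And>u. s \<le> u \<Longrightarrow> u \<le> t \<Longrightarrow> \<rho> (- u) \<le> R\<close>[of "- u"] that by simp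
      then show ?thesis using step[of "- t" "- s" R] that(1-4) \<open>s1 \<le> t0\<close> by (simp add: abs_minus_commute)
    qed
    show "\<rho> (- u) \<le> r" if "- s2 \<le> u" "u \<le> - t0" for u using \<rho>_le[of "- u"] that s by simp
    show "Act (- (- t0)) (- s) = Act (- t) (- s) + Act (- (- t0)) (- t)" if "- s2 \<le> s" "s \<le> t" "t \<le> - t0" for s t
      using add[of "t0" "- t" "- s"] that s by simp
  qed (use s r \<rho> K in auto)
  ultimately show "8 * sqrt (2 * m i) * sqrt r - 4 * L * r \<le> enn2real (action w {s1..s2})"
    using add[of s1 t0 s2] s by (simp add: Act_def algebra_simps)
  have "ennreal (2 * m i * (s2 - s1) / r) \<le> potential_integral w {s1..s2}"
    using s r le by (intro action_ge_dwell[OF i]) auto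
  also have "\<dots> \<le> ennreal (Act s1 s2)" unfolding Act(1)[OF order_refl, symmetric] by (simp add: action_def)
  finally show "2 * m i * (s2 - s1) / r \<le> enn2real (action w {s1..s2})"
    using Act(2)[of s1 s2] by (simp add: Act_def)
qed

theorem local_minimizer_collision_free:
  assumes w: "local_minimizer w" and i: "i \<in> I" and t0: "t0 > 0"
  shows "w t0 \<noteq> p i t0"
proof
  assume coll: "w t0 = p i t0"
  have w_cont: "continuous_on UNIV w" using w by (simp add: local_minimizer_def)
  have w_fin: "action w {u..v} < \<infinity>" if "0 \<le> u" for u v using w that by (simp add: local_minimizer_def)
  define \<rho> where "\<rho> t = norm (w t - p i t)" for t
  have \<rho>_cont: "continuous_on S \<rho>" for S
    unfolding \<rho>_def by (intro continuous_intros continuous_on_subset[OF w_cont] p_continuous[OF i]) auto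
  \<comment> \<open>Within \<open>1 / 2\<close> of the centre, \<open>w\<close> and a competitor are
    within distance 1 of each other; within \<open>d / 2\<close>, the other centres are far
    away.\<close>
  define e0 where "e0 = min (1 / 2) (d / 2)"
  have e0: "e0 > 0" "e0 \<le> 1 / 2" "e0 \<le> d / 2" using d_pos by (auto simp: e0_def)
  obtain \<eta>' where \<eta>': "\<eta>' > 0" "\<And>t. \<bar>t - t0\<bar> < \<eta>' \<Longrightarrow> \<rho> t < e0"
  proof -
    have "isCont \<rho> t0" using \<rho>_cont[of UNIV] by (simp add: continuous_on_eq_continuous_at)
    moreover have "\<rho> t0 = 0" using coll by (simp add: \<rho>_def)
    moreover have "\<rho> t \<ge> 0" for t by (simp add: \<rho>_def)
    ultimately show ?thesis using e0(1) that unfolding continuous_at_eps_delta dist_real_def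
      by (metis abs_of_nonneg diff_zero)
  qed
  define \<eta> where "\<eta> = min (\<eta>' / 2) t0"
  have \<eta>: "\<eta> > 0" "\<eta> \<le> t0" using \<eta>' t0 by (auto simp: \<eta>_def)
  have near: "\<rho> t \<le> e0" if "t0 - \<eta> \<le> t" "t \<le> t0 + \<eta>" for t
    using \<eta>'(2)[of t] \<eta>'(1) that by (force simp: \<eta>_def)
  define lo hi b where "lo = t0 - \<eta>" and "hi = t0 + \<eta> / 2" and "b = t0 + \<eta>"
  have ends: "0 \<le> lo" "lo < t0" "t0 < hi" "hi < b" using \<eta> by (auto simp: lo_def hi_def b_def)
  obtain C1 where C1: "C1 \<ge> 0" "\<And>a a'. lo \<le> a \<Longrightarrow> a \<le> hi \<Longrightarrow> lo \<le> a' \<Longrightarrow> a' \<le> hi \<Longrightarrow>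
    comoving_extension w i C1 b a a'"
  proof (rule action_comoving_reparametrization[OF i w_cont, of lo hi b])
    show "norm (w t - p i t) \<le> d / 2" if "lo \<le> t" "t \<le> b" for t
      using near[of t] that e0 by (auto simp: lo_def b_def \<rho>_def)
  qed (use ends w_fin in auto)
  obtain u1 where u1: "lo \<le> u1" "u1 \<le> t0" "w u1 \<noteq> p i u1" using leaves_center[OF i ends(2) w_fin[OF ends(1)]] .
  obtain u2 where u2: "t0 \<le> u2" "u2 \<le> hi" "w u2 \<noteq> p i u2" using leaves_center[OF i ends(3) w_fin] t0 by auto
  define \<kappa> where "\<kappa> = sqrt (2 * m i)"
  have \<kappa>: "\<kappa> > 0" "\<kappa>\<^sup>2 = 2 * m i" using m_pos[OF i] by (auto simp: \<kappa>_def)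
  define Mo where "Mo = (\<Sum>j\<in>I. 4 * m j / d)"
  have Mo: "Mo \<ge> 0" unfolding Mo_def using d_pos by (intro sum_nonneg) (auto simp: m_nonneg)
  \<comment> \<open>\<open>8 * (1 - \<mu>) = 4 + pi\<close> is the midpoint of \<open>2 * pi\<close>
    and 8: half of the gap pays for \<open>C1 * \<tau>\<close>, the other half,
    \<open>4 - pi\<close>, is left against the terms of order \<open>r\<close>, which
    \<open>D\<close> collects.\<close>
  define \<mu> where "\<mu> = (4 - pi) / 8"
  have \<mu>: "0 < \<mu>" "\<mu> < 1" using pi_less_4 pi_gt_zero by (auto simp: \<mu>_def simp del: pi_gt_zero)
  define D where "D = 4 * L + 2 * pi * L + (L\<^sup>2 + Mo + C1) * pi / \<kappa>"
  have D: "D \<ge> 0" using L_nonneg Mo C1 \<kappa> by (simp add: D_def)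
  define q where "q = ((4 - pi) * \<kappa> / (D + 1))\<^sup>2"
  have q: "q > 0" using \<kappa> D pi_less_4 by (simp add: q_def)
  \<comment> \<open>The entries ensure in turn: that level \<open>r\<close> is crossed on both sides
    of \<open>t0\<close>, that the arc stays close enough, that
    \<open>C1 * \<tau> \<le> \<mu> * A\<close>, that \<open>D * sqrt r\<close> is below
    \<open>(4 - pi) * \<kappa>\<close>, and that the arc lasts at most
    \<open>\<eta> / 2\<close>.\<close>
  define r where "r = Min {\<rho> u1, \<rho> u2, 1 / 2, e0, \<mu> * \<kappa>\<^sup>2 / (C1 + 1), q, \<eta> * \<kappa> / (2 * pi)}"
  have "r > 0" unfolding r_def using u1 u2 e0 \<mu> \<kappa>(1) C1(1) q \<eta> by (subst Min_gr_iff) (auto simp: \<rho>_def)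
  have r: "r \<le> \<rho> u1" "r \<le> \<rho> u2" "r \<le> 1 / 2" "r \<le> e0" "r \<le> \<mu> * \<kappa>\<^sup>2 / (C1 + 1)" "r \<le> q" "r \<le> \<eta> * \<kappa> / (2 * pi)"
    unfolding r_def by (rule Min_le; simp)+
  define \<sigma> where "\<sigma> = sqrt r"
  have \<sigma>: "\<sigma> > 0" "r = \<sigma>\<^sup>2" "\<sigma> \<le> 1" using \<open>r > 0\<close> r(3) by (auto simp: \<sigma>_def)
  obtain s1 where s1: "u1 \<le> s1" "s1 \<le> t0" "\<rho> s1 = r" "\<And>u. s1 \<le> u \<Longrightarrow> u \<le> t0 \<Longrightarrow> \<rho> u \<le> r"
    using last_time_at_level[OF \<rho>_cont u1(2), of r] r \<open>r > 0\<close> coll by (auto simp: \<rho>_def)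
  obtain s2 where s2: "t0 \<le> s2" "s2 \<le> u2" "\<rho> s2 = r" "\<And>u. t0 \<le> u \<Longrightarrow> u \<le> s2 \<Longrightarrow> \<rho> u \<le> r"
    using first_time_at_level[OF \<rho>_cont u2(1), of r] r \<open>r > 0\<close> coll by (auto simp: \<rho>_def)
  \<comment> \<open>The time for half a turn, of length \<open>pi * r\<close>, at the parabolic
    speed \<open>\<kappa> / \<sigma> = sqrt (2 * m i / r)\<close>.\<close>
  define T where "T = pi * r * \<sigma> / \<kappa>"
  have T: "T > 0" using \<open>r > 0\<close> \<sigma> \<kappa> by (simp add: T_def)
  have T_le: "T \<le> pi * r / \<kappa>"
    unfolding T_def using \<sigma> \<kappa> \<open>r > 0\<close> by (intro divide_right_mono) (auto simp: mult_left_le)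
  also have "\<dots> \<le> \<eta> / 2" using r(7) \<kappa> by (simp add: field_simps)
  finally have T_eta: "T \<le> \<eta> / 2" .
  define A where "A = enn2real (action w {s1..s2})"
  define \<tau> where "\<tau> = s2 - s1"
  have \<tau>: "\<tau> \<ge> 0" using s1 s2 by (simp add: \<tau>_def)
  have le: "norm (w t - p i t) \<le> r" if "s1 \<le> t" "t \<le> s2" for t
    using s1(4)[of t] s2(4)[of t] that unfolding \<rho>_def by linarith
  have s12: "norm (w s1 - p i s1) = r" "norm (w s2 - p i s2) = r" using s1(3) s2(3) by (simp_all add: \<rho>_def)
  have s1_nonneg: "0 \<le> s1" using s1 u1 ends by linarith
  have low: "8 * \<kappa> * \<sigma> - 4 * L * r \<le> A" "2 * m i * \<tau> / r \<le> A"
    unfolding A_def \<kappa>_def \<sigma>_def \<tau>_def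
    using collision_window_lower_bounds[OF w_cont w_fin i s1(2) s2(1) \<open>r > 0\<close> coll s12 le] s1_nonneg by auto
  have up: "A \<le> (pi * r / T + L)\<^sup>2 * T + (2 * m i / r + Mo) * T + C1 * (T + \<tau>)"
    unfolding A_def \<tau>_def Mo_def
  proof (rule collision_window_upper_bound[OF w i C1(2) C1(1)])
    show "norm (w t - p i t) \<le> 1 / 2" if "lo \<le> t" "t \<le> b" for t
      using near[of t] that e0 by (simp add: \<rho>_def lo_def b_def)
    show "s1 + T \<le> hi" using s1 T_eta by (simp add: hi_def)
    show "lo \<le> s1" "s1 \<le> s2" "s2 \<le> hi" using s1 s2 u1 u2 by linarith+
  qed (use ends T e0 r s12 \<open>r > 0\<close> in simp_all)
  have "(pi * r / T + L)\<^sup>2 * T + (2 * m i / r + Mo) * T = 2 * pi * \<kappa> * \<sigma> + 2 * pi * L * r + (L\<^sup>2 + Mo) * T"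
  proof -
    have "pi * r / T = \<kappa> / \<sigma>" using \<open>r > 0\<close> \<sigma> \<kappa> by (simp add: T_def)
    moreover have "(\<kappa> / \<sigma>) * T = pi * r" "2 * m i / r * T = pi * \<kappa> * \<sigma>" "(\<kappa> / \<sigma>)\<^sup>2 * T = pi * \<kappa> * \<sigma>"
      using \<sigma>(1) \<kappa> unfolding \<kappa>(2)[symmetric] T_def \<sigma>(2) by (auto simp: field_simps power2_eq_square)
    moreover have "(x + L)\<^sup>2 * T + (y + Mo) * T = x\<^sup>2 * T + 2 * L * (x * T) + y * T + (L\<^sup>2 + Mo) * T" for x y
      by (simp add: power2_sum algebra_simps)
    ultimately show ?thesis by simp
  qed
  with up have up': "A \<le> 2 * pi * \<kappa> * \<sigma> + 2 * pi * L * r + (L\<^sup>2 + Mo + C1) * T + C1 * \<tau>"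
    by (simp add: algebra_simps)
  have "C1 * \<tau> \<le> \<mu> * A"
  proof -
    have "(C1 + 1) * r \<le> \<mu> * \<kappa>\<^sup>2" using r(5) C1 by (simp add: field_simps)
    then have "C1 * r \<le> \<mu> * \<kappa>\<^sup>2" using \<open>r > 0\<close> by (simp add: algebra_simps)
    then have "C1 \<le> \<mu> * \<kappa>\<^sup>2 / r" using \<open>r > 0\<close> by (simp add: field_simps)
    then have "C1 * \<tau> \<le> \<mu> * \<kappa>\<^sup>2 / r * \<tau>" using \<tau> by (intro mult_right_mono) auto
    also have "\<dots> = \<mu> * (2 * m i * \<tau> / r)" by (simp add: \<kappa>(2))
    also have "\<dots> \<le> \<mu> * A" using low(2) \<mu> by (intro mult_left_mono) auto
    finally show ?thesis .
  qed
  moreover have "(4 + pi) * \<kappa> * \<sigma> - 4 * L * r \<le> (1 - \<mu>) * A"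
  proof -
    have "(1 - \<mu>) * (8 * \<kappa> * \<sigma> - 4 * L * r) \<le> (1 - \<mu>) * A" using low(1) \<mu> by (intro mult_left_mono) auto
    moreover have "(1 - \<mu>) * (8 * \<kappa> * \<sigma> - 4 * L * r) = (4 + pi) * \<kappa> * \<sigma> - 4 * L * r + \<mu> * (4 * L * r)"
      by (simp add: \<mu>_def field_simps)
    moreover have "\<mu> * (4 * L * r) \<ge> 0" using \<mu> L_nonneg \<open>r > 0\<close> by simp
    ultimately show ?thesis by linarith
  qed
  moreover have "(L\<^sup>2 + Mo + C1) * T \<le> (L\<^sup>2 + Mo + C1) * (pi * r / \<kappa>)"
    using T_le Mo C1 by (intro mult_left_mono) auto
  ultimately have "(4 - pi) * \<kappa> * \<sigma> \<le> 4 * L * r + 2 * pi * L * r + (L\<^sup>2 + Mo + C1) * (pi * r / \<kappa>)"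
    using up' by (simp add: algebra_simps)
  also have "\<dots> = D * \<sigma> * \<sigma>" by (simp add: D_def \<sigma>(2) power2_eq_square algebra_simps)
  finally have "(4 - pi) * \<kappa> \<le> D * \<sigma>" using \<sigma>(1) by simp
  also have "\<dots> \<le> D * ((4 - pi) * \<kappa> / (D + 1))"
  proof -
    have "\<sigma>\<^sup>2 \<le> ((4 - pi) * \<kappa> / (D + 1))\<^sup>2" using r(6) \<sigma>(2) by (simp add: q_def)
    then have "\<sigma> \<le> (4 - pi) * \<kappa> / (D + 1)"
      by (rule power2_le_imp_le) (use \<kappa> D pi_less_4 in auto)
    then show ?thesis using D by (rule mult_left_mono)
  qed
  also have "\<dots> < (4 - pi) * \<kappa>" using \<kappa> D pi_less_4 by (simp add: field_simps)
  finally show False by simp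
qed

end

section \<open>The equation of motion\<close>

lemma energy_add_affine_bound_nonneg:
  fixes f :: "real \<Rightarrow> 'a::real_inner"
  assumes "a \<le> b" "energy f {a..b} \<le> ennreal e" "e \<ge> 0"
  shows "0 \<le> e + 2 * (\<beta> \<bullet> (f b - f a)) + (norm \<beta>)\<^sup>2 * (b - a)"
proof -
  have "0 \<le> energy_sum (\<lambda>t. f t + (0 + t *\<^sub>R \<beta>)) [a, b]" using assms(1) by (intro energy_sum_nonneg) simp
  also have "\<dots> = energy_sum f [a, b] + 2 * (\<beta> \<bullet> (f b - f a)) + (norm \<beta>)\<^sup>2 * (b - a)"
    by (subst energy_sum_add_affine) auto
  also have "energy_sum f [a, b] \<le> e"
    using order_trans[OF energy_geI[of "[a, b]" "{a..b}" f] assms(2)] assms by (auto simp: ennreal_le_iff)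
  finally show ?thesis by simp
qed

text \<open>In terms of \<open>n = norm (y + \<eta>)\<close> and \<open>r = norm y\<close>,
  linearising \<open>1 / n\<close> in \<open>n^2\<close> leaves the exact remainder
  \<open>(n - r)^2 * (1 + 2 * r / n) / (2 * r^3)\<close>. The hypothesis gives
  \<open>n \<ge> r / 2\<close>, so the middle factor is at most 5.\<close>

lemma inverse_norm_add_le:
  fixes y \<eta> :: "'a::real_inner"
  assumes "y \<noteq> 0" "norm \<eta> \<le> norm y / 2"
  shows "1 / norm (y + \<eta>) \<le> 1 / norm y - (y \<bullet> \<eta>) / norm y ^ 3 + 5 / 2 * (norm \<eta>)\<^sup>2 / norm y ^ 3"
proof -
  define r n where "r = norm y" and "n = norm (y + \<eta>)"
  have r: "r > 0" using assms by (simp add: r_def)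
  have nr: "\<bar>n - r\<bar> \<le> norm \<eta>" using norm_triangle_ineq3[of "y + \<eta>" y] by (simp add: n_def r_def)
  have n: "n \<ge> r / 2" using nr assms(2) by (simp add: r_def)
  have n0: "n > 0" using n r by linarith
  have "n\<^sup>2 = r\<^sup>2 + 2 * (y \<bullet> \<eta>) + (norm \<eta>)\<^sup>2"
    by (simp add: n_def r_def power2_norm_eq_inner inner_add_left inner_add_right inner_commute)
  then have yh: "y \<bullet> \<eta> = (n\<^sup>2 - r\<^sup>2 - (norm \<eta>)\<^sup>2) / 2" by simp
  have "1 / n - 1 / r + (n\<^sup>2 - r\<^sup>2) / (2 * r ^ 3) = (n - r)\<^sup>2 * (n + 2 * r) / (2 * n * r ^ 3)"
    using r n0 by (simp add: field_simps power2_eq_square power3_eq_cube)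
  also have "\<dots> = (n - r)\<^sup>2 * (1 + 2 * r / n) / (2 * r ^ 3)"
    using r n0 by (simp add: field_simps)
  also have "\<dots> \<le> (norm \<eta>)\<^sup>2 * 5 / (2 * r ^ 3)"
  proof (intro divide_right_mono mult_mono)
    show "(n - r)\<^sup>2 \<le> (norm \<eta>)\<^sup>2" using nr by (simp add: abs_le_square_iff[symmetric])
    show "1 + 2 * r / n \<le> 5" using n n0 r by (simp add: field_simps)
  qed (use r n0 in auto)
  finally have "1 / n \<le> 1 / r - (n\<^sup>2 - r\<^sup>2) / (2 * r ^ 3) + (norm \<eta>)\<^sup>2 * 5 / (2 * r ^ 3)" by linarith
  moreover have "(y \<bullet> \<eta>) / r ^ 3 \<le> (n\<^sup>2 - r\<^sup>2) / (2 * r ^ 3)"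
    using r by (simp add: yh field_simps)
  ultimately show ?thesis by (simp add: r_def n_def mult.commute)
qed

lemma quadratic_nonneg_imp_linear_zero:
  fixes X K s0 :: real
  assumes "s0 > 0" "\<And>s. \<bar>s\<bar> \<le> s0 \<Longrightarrow> 0 \<le> s * X + s\<^sup>2 * K"
  shows "X = 0"
proof (rule ccontr)
  assume X: "X \<noteq> 0"
  define s where "s = min s0 (\<bar>X\<bar> / (2 * (\<bar>K\<bar> + 1)))"
  have s: "0 < s" "s \<le> s0" "s \<le> \<bar>X\<bar> / (2 * (\<bar>K\<bar> + 1))" using assms(1) X by (auto simp: s_def)
  have "s * K \<le> s * (\<bar>K\<bar> + 1)" using s by (intro mult_left_mono) auto
  also have "\<dots> \<le> \<bar>X\<bar> / (2 * (\<bar>K\<bar> + 1)) * (\<bar>K\<bar> + 1)" using s by (intro mult_right_mono) auto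
  also have "\<dots> = \<bar>X\<bar> / 2" by (simp add: field_simps)
  finally have K: "s * K \<le> \<bar>X\<bar> / 2" .
  have "0 \<le> (- sgn X * s) * X + (- sgn X * s)\<^sup>2 * K"
    using s X by (intro assms(2)) (simp add: abs_mult sgn_if)
  also have "\<dots> = s * (s * K - \<bar>X\<bar>)" using X by (auto simp: sgn_if power2_eq_square algebra_simps)
  finally have "0 \<le> s * K - \<bar>X\<bar>" using s by (simp add: zero_le_mult_iff)
  then show False using K X by simp
qed

text \<open>A maximum principle: subtract the chord and take a point where the norm of the
  difference \<open>v\<close> is largest. The symmetric interval around it that reaches the nearer
  endpoint has \<open>v = 0\<close> at one end, so twice the maximum is at most the maximum.\<close>

lemma midpoint_linear_imp_affine:
  fixes u :: "real \<Rightarrow> 'a::real_normed_vector"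
  assumes cont: "continuous_on {a..b} u" and ab: "a < b"
    and mid: "\<And>c \<delta>. \<delta> > 0 \<Longrightarrow> a \<le> c - \<delta> \<Longrightarrow> c + \<delta> \<le> b \<Longrightarrow> u (c + \<delta>) + u (c - \<delta>) = 2 *\<^sub>R u c"
    and t: "t \<in> {a..b}"
  shows "u t = u a + ((t - a) / (b - a)) *\<^sub>R (u b - u a)"
proof -
  define v where "v t = u t - (u a + ((t - a) / (b - a)) *\<^sub>R (u b - u a))" for t
  have v_ends: "v a = 0" "v b = 0" using ab by (auto simp: v_def)
  have v_cont: "continuous_on {a..b} (\<lambda>t. norm (v t))"
    unfolding v_def by (intro continuous_intros cont) (use ab in auto)
  have v_mid: "v (c + \<delta>) + v (c - \<delta>) = 2 *\<^sub>R v c" if "\<delta> > 0" "a \<le> c - \<delta>" "c + \<delta> \<le> b" for c \<delta>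
  proof -
    have "((c + \<delta> - a) / (b - a)) *\<^sub>R x + ((c - \<delta> - a) / (b - a)) *\<^sub>R x = (2 * ((c - a) / (b - a))) *\<^sub>R x" for x :: 'a
      by (simp add: scaleR_add_left[symmetric] add_divide_distrib[symmetric])
    from this[of "u b - u a"] show ?thesis using mid[OF that]
      by (simp add: v_def scaleR_right_diff_distrib scaleR_right_distrib algebra_simps scaleR_2)
  qed
  obtain c where c: "c \<in> {a..b}" "\<And>s. s \<in> {a..b} \<Longrightarrow> norm (v s) \<le> norm (v c)"
    using continuous_attains_sup[OF compact_Icc _ v_cont] ab by fastforce
  have "v c = 0"
  proof (cases "c = a \<or> c = b")
    case True
    then show ?thesis using v_ends by auto
  next
    case False
    define \<delta> where "\<delta> = min (c - a) (b - c)"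
    have \<delta>: "\<delta> > 0" "a \<le> c - \<delta>" "c + \<delta> \<le> b" using False c by (auto simp: \<delta>_def)
    have "c - \<delta> = a \<or> c + \<delta> = b" by (auto simp: \<delta>_def min_def)
    then have z: "v (c - \<delta>) = 0 \<or> v (c + \<delta>) = 0" using v_ends by auto
    have "2 * norm (v c) = norm (v (c + \<delta>) + v (c - \<delta>))" using v_mid[OF \<delta>] by simp
    also have "\<dots> \<le> norm (v c)"
      using z c(2)[of "c + \<delta>"] c(2)[of "c - \<delta>"] \<delta> by auto
    finally show ?thesis by simp
  qed
  then have "v t = 0" using c(2)[OF t] by simp
  then show ?thesis by (simp add: v_def)
qed

context moving_centers
begin

definition force :: "real \<Rightarrow> complex \<Rightarrow> complex" where
  "force t y = - (\<Sum>i\<in>I. attraction (m i) (p i t) y)"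

text \<open>Agrees with \<open>potential\<close> only off the centres: at a centre the infinite term
  is replaced by 0, the value of a real division by zero.\<close>

definition real_potential :: "real \<Rightarrow> complex \<Rightarrow> real" where
  "real_potential t y = (\<Sum>i\<in>I. 2 * m i / norm (y - p i t))"

lemma potential_eq_real:
  assumes "\<And>i. i \<in> I \<Longrightarrow> y \<noteq> p i t"
  shows "potential t y = ennreal (real_potential t y)"
proof -
  have "potential t y = (\<Sum>i\<in>I. ennreal (2 * m i / norm (y - p i t)))"
    unfolding potential_def using assms by (intro sum.cong divide_ennreal) (auto simp: m_nonneg)
  also have "\<dots> = ennreal (real_potential t y)"
    unfolding real_potential_def by (intro sum_ennreal) (auto simp: m_nonneg)
  finally show ?thesis .
qed

text \<open>The gradient of the doubled potential is twice \<open>force\<close>. An upper estimate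
  is all that minimality requires, since it bounds the action of \<open>w\<close> by that of the
  varied path.\<close>

lemma real_potential_add_le:
  assumes "\<rho> > 0" "\<And>i. i \<in> I \<Longrightarrow> \<rho> \<le> norm (y - p i t)" "norm \<eta> \<le> \<rho> / 2"
  shows "real_potential t (y + \<eta>) \<le> real_potential t y + 2 * (\<eta> \<bullet> force t y)
    + (\<Sum>i\<in>I. 5 * m i / \<rho> ^ 3) * (norm \<eta>)\<^sup>2"
proof -
  have "real_potential t (y + \<eta>) \<le> (\<Sum>i\<in>I. 2 * m i / norm (y - p i t)
      - 2 * (\<eta> \<bullet> attraction (m i) (p i t) y) + 5 * m i / \<rho> ^ 3 * (norm \<eta>)\<^sup>2)"
    unfolding real_potential_def
  proof (rule sum_mono)
    fix i assume i: "i \<in> I"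
    define r where "r = norm (y - p i t)"
    have r: "\<rho> \<le> r" "r > 0" using assms(2)[OF i] assms(1) unfolding r_def by linarith+
    have "1 / norm (y - p i t + \<eta>) \<le> 1 / r - ((y - p i t) \<bullet> \<eta>) / r ^ 3 + 5 / 2 * (norm \<eta>)\<^sup>2 / r ^ 3"
      unfolding r_def using r assms(2)[OF i] assms(1,3) by (intro inverse_norm_add_le) (auto simp: r_def)
    also have "5 / 2 * (norm \<eta>)\<^sup>2 / r ^ 3 \<le> 5 / 2 * (norm \<eta>)\<^sup>2 / \<rho> ^ 3"
      using r assms(1) by (intro divide_left_mono power_mono mult_pos_pos) auto
    finally have "2 * m i * (1 / norm (y - p i t + \<eta>))
       \<le> 2 * m i * (1 / r - ((y - p i t) \<bullet> \<eta>) / r ^ 3 + 5 / 2 * (norm \<eta>)\<^sup>2 / \<rho> ^ 3)"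
      using m_nonneg[OF i] by (intro mult_left_mono) auto
    moreover have "y - p i t + \<eta> = y + \<eta> - p i t" by simp
    moreover have "\<eta> \<bullet> attraction (m i) (p i t) y = m i * (((y - p i t) \<bullet> \<eta>) / r ^ 3)"
      by (simp add: attraction_def r_def inner_commute)
    ultimately show "2 * m i / norm (y + \<eta> - p i t) \<le> 2 * m i / norm (y - p i t)
      - 2 * (\<eta> \<bullet> attraction (m i) (p i t) y) + 5 * m i / \<rho> ^ 3 * (norm \<eta>)\<^sup>2"
      by (simp add: r_def[symmetric] right_diff_distrib distrib_left)
  qed
  also have "\<dots> = real_potential t y + 2 * (\<eta> \<bullet> force t y) + (\<Sum>i\<in>I. 5 * m i / \<rho> ^ 3) * (norm \<eta>)\<^sup>2"
    by (simp add: real_potential_def force_def sum.distrib sum_subtractf sum_distrib_right sum_distrib_left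
        inner_minus_right inner_sum_right)
  finally show ?thesis .
qed

lemma uniform_distance:
  assumes "continuous_on {a..b} w" "\<And>t i. t \<in> {a..b} \<Longrightarrow> i \<in> I \<Longrightarrow> w t \<noteq> p i t"
  obtains \<rho> where "\<rho> > 0" "\<And>t i. t \<in> {a..b} \<Longrightarrow> i \<in> I \<Longrightarrow> \<rho> \<le> norm (w t - p i t)"
proof (cases "a \<le> b")
  case True
  have "\<exists>r>0. \<forall>t\<in>{a..b}. r \<le> norm (w t - p i t)" if i: "i \<in> I" for i
  proof -
    have "continuous_on {a..b} (\<lambda>t. norm (w t - p i t))"
      by (intro continuous_intros assms(1) p_continuous[OF i])
    then obtain c where "c \<in> {a..b}" "\<And>t. t \<in> {a..b} \<Longrightarrow> norm (w c - p i c) \<le> norm (w t - p i t)"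
      using continuous_attains_inf[of "{a..b}" "\<lambda>t. norm (w t - p i t)"] True by auto
    then show ?thesis using assms(2)[of c i] i by (intro exI[of _ "norm (w c - p i c)"]) auto
  qed
  then obtain r where r: "\<And>i. i \<in> I \<Longrightarrow> r i > 0" "\<And>i t. i \<in> I \<Longrightarrow> t \<in> {a..b} \<Longrightarrow> r i \<le> norm (w t - p i t)"
    by metis
  show ?thesis
  proof (rule that[of "Min (insert 1 (r ` I))"])
    show "Min (insert 1 (r ` I)) > 0" using finite_I r by (subst Min_gr_iff) auto
    show "Min (insert 1 (r ` I)) \<le> norm (w t - p i t)" if "t \<in> {a..b}" "i \<in> I" for t i
      using finite_I r(2)[OF that(2,1)] that by (intro order_trans[OF Min_le[of _ "r i"]]) auto
  qed
qed (use that[of 1] in auto)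

lemma continuous_on_force:
  assumes "continuous_on S w" "\<And>t i. t \<in> S \<Longrightarrow> i \<in> I \<Longrightarrow> w t \<noteq> p i t"
  shows "continuous_on S (\<lambda>t. force t (w t))"
  unfolding force_def attraction_def
  by (intro continuous_intros assms(1) p_continuous) (use assms(2) in auto)

lemma continuous_on_real_potential:
  assumes "continuous_on S w" "\<And>t i. t \<in> S \<Longrightarrow> i \<in> I \<Longrightarrow> w t \<noteq> p i t"
  shows "continuous_on S (\<lambda>t. real_potential t (w t))"
  unfolding real_potential_def
  by (intro continuous_intros assms(1) p_continuous) (use assms(2) in auto)

end

lemma nn_integral_continuous_Icc:
  fixes f :: "real \<Rightarrow> real"
  assumes "continuous_on {a..b} f" "\<And>t. t \<in> {a..b} \<Longrightarrow> 0 \<le> f t"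
  shows "(\<integral>\<^sup>+t\<in>{a..b}. ennreal (f t) \<partial>lborel) = ennreal (integral {a..b} f)"
proof -
  have "(\<integral>\<^sup>+t\<in>{a..b}. ennreal (f t) \<partial>lborel) = (\<integral>\<^sup>+t. ennreal (indicator {a..b} t *\<^sub>R f t) \<partial>lborel)"
    by (intro nn_integral_cong) (auto simp: indicator_def)
  also have "\<dots> = ennreal (integral UNIV (\<lambda>t. indicator {a..b} t *\<^sub>R f t))"
  proof (rule nn_integral_has_integral_lborel)
    show "(\<lambda>t. indicator {a..b} t *\<^sub>R f t) \<in> borel_measurable borel"
      by (rule borel_measurable_continuous_on_indicator[OF _ assms(1)]) simp
    have "(f has_integral integral {a..b} f) {a..b}"
      using integrable_continuous_interval[OF assms(1)] by (rule integrable_integral)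
    then have "((\<lambda>t. if t \<in> {a..b} then f t else 0) has_integral integral {a..b} f) UNIV"
      by (simp only: has_integral_restrict_UNIV)
    moreover have "(\<lambda>t. if t \<in> {a..b} then f t else 0) = (\<lambda>t. indicator {a..b} t *\<^sub>R f t)"
      by (auto simp: indicator_def)
    ultimately have *: "((\<lambda>t. indicator {a..b} t *\<^sub>R f t) has_integral integral {a..b} f) UNIV" by simp
    then show "((\<lambda>t. indicator {a..b} t *\<^sub>R f t) has_integral integral UNIV (\<lambda>t. indicator {a..b} t *\<^sub>R f t)) UNIV"
      by (simp add: integral_unique)
  qed (use assms(2) in \<open>auto simp: indicator_def\<close>)
  also have "integral UNIV (\<lambda>t. indicator {a..b} t *\<^sub>R f t) = integral {a..b} f"
    by (subst integral_restrict_UNIV[symmetric]) (intro integral_cong, auto simp: indicator_def)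
  finally show ?thesis .
qed

context moving_centers
begin

text \<open>For a piecewise linear variation the change of the energy is exact, so the first variation
  is a second difference of \<open>w\<close> and no derivative of \<open>w\<close> is needed.\<close>

lemma second_difference:
  assumes w: "local_minimizer w" and \<delta>: "\<delta> > 0" and c: "0 \<le> c - \<delta>"
    and free: "\<And>t i. t \<in> {c - \<delta>..c + \<delta>} \<Longrightarrow> i \<in> I \<Longrightarrow> w t \<noteq> p i t"
  shows "w (c + \<delta>) + w (c - \<delta>) - 2 *\<^sub>R w c
    = \<delta> *\<^sub>R integral {c - \<delta>..c + \<delta>} (\<lambda>t. (1 - \<bar>t - c\<bar> / \<delta>) *\<^sub>R force t (w t))"
proof -
  define a b where "a = c - \<delta>" and "b = c + \<delta>"
  have ab: "0 \<le> a" "a < c" "c < b" "c - a = \<delta>" "b - c = \<delta>" using \<delta> c by (auto simp: a_def b_def)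
  have w_cont: "continuous_on UNIV w" using w by (simp add: local_minimizer_def)
  have w_cont': "continuous_on {a..b} w" by (rule continuous_on_subset[OF w_cont]) simp
  have fin: "action w {u..v} < \<infinity>" if "0 \<le> u" for u v using w that by (simp add: local_minimizer_def)
  have free': "w t \<noteq> p i t" if "t \<in> {a..b}" "i \<in> I" for t i using free that by (auto simp: a_def b_def)
  obtain \<rho> where \<rho>: "\<rho> > 0" "\<And>t i. t \<in> {a..b} \<Longrightarrow> i \<in> I \<Longrightarrow> \<rho> \<le> norm (w t - p i t)"
    using uniform_distance[OF w_cont' free'] by blast
  define \<phi> where "\<phi> t = max 0 (1 - \<bar>t - c\<bar> / \<delta>)" for t
  have \<phi>: "0 \<le> \<phi> t" "\<phi> t \<le> 1" for t using \<delta> by (auto simp: \<phi>_def)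
  have \<phi>_cont: "continuous_on S \<phi>" for S unfolding \<phi>_def by (intro continuous_intros) (use \<delta> in auto)
  have \<phi>_left: "\<phi> t = (t - a) / \<delta>" if "a \<le> t" "t \<le> c" for t
    using that \<delta> by (auto simp: \<phi>_def a_def field_simps max_def)
  have \<phi>_right: "\<phi> t = (b - t) / \<delta>" if "c \<le> t" "t \<le> b" for t
    using that \<delta> by (auto simp: \<phi>_def b_def field_simps max_def)
  have "energy w {a..c} < \<infinity>" "energy w {c..b} < \<infinity>"
    using fin[of a c] fin[of c b] ab by (auto simp: action_def less_top[symmetric])
  then obtain e1 e2 where e: "energy w {a..c} = ennreal e1" "energy w {c..b} = ennreal e2" "e1 \<ge> 0" "e2 \<ge> 0"
    by (cases "energy w {a..c}"; cases "energy w {c..b}") auto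
  define f where "f t = force t (w t)" for t
  have f_cont: "continuous_on {a..b} f" unfolding f_def using w_cont' free' by (rule continuous_on_force)
  define P where "P t = real_potential t (w t)" for t
  have P_cont: "continuous_on {a..b} P" unfolding P_def using w_cont' free' by (rule continuous_on_real_potential)
  have P_nonneg: "0 \<le> P t" for t unfolding P_def real_potential_def by (intro sum_nonneg) (auto simp: m_nonneg)
  define K where "K = (\<Sum>i\<in>I. 5 * m i / \<rho> ^ 3)"
  have K: "K \<ge> 0" unfolding K_def using \<rho> by (intro sum_nonneg) (auto simp: m_nonneg)
  \<comment> \<open>\<open>2 * s * (x \<bullet> v)\<close> is the first-order change of the doubled
    action under the variation \<open>s * \<phi>\<close> in the direction \<open>x\<close>: the
    slopes of the hat produce the second difference, the potential the weighted force.\<close>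
  define v where "v = (1 / \<delta>) *\<^sub>R ((w c - w a) - (w b - w c)) + integral {a..b} (\<lambda>t. \<phi> t *\<^sub>R f t)"
  have "x \<bullet> v = 0" for x
  proof (rule quadratic_nonneg_imp_linear_zero)
    \<comment> \<open>Keeps the variation below \<open>\<rho> / 2\<close>, where the expansion of
      the potential applies, and below 1, as \<open>local_minimizer\<close> demands.\<close>
    define s0 where "s0 = min \<rho> 1 / (2 * (norm x + 1))"
    show "s0 / 2 > 0" using \<rho> by (auto simp: s0_def intro!: divide_pos_pos add_nonneg_pos)
    show "0 \<le> s * (x \<bullet> v) + s\<^sup>2 * ((norm x)\<^sup>2 / \<delta> + K * (norm x)\<^sup>2 * \<delta>)" if s: "\<bar>s\<bar> \<le> s0 / 2" for s
    proof -
      have xs: "\<bar>s\<bar> * norm x \<le> \<rho> / 2" "\<bar>s\<bar> * norm x \<le> 1"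
      proof -
        have "s0 \<ge> 0" using \<open>s0 / 2 > 0\<close> by simp
        then have "\<bar>s\<bar> * norm x \<le> s0 * (norm x + 1)" using s by (intro mult_mono) auto
        also have "\<dots> = min \<rho> 1 / 2"
        proof -
          have "y / (2 * k) * k = y / 2" if "k > 0" for y k :: real using that by simp
          from this[of "norm x + 1" "min \<rho> 1"] show ?thesis unfolding s0_def by (simp add: add_nonneg_pos)
        qed
        finally show "\<bar>s\<bar> * norm x \<le> \<rho> / 2" "\<bar>s\<bar> * norm x \<le> 1" by auto
      qed
      define g where "g t = w t + (s * \<phi> t) *\<^sub>R x" for t
      have g_cont: "continuous_on UNIV g" unfolding g_def by (intro continuous_intros w_cont \<phi>_cont)
      have g_diff: "norm (g t - w t) \<le> \<bar>s\<bar> * norm x" for t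
      proof -
        have "\<bar>s\<bar> * \<phi> t * norm x \<le> \<bar>s\<bar> * 1 * norm x"
          using \<phi> by (intro mult_right_mono mult_left_mono) auto
        then show ?thesis using \<phi>[of t] by (simp add: g_def abs_mult)
      qed
      have "g a = w a" "g b = w b" using ab \<phi>_left[of a] \<phi>_right[of b] by (auto simp: g_def)
      moreover have "\<forall>t\<in>{a..b}. norm (g t - w t) \<le> 1" using g_diff xs(2) by (meson order_trans)
      moreover have "a < b" using ab by linarith
      ultimately have min: "action w {a..b} \<le> action g {a..b}"
        using w g_cont ab(1) unfolding local_minimizer_def by blast
      define \<beta> where "\<beta> = (s / \<delta>) *\<^sub>R x"
      define X1 where "X1 = e1 + 2 * (\<beta> \<bullet> (w c - w a)) + (norm \<beta>)\<^sup>2 * (c - a)"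
      define X2 where "X2 = e2 + 2 * ((- \<beta>) \<bullet> (w b - w c)) + (norm (- \<beta>))\<^sup>2 * (b - c)"
      have X: "X1 \<ge> 0" "X2 \<ge> 0"
        unfolding X1_def X2_def by (rule energy_add_affine_bound_nonneg; use e ab in simp)+
      have "energy g {a..c} = energy (\<lambda>t. w t + ((- a) *\<^sub>R \<beta> + t *\<^sub>R \<beta>)) {a..c}"
      proof (rule energy_cong)
        fix t assume t: "t \<in> {a..c}"
        have "(- a) *\<^sub>R \<beta> + t *\<^sub>R \<beta> = (t - a) *\<^sub>R \<beta>" by (simp add: scaleR_diff_left)
        also have "\<dots> = (s * \<phi> t) *\<^sub>R x" using t by (simp add: \<phi>_left \<beta>_def mult.commute)
        finally show "g t = w t + ((- a) *\<^sub>R \<beta> + t *\<^sub>R \<beta>)" by (simp add: g_def)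
      qed
      also have "\<dots> \<le> ennreal X1"
        unfolding X1_def by (rule energy_add_affine_le) (use e ab in auto)
      finally have en1: "energy g {a..c} \<le> ennreal X1" .
      have "energy g {c..b} = energy (\<lambda>t. w t + (b *\<^sub>R \<beta> + t *\<^sub>R (- \<beta>))) {c..b}"
      proof (rule energy_cong)
        fix t assume t: "t \<in> {c..b}"
        have "b *\<^sub>R \<beta> + t *\<^sub>R (- \<beta>) = (b - t) *\<^sub>R \<beta>" by (simp add: scaleR_diff_left)
        also have "\<dots> = (s * \<phi> t) *\<^sub>R x" using t by (simp add: \<phi>_right \<beta>_def mult.commute)
        finally show "g t = w t + (b *\<^sub>R \<beta> + t *\<^sub>R (- \<beta>))" by (simp add: g_def)
      qed
      also have "\<dots> \<le> ennreal X2"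
        unfolding X2_def by (rule energy_add_affine_le) (use e ab in auto)
      finally have en2: "energy g {c..b} \<le> ennreal X2" .
      have en: "energy g {a..b} \<le> ennreal (X1 + X2)"
        using add_mono[OF en1 en2] energy_Icc_split[of a c b g] ab X by simp
      define Q where "Q t = P t + 2 * s * (x \<bullet> (\<phi> t *\<^sub>R f t)) + K * (s\<^sup>2 * (norm x)\<^sup>2)" for t
      have Q_ge: "real_potential t (g t) \<le> Q t" if t: "t \<in> {a..b}" for t
      proof -
        have "real_potential t (g t) \<le> P t + 2 * (((s * \<phi> t) *\<^sub>R x) \<bullet> f t) + K * (norm ((s * \<phi> t) *\<^sub>R x))\<^sup>2"
          unfolding g_def P_def f_def K_def
          by (rule real_potential_add_le[OF \<rho>(1) \<rho>(2)[OF t]])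
             (use g_diff[of t] xs(1) in \<open>auto simp: g_def\<close>)
        also have "(norm ((s * \<phi> t) *\<^sub>R x))\<^sup>2 \<le> (\<bar>s\<bar> * norm x)\<^sup>2"
          using g_diff[of t] by (intro power_mono) (auto simp: g_def)
        then have "K * (norm ((s * \<phi> t) *\<^sub>R x))\<^sup>2 \<le> K * (s\<^sup>2 * (norm x)\<^sup>2)"
          using K by (intro mult_left_mono) (auto simp: power_mult_distrib)
        finally show ?thesis by (simp add: Q_def)
      qed
      have Q_nonneg: "0 \<le> Q t" if "t \<in> {a..b}" for t
      proof -
        have "0 \<le> real_potential t (g t)" unfolding real_potential_def by (intro sum_nonneg) (auto simp: m_nonneg)
        then show ?thesis using Q_ge[OF that] by linarith
      qed
      have g_free: "g t \<noteq> p i t" if "t \<in> {a..b}" "i \<in> I" for t i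
      proof
        assume "g t = p i t"
        then have "\<rho> \<le> norm (g t - w t)" using \<rho>(2)[OF that] by (simp add: norm_minus_commute)
        then show False using g_diff[of t] xs(1) \<rho>(1) by linarith
      qed
      have fint: "(\<lambda>t. \<phi> t *\<^sub>R f t) integrable_on {a..b}"
        by (intro integrable_continuous_interval continuous_intros \<phi>_cont f_cont)
      have Q_cont: "continuous_on {a..b} Q"
        unfolding Q_def by (intro continuous_intros P_cont \<phi>_cont f_cont)
      have "potential_integral g {a..b} \<le> (\<integral>\<^sup>+t\<in>{a..b}. ennreal (Q t) \<partial>lborel)"
        by (intro nn_integral_mono) (auto simp: indicator_def potential_eq_real g_free intro!: ennreal_leI Q_ge)
      also have "\<dots> = ennreal (integral {a..b} Q)"
        by (rule nn_integral_continuous_Icc[OF Q_cont Q_nonneg])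
      finally have pot: "potential_integral g {a..b} \<le> ennreal (integral {a..b} Q)" .
      have "integral {a..b} Q = integral {a..b} P + 2 * s * integral {a..b} (\<lambda>t. x \<bullet> (\<phi> t *\<^sub>R f t))
          + K * (s\<^sup>2 * (norm x)\<^sup>2) * (b - a)"
      proof -
        have i1: "(P has_integral integral {a..b} P) {a..b}"
          by (intro integrable_integral integrable_continuous_interval P_cont)
        have i2: "((\<lambda>t. x \<bullet> (\<phi> t *\<^sub>R f t)) has_integral integral {a..b} (\<lambda>t. x \<bullet> (\<phi> t *\<^sub>R f t))) {a..b}"
          by (intro integrable_integral integrable_continuous_interval continuous_intros \<phi>_cont f_cont)
        have i3: "((\<lambda>t. K * (s\<^sup>2 * (norm x)\<^sup>2)) has_integral K * (s\<^sup>2 * (norm x)\<^sup>2) * (b - a)) {a..b}"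
          using has_integral_const_real[of "K * (s\<^sup>2 * (norm x)\<^sup>2)" a b] ab by (simp add: mult.commute)
        show ?thesis unfolding Q_def
          by (rule integral_unique[OF has_integral_add[OF has_integral_add[OF i1 has_integral_mult_right[OF i2]] i3]])
      qed
      also have "integral {a..b} (\<lambda>t. x \<bullet> (\<phi> t *\<^sub>R f t)) = x \<bullet> integral {a..b} (\<lambda>t. \<phi> t *\<^sub>R f t)"
        using integral_linear[OF fint bounded_linear_inner_right[of x]] by (simp add: o_def)
      finally have int_Q: "integral {a..b} Q = integral {a..b} P + 2 * s * (x \<bullet> integral {a..b} (\<lambda>t. \<phi> t *\<^sub>R f t))
          + K * (s\<^sup>2 * (norm x)\<^sup>2) * (b - a)" .
      have int_nonneg: "0 \<le> integral {a..b} Q" "0 \<le> integral {a..b} P"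
        using Q_nonneg P_nonneg by (auto intro!: integral_nonneg integrable_continuous_interval Q_cont P_cont)
      have act_w: "action w {a..b} = ennreal (e1 + e2 + integral {a..b} P)"
      proof -
        have "potential_integral w {a..b} = (\<integral>\<^sup>+t\<in>{a..b}. ennreal (P t) \<partial>lborel)"
          by (intro nn_integral_cong) (auto simp: indicator_def potential_eq_real free' P_def)
        also have "\<dots> = ennreal (integral {a..b} P)"
          by (rule nn_integral_continuous_Icc[OF P_cont P_nonneg])
        finally show ?thesis
          using energy_Icc_split[of a c b w] ab e int_nonneg by (simp add: action_def)
      qed
      have "action g {a..b} \<le> ennreal (X1 + X2) + ennreal (integral {a..b} Q)"
        unfolding action_def by (rule add_mono[OF en pot])
      also have "\<dots> = ennreal (X1 + X2 + integral {a..b} Q)" using X int_nonneg by simp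
      finally have "ennreal (e1 + e2 + integral {a..b} P) \<le> ennreal (X1 + X2 + integral {a..b} Q)"
        using min unfolding act_w by (rule order_trans[rotated])
      then have "e1 + e2 + integral {a..b} P \<le> X1 + X2 + integral {a..b} Q"
        by (rule iffD1[OF ennreal_le_iff, rotated]) (use X int_nonneg in simp)
      then have "0 \<le> 2 * (\<beta> \<bullet> (w c - w a)) + 2 * ((- \<beta>) \<bullet> (w b - w c)) + 2 * (norm \<beta>)\<^sup>2 * \<delta>
          + 2 * s * (x \<bullet> integral {a..b} (\<lambda>t. \<phi> t *\<^sub>R f t)) + K * (s\<^sup>2 * (norm x)\<^sup>2) * (2 * \<delta>)"
        unfolding X1_def X2_def int_Q using ab by (simp add: algebra_simps a_def b_def)
      moreover have "2 * (\<beta> \<bullet> (w c - w a)) + 2 * ((- \<beta>) \<bullet> (w b - w c)) + 2 * s * (x \<bullet> integral {a..b} (\<lambda>t. \<phi> t *\<^sub>R f t))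
          = 2 * (s * (x \<bullet> v))"
      proof -
        have "x \<bullet> v = 1 / \<delta> * (x \<bullet> (w c - w a) - x \<bullet> (w b - w c)) + x \<bullet> integral {a..b} (\<lambda>t. \<phi> t *\<^sub>R f t)"
          unfolding v_def by (simp only: inner_add_right inner_scaleR_right inner_diff_right)
        then show ?thesis unfolding \<beta>_def inner_minus_left inner_scaleR_left
          by (simp only:) (simp add: right_diff_distrib distrib_left)
      qed
      moreover have "2 * (norm \<beta>)\<^sup>2 * \<delta> = 2 * (s\<^sup>2 * ((norm x)\<^sup>2 / \<delta>))"
        using \<delta> by (simp add: \<beta>_def power2_eq_square field_simps)
      ultimately show ?thesis by (simp add: algebra_simps)
    qed
  qed
  then have "v = 0" using inner_eq_zero_iff by blast
  then have "\<delta> *\<^sub>R v = 0" by simp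
  then have "(w c - w a) - (w b - w c) + \<delta> *\<^sub>R integral {a..b} (\<lambda>t. \<phi> t *\<^sub>R f t) = 0"
    using \<delta> by (simp add: v_def scaleR_right_distrib)
  moreover have "integral {a..b} (\<lambda>t. \<phi> t *\<^sub>R f t) = integral {a..b} (\<lambda>t. (1 - \<bar>t - c\<bar> / \<delta>) *\<^sub>R f t)"
    by (intro integral_cong) (use \<delta> in \<open>auto simp: \<phi>_def a_def b_def max_def field_simps abs_if split: if_splits\<close>)
  ultimately have "w b + w a - 2 *\<^sub>R w c = \<delta> *\<^sub>R integral {a..b} (\<lambda>t. (1 - \<bar>t - c\<bar> / \<delta>) *\<^sub>R f t)"
    by (simp add: scaleR_2 algebra_simps add_eq_0_iff)
  then show ?thesis by (simp add: a_def b_def f_def)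
qed

text \<open>\<open>G\<close> is a double primitive of the force along \<open>w\<close>. Integration
  by parts against the hat shows that \<open>G\<close> has the same second differences as
  \<open>w\<close>; so \<open>w - G\<close> is continuous and midpoint-linear, hence affine, and
  \<open>w\<close> inherits two derivatives from \<open>G\<close>.\<close>

theorem local_minimizer_equation:
  assumes w: "local_minimizer w" and ab: "0 \<le> a" "a < b"
    and free: "\<And>t i. t \<in> {a..b} \<Longrightarrow> i \<in> I \<Longrightarrow> w t \<noteq> p i t"
  obtains w' where "\<And>t. t \<in> {a..b} \<Longrightarrow> (w has_vector_derivative w' t) (at t within {a..b})"
    "\<And>t. t \<in> {a..b} \<Longrightarrow> (w' has_vector_derivative force t (w t)) (at t within {a..b})"
proof -
  have w_cont: "continuous_on {a..b} w"
    using w continuous_on_subset by (auto simp: local_minimizer_def)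
  define f where "f t = force t (w t)" for t
  have f_cont: "continuous_on {a..b} f" unfolding f_def using w_cont free by (rule continuous_on_force)
  define F where "F t = integral {a..t} f" for t
  have F: "(F has_vector_derivative f t) (at t within {a..b})" if "t \<in> {a..b}" for t
    unfolding F_def using f_cont that by (rule integral_has_vector_derivative)
  then have F_cont: "continuous_on {a..b} F"
    by (meson continuous_on_eq_continuous_within has_vector_derivative_continuous)
  define G where "G t = integral {a..t} F" for t
  have G: "(G has_vector_derivative F t) (at t within {a..b})" if "t \<in> {a..b}" for t
    unfolding G_def using F_cont that by (rule integral_has_vector_derivative)
  then have G_cont: "continuous_on {a..b} G"
    by (meson continuous_on_eq_continuous_within has_vector_derivative_continuous)
  define u where "u t = w t - G t" for t
  have u_cont: "continuous_on {a..b} u" unfolding u_def by (intro continuous_intros w_cont G_cont)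
  have mid: "u (c + \<delta>) + u (c - \<delta>) = 2 *\<^sub>R u c" if \<delta>: "\<delta> > 0" "a \<le> c - \<delta>" "c + \<delta> \<le> b" for c \<delta>
  proof -
    let ?\<phi> = "\<lambda>t. 1 - \<bar>t - c\<bar> / \<delta>"
    have weighted: "((\<lambda>t. (\<alpha> + \<beta> * t) *\<^sub>R f t) has_integral
        ((\<alpha> + \<beta> * s') *\<^sub>R F s' - \<beta> *\<^sub>R G s') - ((\<alpha> + \<beta> * s) *\<^sub>R F s - \<beta> *\<^sub>R G s)) {s..s'}"
      if s: "a \<le> s" "s \<le> s'" "s' \<le> b" for \<alpha> \<beta> s s'
    proof (rule fundamental_theorem_of_calculus[OF s(2)])
      fix t assume "t \<in> {s..s'}"
      then have t: "t \<in> {a..b}" "{s..s'} \<subseteq> {a..b}" using s by auto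
      note [derivative_intros] = has_vector_derivative_within_subset[OF F[OF t(1)] t(2)]
        has_vector_derivative_within_subset[OF G[OF t(1)] t(2)]
      show "((\<lambda>t. (\<alpha> + \<beta> * t) *\<^sub>R F t - \<beta> *\<^sub>R G t) has_vector_derivative (\<alpha> + \<beta> * t) *\<^sub>R f t) (at t within {s..s'})"
        by (auto intro!: derivative_eq_intros)
    qed
    have "((\<lambda>t. (- (c - \<delta>) / \<delta> + 1 / \<delta> * t) *\<^sub>R f t) has_integral F c - (1 / \<delta>) *\<^sub>R G c + (1 / \<delta>) *\<^sub>R G (c - \<delta>)) {c - \<delta>..c}"
      using weighted[of "c - \<delta>" c "- (c - \<delta>) / \<delta>" "1 / \<delta>"] \<delta>
      by (simp add: add_divide_distrib[symmetric])
    then have I1: "((\<lambda>t. ?\<phi> t *\<^sub>R f t) has_integral F c - (1 / \<delta>) *\<^sub>R G c + (1 / \<delta>) *\<^sub>R G (c - \<delta>)) {c - \<delta>..c}"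
      by (rule has_integral_eq[rotated]) (use \<delta>(1) in \<open>auto simp: field_simps\<close>)
    have "((\<lambda>t. ((c + \<delta>) / \<delta> + - (1 / \<delta>) * t) *\<^sub>R f t) has_integral (1 / \<delta>) *\<^sub>R G (c + \<delta>) - (F c + (1 / \<delta>) *\<^sub>R G c)) {c..c + \<delta>}"
      using weighted[of c "c + \<delta>" "(c + \<delta>) / \<delta>" "- (1 / \<delta>)"] \<delta>
      by (simp add: add_divide_distrib[symmetric] diff_divide_distrib[symmetric])
    then have I2: "((\<lambda>t. ?\<phi> t *\<^sub>R f t) has_integral (1 / \<delta>) *\<^sub>R G (c + \<delta>) - (F c + (1 / \<delta>) *\<^sub>R G c)) {c..c + \<delta>}"
      by (rule has_integral_eq[rotated]) (use \<delta>(1) in \<open>auto simp: field_simps\<close>)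
    have "((\<lambda>t. ?\<phi> t *\<^sub>R f t) has_integral
        (F c - (1 / \<delta>) *\<^sub>R G c + (1 / \<delta>) *\<^sub>R G (c - \<delta>)) + ((1 / \<delta>) *\<^sub>R G (c + \<delta>) - (F c + (1 / \<delta>) *\<^sub>R G c))) {c - \<delta>..c + \<delta>}"
      by (rule has_integral_combine[OF _ _ I1 I2]) (use \<delta> in auto)
    then have int: "integral {c - \<delta>..c + \<delta>} (\<lambda>t. ?\<phi> t *\<^sub>R f t) = (1 / \<delta>) *\<^sub>R (G (c + \<delta>) + G (c - \<delta>) - 2 *\<^sub>R G c)"
      by (simp add: integral_unique scaleR_2 algebra_simps)
    have "w (c + \<delta>) + w (c - \<delta>) - 2 *\<^sub>R w c = \<delta> *\<^sub>R integral {c - \<delta>..c + \<delta>} (\<lambda>t. ?\<phi> t *\<^sub>R f t)"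
      unfolding f_def by (rule second_difference[OF w]) (use \<delta> ab free in auto)
    also have "\<dots> = G (c + \<delta>) + G (c - \<delta>) - 2 *\<^sub>R G c" using \<delta>(1) by (simp add: int)
    finally show ?thesis by (simp add: u_def algebra_simps)
  qed
  define \<kappa> where "\<kappa> = (1 / (b - a)) *\<^sub>R (u b - u a)"
  have w_eq: "w t = G t + u a + (t - a) *\<^sub>R \<kappa>" if "t \<in> {a..b}" for t
    using midpoint_linear_imp_affine[OF u_cont ab(2) mid that] by (simp add: u_def \<kappa>_def algebra_simps)
  show ?thesis
  proof (rule that[of "\<lambda>t. F t + \<kappa>"])
    fix t assume t: "t \<in> {a..b}"
    note [derivative_intros] = F[OF t] G[OF t]
    show "((\<lambda>t. F t + \<kappa>) has_vector_derivative force t (w t)) (at t within {a..b})"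
      by (auto intro!: derivative_eq_intros simp: f_def)
    have "((\<lambda>t. G t + u a + (t - a) *\<^sub>R \<kappa>) has_vector_derivative F t + \<kappa>) (at t within {a..b})"
      by (auto intro!: derivative_eq_intros)
    then show "(w has_vector_derivative F t + \<kappa>) (at t within {a..b})"
      by (rule has_vector_derivative_transform[OF t, rotated]) (rule w_eq)
  qed
qed

end

section \<open>Existence of minimisers\<close>

lemma Hoelder_continuous_on_UNIV:
  fixes f :: "real \<Rightarrow> 'a::real_normed_vector"
  assumes "K \<ge> 0" "\<And>s t. norm (f t - f s) \<le> K * sqrt \<bar>t - s\<bar>"
  shows "continuous_on UNIV f"
  unfolding continuous_on_iff
proof (intro ballI allI impI)
  fix s e :: real assume e: "0 < e"
  define \<delta> where "\<delta> = (e / (K + 1))\<^sup>2"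
  have \<delta>: "\<delta> > 0" using e assms(1) by (simp add: \<delta>_def)
  moreover have "dist (f t) (f s) < e" if "dist t s < \<delta>" for t
  proof -
    have "sqrt \<bar>t - s\<bar> < sqrt \<delta>" using that by (simp add: dist_real_def)
    also have "sqrt \<delta> = e / (K + 1)" using e assms(1) by (simp add: \<delta>_def)
    finally have "(K + 1) * sqrt \<bar>t - s\<bar> < e" using assms(1) by (simp add: field_simps)
    moreover have "K * sqrt \<bar>t - s\<bar> \<le> (K + 1) * sqrt \<bar>t - s\<bar>" by (intro mult_right_mono) auto
    ultimately show ?thesis using assms(2)[of t s] by (simp add: dist_norm)
  qed
  ultimately show "\<exists>d>0. \<forall>x'\<in>UNIV. dist x' s < d \<longrightarrow> dist (f x') (f s) < e" by blast
qed

text \<open>Arzela-Ascoli on the line: a diagonal subsequence converges at rational times, and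
  equicontinuity makes it Cauchy at all others. Pointwise convergence is what the semicontinuity of
  the action uses.\<close>

lemma Hoelder_convergent_subsequence:
  fixes u :: "nat \<Rightarrow> real \<Rightarrow> 'a::{real_normed_vector,heine_borel}"
  assumes K: "K \<ge> 0" and H: "\<And>n s t. norm (u n t - u n s) \<le> K * sqrt \<bar>t - s\<bar>" and u0: "\<And>n. u n 0 = 0"
  obtains r w where "strict_mono (r :: nat \<Rightarrow> nat)" "\<And>t. (\<lambda>n. u (r n) t) \<longlonglongrightarrow> w t"
    "continuous_on UNIV w"
proof -
  have bound: "norm ((1 / (1 + \<bar>t\<bar>)) *\<^sub>R u n t) \<le> K" for n t
  proof -
    have "norm (u n t) \<le> K * sqrt \<bar>t\<bar>" using H[of n t 0] u0[of n] by simp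
    also have "\<dots> \<le> K * (1 + \<bar>t\<bar>)"
      using K by (intro mult_left_mono real_le_lsqrt) (auto simp: power2_eq_square algebra_simps)
    finally show ?thesis by (simp add: field_simps)
  qed
  \<comment> \<open>The diagonal argument asks for one bound at all times, hence the weight
    \<open>1 / (1 + \<bar>t\<bar>)\<close>, which dominates the growth
    \<open>K * sqrt \<bar>t\<bar>\<close>.\<close>
  obtain r :: "nat \<Rightarrow> nat" where r: "strict_mono r"
    "\<And>t. t \<in> \<rat> \<Longrightarrow> \<exists>l. (\<lambda>n. (1 / (1 + \<bar>t\<bar>)) *\<^sub>R u (r n) t) \<longlonglongrightarrow> l"
    by (rule function_convergent_subsequence[of \<rat> "\<lambda>n t. (1 / (1 + \<bar>t\<bar>)) *\<^sub>R u n t" K, OF countable_rat bound]) (rule that)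
  have rat: "convergent (\<lambda>n. u (r n) t)" if t: "t \<in> \<rat>" for t
  proof -
    obtain l where l: "(\<lambda>n. (1 / (1 + \<bar>t\<bar>)) *\<^sub>R u (r n) t) \<longlonglongrightarrow> l" using r(2)[OF t] by blast
    have "(\<lambda>n. (1 + \<bar>t\<bar>) *\<^sub>R ((1 / (1 + \<bar>t\<bar>)) *\<^sub>R u (r n) t)) \<longlonglongrightarrow> (1 + \<bar>t\<bar>) *\<^sub>R l"
      by (intro tendsto_intros l)
    moreover have "1 + \<bar>t\<bar> \<noteq> 0" by linarith
    ultimately show ?thesis by (auto simp: convergent_def)
  qed
  have conv: "convergent (\<lambda>n. u (r n) t)" for t
  proof -
    have "Cauchy (\<lambda>n. u (r n) t)"
    proof (rule CauchyI)
      fix e :: real assume e: "0 < e"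
      define \<delta> where "\<delta> = (e / (3 * (K + 1)))\<^sup>2"
      have \<delta>: "\<delta> > 0" using e K by (simp add: \<delta>_def)
      obtain q where q: "q \<in> \<rat>" "t < q" "q < t + \<delta>" using Rats_dense_in_real[of t "t + \<delta>"] \<delta> by auto
      have near: "norm (u n t - u n q) < e / 3" for n
      proof -
        have "norm (u n t - u n q) \<le> K * sqrt \<bar>t - q\<bar>" by (rule H)
        also have "\<dots> \<le> K * sqrt \<delta>" using q K by (intro mult_left_mono real_sqrt_le_mono) auto
        also have "sqrt \<delta> = e / (3 * (K + 1))" using e K by (simp add: \<delta>_def)
        also have "K * (e / (3 * (K + 1))) < e / 3" using e K by (simp add: field_simps)
        finally show ?thesis .
      qed
      obtain M where M: "\<And>i j. i \<ge> M \<Longrightarrow> j \<ge> M \<Longrightarrow> norm (u (r i) q - u (r j) q) < e / 3"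
        using CauchyD[OF convergent_Cauchy[OF rat[OF q(1)]], of "e / 3"] e by auto
      show "\<exists>M. \<forall>i\<ge>M. \<forall>j\<ge>M. norm (u (r i) t - u (r j) t) < e"
      proof (intro exI allI impI)
        fix i j assume ij: "i \<ge> M" "j \<ge> M"
        have "u (r i) t - u (r j) t = (u (r i) t - u (r i) q) + (u (r i) q - u (r j) q) - (u (r j) t - u (r j) q)"
          by simp
        also have "norm \<dots> \<le> norm (u (r i) t - u (r i) q) + norm (u (r i) q - u (r j) q) + norm (u (r j) t - u (r j) q)"
          by (meson add_mono norm_triangle_ineq norm_triangle_ineq4 order_refl order_trans)
        also have "\<dots> < e" using near[of "r i"] near[of "r j"] M[OF ij] by linarith
        finally show "norm (u (r i) t - u (r j) t) < e" .
      qed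
    qed
    then show ?thesis by (rule Cauchy_convergent)
  qed
  define w where "w t = lim (\<lambda>n. u (r n) t)" for t
  have w: "(\<lambda>n. u (r n) t) \<longlonglongrightarrow> w t" for t using conv unfolding w_def by (simp add: convergent_LIMSEQ_iff)
  have "norm (w t - w s) \<le> K * sqrt \<bar>t - s\<bar>" for s t
    by (rule LIMSEQ_le_const2[OF tendsto_norm[OF tendsto_diff[OF w w]]]) (use H in blast)
  from Hoelder_continuous_on_UNIV[OF K this] show ?thesis using that r(1) w by blast
qed

context moving_centers
begin

text \<open>Subtracting \<open>k\<close>, with truncation at \<open>0\<close>, makes the action on the whole half-line finite and
  keeps it nonnegative.\<close>

definition reduced_action :: "(real \<Rightarrow> real) \<Rightarrow> (real \<Rightarrow> complex) \<Rightarrow> real set \<Rightarrow> ennreal" where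
  "reduced_action k w S = energy w S + (\<integral>\<^sup>+t\<in>S. (potential t (w t) - ennreal (k t)) \<partial>lborel)"

text \<open>Paths on the half-line starting at 0, continued by 0 to negative times so that
  continuity is a statement on the whole line.\<close>

definition paths :: "(real \<Rightarrow> complex) set" where
  "paths = {w. continuous_on UNIV w \<and> (\<forall>t\<le>0. w t = 0)}"

text \<open>With values in \<open>ennreal\<close> this includes the centres, so the integrands
  converge pointwise even where the limit path runs into a collision.\<close>

lemma continuous_on_potential: "continuous_on S (potential t)"
  unfolding potential_def divide_ennreal_def
  by (intro continuous_on_sum ennreal_continuous_on_cmult continuous_on_inverse_ennreal
      continuous_on_ennreal continuous_intros) auto

text \<open>Only the limit of the total is known, not those of its two parts. For one fixed
  partition the energy sum converges, so it is subtracted from the total, and Fatou's lemma applies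
  to the potential; the supremum over partitions comes last.\<close>

lemma reduced_action_lower_semicontinuous:
  assumes [measurable]: "k \<in> borel_measurable borel"
    and u: "\<And>n. continuous_on UNIV (u n)" and w: "continuous_on UNIV w" and S [measurable]: "S \<in> sets borel"
    and lim: "\<And>t. (\<lambda>n. u n t) \<longlonglongrightarrow> w t"
    and act: "(\<lambda>n. reduced_action k (u n) S) \<longlonglongrightarrow> c"
  shows "reduced_action k w S \<le> c"
proof -
  define J where "J v = (\<integral>\<^sup>+t\<in>S. (potential t (v t) - ennreal (k t)) \<partial>lborel)" for v
  have [measurable]: "(\<lambda>t. potential t (u n t)) \<in> borel_measurable borel" for n
    by (rule measurable_potential[OF u])
  have J_lsc: "J w \<le> liminf (\<lambda>n. J (u n))"
  proof -
    have conv: "(\<lambda>n. (potential t (u n t) - ennreal (k t)) * indicator S t) \<longlonglongrightarrow> (potential t (w t) - ennreal (k t)) * indicator S t" for t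
    proof -
      have "(\<lambda>n. potential t (u n t)) \<longlonglongrightarrow> potential t (w t)"
        by (rule continuous_on_tendsto_compose[OF continuous_on_potential[of UNIV] lim]) auto
      then have "(\<lambda>n. potential t (u n t) - ennreal (k t)) \<longlonglongrightarrow> potential t (w t) - ennreal (k t)"
        by (intro tendsto_diff_ennreal_general tendsto_const) auto
      then show ?thesis by (cases "t \<in> S") auto
    qed
    have "J w = (\<integral>\<^sup>+t. liminf (\<lambda>n. (potential t (u n t) - ennreal (k t)) * indicator S t) \<partial>lborel)"
      unfolding J_def by (intro nn_integral_cong) (rule lim_imp_Liminf[OF _ conv, symmetric], simp)
    also have "\<dots> \<le> liminf (\<lambda>n. J (u n))" unfolding J_def by (rule nn_integral_liminf) measurable
    finally show ?thesis .
  qed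
  have main: "ennreal (energy_sum w ts) + J w \<le> c" if ts: "sorted ts" "set ts \<subseteq> S" for ts
  proof -
    have lim_ts: "(\<lambda>n. ennreal (energy_sum (u n) ts)) \<longlonglongrightarrow> ennreal (energy_sum w ts)"
      by (intro tendsto_ennrealI tendsto_energy_sum lim)
    have le: "ennreal (energy_sum (u n) ts) + J (u n) \<le> reduced_action k (u n) S" for n
      unfolding reduced_action_def J_def using energy_geI[OF ts, of "u n"] by (intro add_mono) auto
    then have "J (u n) \<le> reduced_action k (u n) S - ennreal (energy_sum (u n) ts)" for n
      by (subst ennreal_le_minus_iff) (simp add: add.commute)
    then have "liminf (\<lambda>n. J (u n)) \<le> liminf (\<lambda>n. reduced_action k (u n) S - ennreal (energy_sum (u n) ts))"
      by (intro Liminf_mono) auto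
    also have "\<dots> = c - ennreal (energy_sum w ts)"
      by (intro lim_imp_Liminf tendsto_diff_ennreal_general act lim_ts) auto
    finally have "J w \<le> c - ennreal (energy_sum w ts)" using J_lsc by (rule order_trans[rotated])
    moreover have "ennreal (energy_sum w ts) \<le> c"
      by (rule LIMSEQ_le[OF lim_ts act]) (use le add_increasing2 in \<open>force intro: order_trans[OF _ le]\<close>)
    ultimately show ?thesis by (metis add.commute add_left_mono diff_add_cancel_ennreal)
  qed
  have "reduced_action k w S = (SUP ts\<in>{ts. sorted ts \<and> set ts \<subseteq> S}. ennreal (energy_sum w ts) + J w)"
    unfolding reduced_action_def J_def energy_def
    by (rule ennreal_SUP_add_left[symmetric]) (auto intro: exI[of _ "[]"])
  also have "\<dots> \<le> c" using main by (intro SUP_least) auto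
  finally show ?thesis .
qed

lemma minimizer_exists:
  assumes k [measurable]: "k \<in> borel_measurable borel"
    and w0: "w0 \<in> paths" "reduced_action k w0 {0..} \<le> ennreal (B\<^sup>2)"
  obtains w where "w \<in> paths" "reduced_action k w {0..} \<le> ennreal (B\<^sup>2)"
    "\<And>g. g \<in> paths \<Longrightarrow> reduced_action k w {0..} \<le> reduced_action k g {0..}"
proof -
  let ?F = "\<lambda>w. reduced_action k w {0..}"
  define c where "c = (INF w\<in>paths. ?F w)"
  have c: "c \<le> ennreal (B\<^sup>2)" unfolding c_def using w0 by (meson INF_lower order_trans)
  obtain f :: "nat \<Rightarrow> ennreal" where f: "decseq f" "range f \<subseteq> ?F ` paths" "c = (INF i. f i)"
    using ennreal_Inf_countable_INF[of "?F ` paths"] w0(1) unfolding c_def by auto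
  have f_lim: "f \<longlonglongrightarrow> c" unfolding f(3) using f(1) by (rule LIMSEQ_INF)
  have "\<forall>n. \<exists>v. v \<in> paths \<and> f n = ?F v" using f(2) by blast
  then obtain v where v: "\<And>n. v n \<in> paths" "\<And>n. f n = ?F (v n)" by metis
  \<comment> \<open>The infimum is strictly below \<open>B^2 + 1\<close>, so from some index on the
    minimising sequence has one common energy bound.\<close>
  define K where "K = sqrt (B\<^sup>2 + 1)"
  have K: "K \<ge> 0" "K\<^sup>2 = B\<^sup>2 + 1" by (auto simp: K_def)
  have "c < ennreal (K\<^sup>2)" using c K by (auto intro: le_less_trans simp: ennreal_less_iff)
  then obtain n0 where n0: "\<And>n. n \<ge> n0 \<Longrightarrow> f n \<le> ennreal (K\<^sup>2)"
    using order_tendstoD(2)[OF f_lim] unfolding eventually_sequentially by (meson less_imp_le)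
  define u where "u n = v (n + n0)" for n
  have u: "continuous_on UNIV (u n)" "\<And>t. t \<le> 0 \<Longrightarrow> u n t = 0" for n
    using v(1)[of "n + n0"] by (auto simp: u_def paths_def)
  have u_energy: "energy (u n) {0..} \<le> ennreal (K\<^sup>2)" for n
  proof -
    have "energy (u n) {0..} \<le> ?F (u n)" by (simp add: reduced_action_def)
    also have "\<dots> \<le> ennreal (K\<^sup>2)" using n0[of "n + n0"] v(2) by (simp add: u_def)
    finally show ?thesis .
  qed
  have H: "norm (u n t - u n s) \<le> K * sqrt \<bar>t - s\<bar>" for n s t
  proof -
    have pos: "u n t = u n (max 0 t)" for t using u(2) by (simp add: max_def)
    have "norm (u n (max 0 t) - u n (max 0 s)) \<le> K * sqrt \<bar>max 0 t - max 0 s\<bar>"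
      by (rule norm_diff_le_sqrt_energy[OF u_energy K(1)]) auto
    also have "\<dots> \<le> K * sqrt \<bar>t - s\<bar>" using K(1) by (intro mult_left_mono real_sqrt_le_mono) auto
    finally show ?thesis using pos[of t] pos[of s] by simp
  qed
  obtain r w where r: "strict_mono (r :: nat \<Rightarrow> nat)" "\<And>t. (\<lambda>n. u (r n) t) \<longlonglongrightarrow> w t" "continuous_on UNIV w"
    by (rule Hoelder_convergent_subsequence[OF K(1) H u(2)[OF order_refl]]) (rule that)
  have "w t = 0" if "t \<le> 0" for t using r(2)[of t] u(2)[OF that] by (simp add: LIMSEQ_const_iff)
  then have w: "w \<in> paths" using r(3) by (simp add: paths_def)
  have "(\<lambda>n. ?F (u (r n))) \<longlonglongrightarrow> c"
  proof -
    have "(\<lambda>n. f (n + n0)) \<longlonglongrightarrow> c" using f_lim by (rule LIMSEQ_ignore_initial_segment)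
    then have "((\<lambda>n. f (n + n0)) \<circ> r) \<longlonglongrightarrow> c" using r(1) by (rule LIMSEQ_subseq_LIMSEQ)
    then show ?thesis by (simp add: o_def u_def v(2))
  qed
  then have "?F w \<le> c"
    by (intro reduced_action_lower_semicontinuous[where u = "\<lambda>n. u (r n)"]) (auto intro: u r)
  moreover have "c \<le> ?F g" if "g \<in> paths" for g unfolding c_def using that by (rule INF_lower)
  ultimately show ?thesis using that[of w] w c by (meson order_trans)
qed

text \<open>A competitor on \<open>{a..b}\<close> is spliced into \<open>w\<close>, and the common
  finite contributions outside cancel. Within distance 1 of \<open>w\<close> the subtraction of
  \<open>k\<close> is not truncated, so adding the finite integral of \<open>k\<close> to both sides
  turns reduced actions into actions.\<close>

lemma minimizer_imp_local_minimizer: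
  assumes [measurable]: "k \<in> borel_measurable borel"
    and w: "w \<in> paths" "reduced_action k w {0..} < \<infinity>"
    and min: "\<And>g. g \<in> paths \<Longrightarrow> reduced_action k w {0..} \<le> reduced_action k g {0..}"
    and k: "\<And>t y. 0 \<le> t \<Longrightarrow> norm (y - w t) \<le> 1 \<Longrightarrow> ennreal (k t) \<le> potential t y"
    and k_fin: "\<And>a b. (\<integral>\<^sup>+t\<in>{a..b}. ennreal (k t) \<partial>lborel) < \<infinity>"
  shows "local_minimizer w"
proof -
  define R where "R v S = (\<integral>\<^sup>+t\<in>S. (potential t (v t) - ennreal (k t)) \<partial>lborel)" for v S
  have w_cont: "continuous_on UNIV w" and w0: "\<And>t. t \<le> 0 \<Longrightarrow> w t = 0" using w(1) by (auto simp: paths_def)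
  have R_split: "R v {0..} = R v {0..<a} + R v {a..b} + R v {b<..}"
    if v: "continuous_on UNIV v" and ab: "0 \<le> a" "a \<le> b" for v a b
  proof -
    have [measurable]: "(\<lambda>t. potential t (v t)) \<in> borel_measurable borel" using v by (rule measurable_potential)
    have m: "(\<lambda>t. (potential t (v t) - ennreal (k t)) * indicator A t) \<in> borel_measurable lborel" if "A \<in> sets borel" for A
      using that by measurable
    have "R v {0..} = (\<integral>\<^sup>+t. (potential t (v t) - ennreal (k t)) * indicator {0..<a} t
        + (potential t (v t) - ennreal (k t)) * indicator {a..b} t + (potential t (v t) - ennreal (k t)) * indicator {b<..} t \<partial>lborel)"
      unfolding R_def by (intro nn_integral_cong) (use ab in \<open>auto simp: indicator_def\<close>)
    also have "\<dots> = R v {0..<a} + R v {a..b} + R v {b<..}"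
      unfolding R_def
      by (subst nn_integral_add[OF borel_measurable_add[OF m m] m], simp_all)
         (subst nn_integral_add[OF m m], simp_all)
    finally show ?thesis .
  qed
  have E_split: "energy v {0..} = energy v {0..a} + energy v {a..b} + energy v {b..}"
    if "0 \<le> a" "a \<le> b" for v :: "real \<Rightarrow> complex" and a b
    using energy_Ici_split[of 0 b v] energy_Icc_split[of 0 a b v] that by simp
  have act: "action v {a..b} = energy v {a..b} + R v {a..b} + (\<integral>\<^sup>+t\<in>{a..b}. ennreal (k t) \<partial>lborel)"
    if v: "continuous_on UNIV v" and ab: "0 \<le> a" "\<And>t. t \<in> {a..b} \<Longrightarrow> norm (v t - w t) \<le> 1" for v a b
  proof -
    have [measurable]: "(\<lambda>t. potential t (v t)) \<in> borel_measurable borel" using v by (rule measurable_potential)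
    have "potential_integral v {a..b}
      = (\<integral>\<^sup>+t. (potential t (v t) - ennreal (k t)) * indicator {a..b} t + ennreal (k t) * indicator {a..b} t \<partial>lborel)"
    proof (rule nn_integral_cong)
      fix t
      show "potential t (v t) * indicator {a..b} t
        = (potential t (v t) - ennreal (k t)) * indicator {a..b} t + ennreal (k t) * indicator {a..b} t"
      proof (cases "t \<in> {a..b}")
        case True
        then have "ennreal (k t) \<le> potential t (v t)" using ab by (intro k) auto
        then show ?thesis using True by (simp add: diff_add_cancel_ennreal)
      qed simp
    qed
    also have "\<dots> = R v {a..b} + (\<integral>\<^sup>+t\<in>{a..b}. ennreal (k t) \<partial>lborel)"
      unfolding R_def by (rule nn_integral_add) measurable
    finally show ?thesis by (simp add: action_def add.assoc)
  qed
  have fin: "energy w {0..} + R w {0..} < \<infinity>" using w(2) by (simp add: reduced_action_def R_def)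
  have fin_ab: "energy w {a..b} + R w {a..b} < \<infinity>" if "0 \<le> a" for a b
  proof -
    have "energy w {a..b} \<le> energy w {0..}" using that by (intro energy_mono) auto
    moreover have "R w {a..b} \<le> R w {0..}"
      unfolding R_def using that by (intro nn_integral_mono mult_left_mono) (auto simp: indicator_def)
    ultimately show ?thesis using fin by (meson add_mono le_less_trans)
  qed
  show ?thesis
    unfolding local_minimizer_def
  proof (intro conjI allI impI)
    show "continuous_on UNIV w" by (rule w_cont)
    show "action w {a..b} < \<infinity>" if "0 \<le> a" for a b
      using act[OF w_cont that] fin_ab[OF that, of b] k_fin[of a b] by (simp add: less_top[symmetric])
    fix a b g
    assume a: "0 \<le> a" "a < b" and g: "continuous_on UNIV g" "g a = w a" "g b = w b" "\<forall>t\<in>{a..b}. norm (g t - w t) \<le> 1"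
    define h where "h t = (if t \<le> b then if t \<le> a then w t else g t else w t)" for t
    have h_cont: "continuous_on UNIV h"
      unfolding h_def using w_cont g a by (intro continuous_on_if_le) auto
    have "h \<in> paths" using h_cont w0 a by (simp add: paths_def h_def)
    then have "energy w {0..} + R w {0..} \<le> energy h {0..} + R h {0..}"
      using min by (simp add: reduced_action_def R_def)
    moreover have "energy h {0..a} = energy w {0..a}" "energy h {b..} = energy w {b..}" "energy h {a..b} = energy g {a..b}"
      using g by (auto simp: h_def intro!: energy_cong)
    moreover have "R h {0..<a} = R w {0..<a}" "R h {b<..} = R w {b<..}" "R h {a..b} = R g {a..b}"
      unfolding R_def using a g by (auto simp: h_def indicator_def intro!: nn_integral_cong)
    moreover note E_split[of a b w] E_split[of a b h] R_split[OF w_cont a(1), of b] R_split[OF h_cont a(1), of b]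
    ultimately have le: "(energy w {0..a} + energy w {b..} + R w {0..<a} + R w {b<..}) + (energy w {a..b} + R w {a..b})
        \<le> (energy w {0..a} + energy w {b..} + R w {0..<a} + R w {b<..}) + (energy g {a..b} + R g {a..b})"
      using a by (simp add: ac_simps)
    have "energy w {0..a} + energy w {b..} + R w {0..<a} + R w {b<..} \<noteq> \<infinity>"
      using fin E_split[of a b w] R_split[OF w_cont a(1), of b] a by (auto simp: less_top[symmetric])
    with le have "energy w {a..b} + R w {a..b} \<le> energy g {a..b} + R g {a..b}"
      by (simp add: ennreal_add_left_cancel_le)
    then show "action w {a..b} \<le> action g {a..b}"
      using act[OF w_cont a(1), of b] act[OF g(1) a(1), of b] g(4) by (auto intro: add_right_mono)
  qed
qed

end

section \<open>Estimates for the reference path\<close>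

lemma energy_const: "energy (\<lambda>_. c) S = 0"
proof -
  have "energy_sum (\<lambda>_. c) ts = 0" for ts by (induction ts rule: induct_list012) auto
  then have "energy (\<lambda>_. c) S \<le> 0" by (intro energy_leI) simp
  then show ?thesis by simp
qed

lemma nn_integral_powr_tail:
  assumes "c > 0"
  shows "(\<integral>\<^sup>+t\<in>{0..}. ennreal ((c * t + 1) powr (- 3 / 2)) \<partial>lborel) = ennreal (2 / c)"
proof -
  have "(\<integral>\<^sup>+t\<in>{0..}. ennreal ((c * t + 1) powr (- 3 / 2)) \<partial>lborel)
      = 0 - (- (2 / c) * (c * 0 + 1) powr (- 1 / 2))"
  proof (rule nn_integral_FTC_atLeast)
    fix t :: real assume "0 \<le> t"
    then have "c * t + 1 > 0" using assms by (simp add: add_nonneg_pos)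
    then show "((\<lambda>t. - (2 / c) * (c * t + 1) powr (- 1 / 2)) has_real_derivative (c * t + 1) powr (- 3 / 2)) (at t)"
    proof -
      have "((\<lambda>t. (c * t + 1) powr (- 1 / 2)) has_real_derivative (- 1 / 2) * (c * t + 1) powr (- 1 / 2 - 1) * c) (at t)"
        by (rule DERIV_chain2[OF has_real_derivative_powr]) (use \<open>c * t + 1 > 0\<close> in \<open>auto intro!: derivative_eq_intros\<close>)
      from DERIV_cmult[OF this, of "- (2 / c)"] show ?thesis using assms by simp
    qed
  next
    have "filterlim (\<lambda>t. 1 + c * t) at_top at_top"
      by (intro filterlim_tendsto_add_at_top[OF tendsto_const] filterlim_tendsto_pos_mult_at_top[OF tendsto_const assms filterlim_ident])
    then have "filterlim (\<lambda>t. c * t + 1) at_top at_top" by (simp add: add.commute)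
    then have "((\<lambda>t. (c * t + 1) powr (- 1 / 2)) \<longlongrightarrow> 0) at_top"
      by (intro tendsto_neg_powr) auto
    then show "((\<lambda>t. - (2 / c) * (c * t + 1) powr (- 1 / 2)) \<longlongrightarrow> 0) at_top"
      by (rule tendsto_mult_right_zero)
  qed auto
  then show ?thesis by simp
qed

text \<open>Cauchy-Schwarz for \<open>t powr (2/3)\<close>: the square of its derivative has the
  primitive \<open>4 / 3 * t powr (1/3)\<close>. In terms of cube roots \<open>a\<close> and
  \<open>b\<close>, the defect is a multiple of \<open>(b - a) ^ 4\<close>.\<close>

lemma powr_two_thirds_diff_le:
  fixes s t :: real
  assumes "0 \<le> s" "s \<le> t"
  shows "(t powr (2 / 3) - s powr (2 / 3))\<^sup>2 \<le> 4 / 3 * (t - s) * (t powr (1 / 3) - s powr (1 / 3))"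
proof -
  have cube: "r powr (2 / 3) = (r powr (1 / 3))\<^sup>2 \<and> r = (r powr (1 / 3)) ^ 3" if "0 \<le> r" for r :: real
    using that by (cases "r = 0") (auto simp: powr_power)
  define a b where "a = s powr (1 / 3)" and "b = t powr (1 / 3)"
  have eq: "s = a ^ 3" "t = b ^ 3" "s powr (2 / 3) = a\<^sup>2" "t powr (2 / 3) = b\<^sup>2"
    using cube[of s] cube[of t] assms by (auto simp: a_def b_def)
  have "3 * (b\<^sup>2 - a\<^sup>2)\<^sup>2 + (b - a) ^ 4 = 4 * (b ^ 3 - a ^ 3) * (b - a)"
    by (simp add: power2_eq_square power3_eq_cube power4_eq_xxxx algebra_simps)
  moreover have "(b - a) ^ 4 \<ge> 0" by simp
  ultimately have "(b\<^sup>2 - a\<^sup>2)\<^sup>2 \<le> 4 / 3 * (b ^ 3 - a ^ 3) * (b - a)" by linarith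
  moreover have "t - s = b ^ 3 - a ^ 3" using eq by simp
  ultimately show ?thesis by (simp only: a_def[symmetric] b_def[symmetric] eq(3,4))
qed

text \<open>Each nonzero \<open>y\<close> excludes at most one slope \<open>\<beta>\<close>. The
  conclusion says that \<open>y\<close> is not on the real line through
  \<open>u = v * Complex 1 \<beta>\<close>, while the real part 1 lets \<open>u\<close> advance
  along \<open>v\<close> as fast as \<open>v\<close> itself.\<close>

lemma generic_direction:
  fixes v :: complex
  assumes "v \<noteq> 0" "finite Y"
  obtains \<beta> :: real where "\<And>y. y \<in> Y \<Longrightarrow> y \<noteq> 0 \<Longrightarrow> Im (cnj (v * Complex 1 \<beta>) * y) \<noteq> 0"
proof -
  have "finite ((\<lambda>y. Im (cnj v * y) / Re (cnj v * y)) ` Y)" using assms(2) by simp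
  then obtain \<beta> where \<beta>: "\<beta> \<notin> (\<lambda>y. Im (cnj v * y) / Re (cnj v * y)) ` Y"
    using ex_new_if_finite[OF infinite_UNIV_char_0] by blast
  have "Im (cnj (v * Complex 1 \<beta>) * y) \<noteq> 0" if y: "y \<in> Y" "y \<noteq> 0" for y
  proof
    assume "Im (cnj (v * Complex 1 \<beta>) * y) = 0"
    then have *: "Im (cnj v * y) = \<beta> * Re (cnj v * y)" by (simp add: algebra_simps)
    show False
    proof (cases "Re (cnj v * y) = 0")
      case True
      then have "cnj v * y = 0" using * by (simp add: complex_eq_iff)
      then show False using assms(1) y(2) by simp
    next
      case False
      then have "\<beta> = Im (cnj v * y) / Re (cnj v * y)" using * by simp
      then show False using \<beta> y(1) by blast
    qed
  qed
  then show ?thesis using that by blast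
qed

context moving_centers
begin

text \<open>Twice the total mass, to match the doubled potential.\<close>

definition mass :: real where "mass = (\<Sum>i\<in>I. 2 * m i)"

lemma mass_nonneg: "0 \<le> mass"
  unfolding mass_def by (intro sum_nonneg) (auto simp: m_nonneg)

lemma potential_le_mass:
  assumes "0 < r" "\<And>i. i \<in> I \<Longrightarrow> r \<le> norm (y - p i t)"
  shows "potential t y \<le> ennreal (mass / r)"
proof -
  have "potential t y \<le> (\<Sum>i\<in>I. ennreal (2 * m i / r))"
    unfolding potential_def using assms by (intro sum_mono ennreal_divide_norm_le) (auto simp: m_nonneg)
  also have "\<dots> = ennreal (mass / r)"
    unfolding mass_def sum_divide_distrib using assms(1) by (intro sum_ennreal) (auto simp: m_nonneg)
  finally show ?thesis .
qed

lemma potential_ge_mass: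
  assumes "0 < r" "\<And>i. i \<in> I \<Longrightarrow> norm (y - p i t) \<le> r"
  shows "ennreal (mass / r) \<le> potential t y"
proof -
  have "ennreal (mass / r) = (\<Sum>i\<in>I. ennreal (2 * m i / r))"
    unfolding mass_def sum_divide_distrib using assms(1) by (intro sum_ennreal[symmetric]) (auto simp: m_nonneg)
  also have "\<dots> \<le> potential t y"
    unfolding potential_def using assms m_pos by (intro sum_mono ennreal_divide_norm_ge) auto
  finally show ?thesis .
qed

end

text \<open>Relative to the uniform motion \<open>x + t v\<close> the wanted solution starts at \<open>0\<close> and grows sublinearly.\<close>

locale translated_centers = moving_centers +
  fixes R :: real and x v :: complex
  assumes p_bounded: "i \<in> I \<Longrightarrow> norm (p i t) \<le> R" and R_nonneg: "R \<ge> 0" and v_nonzero: "v \<noteq> 0"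
begin

sublocale rel: moving_centers I m "\<lambda>i t. p i t - (x + t *\<^sub>R v)" "\<lambda>i t. p' i t - v" "L + norm v" C d
proof
  show "((\<lambda>t. p i t - (x + t *\<^sub>R v)) has_vector_derivative p' i t - v) (at t)" if "i \<in> I" for i t
    using p_deriv[OF that] by (auto intro!: derivative_eq_intros)
  show "norm (p' i t - v) \<le> L + norm v" if "i \<in> I" for i t
    using p'_le[OF that, of t] norm_triangle_ineq4[of "p' i t" v] by linarith
  show "0 \<le> L + norm v" using L_nonneg by simp
qed (use finite_I m_pos p'_Lipschitz p_separated d_pos C_nonneg in auto)

text \<open>Only times \<open>t \<ge> 0\<close> matter; \<open>max 0\<close> makes the function continuous on the whole line.\<close>

definition floor_potential :: "real \<Rightarrow> real \<Rightarrow> real" where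
  "floor_potential B t = mass / (R + norm x + 1 + norm v * max 0 t + B * sqrt (max 0 t))"

lemma floor_potential_denom: "B \<ge> 0 \<Longrightarrow> R + norm x + 1 + norm v * max 0 t + B * sqrt (max 0 t) \<ge> 1"
  using R_nonneg by (smt (verit) norm_ge_zero mult_nonneg_nonneg real_sqrt_ge_zero)

lemma continuous_floor_potential: "B \<ge> 0 \<Longrightarrow> continuous_on UNIV (floor_potential B)"
  unfolding floor_potential_def
  by (intro continuous_intros ballI) (metis floor_potential_denom not_one_le_zero)

lemma floor_potential_bounds: "B \<ge> 0 \<Longrightarrow> 0 \<le> floor_potential B t \<and> floor_potential B t \<le> mass"
  unfolding floor_potential_def using floor_potential_denom[of B t] mass_nonneg
  by (auto simp: divide_le_eq mult_le_cancel_left1 intro!: divide_nonneg_pos)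

lemma floor_potential_le:
  assumes "B \<ge> 0" "0 \<le> t" "norm y \<le> B * sqrt t + 1"
  shows "ennreal (floor_potential B t) \<le> rel.potential t y"
proof -
  have "norm (y - (p i t - (x + t *\<^sub>R v))) \<le> R + norm x + 1 + norm v * t + B * sqrt t" if "i \<in> I" for i
  proof -
    have "norm (y - (p i t - (x + t *\<^sub>R v))) \<le> norm y + norm (p i t) + norm x + norm (t *\<^sub>R v)"
      by (smt (verit) norm_triangle_ineq norm_triangle_ineq4)
    then show ?thesis using p_bounded[OF that, of t] assms by (simp add: mult.commute)
  qed
  moreover have "R + norm x + 1 + norm v * t + B * sqrt t > 0"
    using floor_potential_denom[OF assms(1), of t] assms(2) by simp
  ultimately show ?thesis
    using rel.potential_ge_mass[of "R + norm x + 1 + norm v * t + B * sqrt t" y t] assms(2)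
    by (simp add: floor_potential_def max_def)
qed

text \<open>The exponent \<open>2/3\<close> makes both the energy and the potential integrable at a starting collision.
  Times past \<open>\<epsilon>\<close> correspond to uniform motion with velocity \<open>v\<close>.\<close>

lemma reference_path:
  obtains w c0 c1 where "w \<in> rel.paths" "c0 \<ge> 0" "c1 \<ge> 0"
    "\<And>B. B \<ge> 0 \<Longrightarrow> rel.reduced_action (floor_potential B) w {0..} \<le> ennreal (c0 + c1 * B)"
proof -
  \<comment> \<open>From time \<open>\<epsilon>\<close> on the reference motion is uniform and
    starts at \<open>x + D *\<^sub>R u\<close>. This \<open>D\<close> gives a head start that
    outweighs \<open>x\<close> and the extent of the bodies and leaves distance at least
    \<open>norm v * t + 1\<close> to every centre.\<close>
  define D where "D = 1 + (norm x + R + 1) / norm v"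
  have nv: "norm v > 0" using v_nonzero by simp
  have D: "D > 1" "norm v * (D - 1) = norm x + R + 1"
    using nv R_nonneg by (auto simp: D_def intro!: divide_pos_pos add_nonneg_pos)
  define Y where "Y = (\<lambda>i. p i 0 - x) ` I"
  obtain \<beta> where \<beta>: "\<And>y. y \<in> Y \<Longrightarrow> y \<noteq> 0 \<Longrightarrow> Im (cnj (v * Complex 1 \<beta>) * y) \<noteq> 0"
    using generic_direction[OF v_nonzero, of Y] finite_I by (auto simp: Y_def)
  define u where "u = v * Complex 1 \<beta>"
  have "Complex 1 \<beta> \<noteq> 0" by (simp add: complex_eq_iff)
  then have nu: "norm u > 0" using v_nonzero by (simp add: u_def)
  \<comment> \<open>The clearance must grow linearly only because of a starting collision,
    \<open>y = 0\<close>. Any other \<open>y\<close> has distance \<open>\<delta> > 0\<close> from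
    the whole line through \<open>u\<close>.\<close>
  have "\<exists>\<eta>>0. \<forall>s. 0 \<le> s \<and> s \<le> D \<longrightarrow> \<eta> * s \<le> norm (s *\<^sub>R u - y)" if y: "y \<in> Y" for y
  proof (cases "y = 0")
    case True
    then show ?thesis using nu by (intro exI[of _ "norm u"]) simp
  next
    case False
    define \<delta> where "\<delta> = \<bar>Im (cnj u * y)\<bar> / norm u"
    have \<delta>: "\<delta> > 0" using \<beta>[OF y False] nu by (simp add: \<delta>_def u_def)
    have "\<delta> / D * s \<le> norm (s *\<^sub>R u - y)" if s: "0 \<le> s" "s \<le> D" for s
    proof -
      have "Im (cnj u * (s *\<^sub>R u - y)) = - Im (cnj u * y)"
        by (simp add: algebra_simps)
      then have "\<bar>Im (cnj u * y)\<bar> \<le> norm (cnj u * (s *\<^sub>R u - y))"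
        using abs_Im_le_cmod[of "cnj u * (s *\<^sub>R u - y)"] by linarith
      also have "\<dots> = norm (s *\<^sub>R u - y) * norm u" by (simp only: norm_mult complex_mod_cnj mult.commute)
      finally have "\<delta> \<le> norm (s *\<^sub>R u - y)" using nu unfolding \<delta>_def by (simp only: divide_le_eq if_True)
      moreover have "\<delta> / D * s \<le> \<delta> / D * D" using s \<delta> D by (intro mult_left_mono) auto
      ultimately show ?thesis using D by simp
    qed
    then show ?thesis using \<delta> D by (intro exI[of _ "\<delta> / D"]) auto
  qed
  then obtain e where e: "\<And>y. y \<in> Y \<Longrightarrow> e y > 0"
    "\<And>y s. y \<in> Y \<Longrightarrow> 0 \<le> s \<Longrightarrow> s \<le> D \<Longrightarrow> e y * s \<le> norm (s *\<^sub>R u - y)" by metis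
  define \<eta> where "\<eta> = Min (insert 1 (e ` Y))"
  have fY: "finite Y" using finite_I by (simp add: Y_def)
  have \<eta>: "\<eta> > 0" unfolding \<eta>_def using fY e(1) by (subst Min_gr_iff) auto
  have ray: "\<eta> * s \<le> norm (x + s *\<^sub>R u - p i 0)" if "i \<in> I" "0 \<le> s" "s \<le> D" for i s
  proof -
    have "p i 0 - x \<in> Y" using that by (simp add: Y_def)
    then have "\<eta> \<le> e (p i 0 - x)" unfolding \<eta>_def using fY by (intro Min_le) auto
    then have "\<eta> * s \<le> e (p i 0 - x) * s" using that by (intro mult_right_mono)
    also have "\<dots> \<le> norm (s *\<^sub>R u - (p i 0 - x))" using e(2) \<open>p i 0 - x \<in> Y\<close> that by blast
    finally show ?thesis by (simp add: algebra_simps)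
  qed
  \<comment> \<open>So short that the centres use up at most half of the clearance
    \<open>\<eta> * s\<close> by time \<open>t\<close>: their displacement is linear in
    \<open>t / \<epsilon>\<close>, which is below its power \<open>2/3\<close>.\<close>
  define \<epsilon> where "\<epsilon> = min 1 (\<eta> * D / (2 * (L + 1)))"
  have \<epsilon>: "\<epsilon> > 0" "\<epsilon> \<le> 1" using \<eta> D L_nonneg by (auto simp: \<epsilon>_def)
  have L\<epsilon>: "L * \<epsilon> \<le> \<eta> * D / 2"
  proof -
    have "L * \<epsilon> \<le> (L + 1) * \<epsilon>" using \<epsilon> by simp
    also have "\<dots> \<le> (L + 1) * (\<eta> * D / (2 * (L + 1)))" using L_nonneg by (intro mult_left_mono) (auto simp: \<epsilon>_def)
    also have "\<dots> = \<eta> * D / 2"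
    proof -
      have "l * (y / (2 * l)) = y / 2" if "0 < l" for l y :: real using that by simp
      moreover have "0 < L + 1" using L_nonneg by simp
      ultimately show ?thesis by blast
    qed
    finally show ?thesis .
  qed
  \<comment> \<open>In the original frame this runs from \<open>x\<close> straight to
    \<open>x + D *\<^sub>R u\<close>; subtracting \<open>\<tau> *\<^sub>R v\<close> passes to the
    moving frame, where \<open>w\<close> rests after time \<open>\<epsilon>\<close>.\<close>
  define f where "f \<tau> = (D * (\<tau> / \<epsilon>) powr (2 / 3)) *\<^sub>R u - \<tau> *\<^sub>R v" for \<tau>
  define w where "w t = f (min (max 0 t) \<epsilon>)" for t
  have f_cont: "continuous_on {0..} f"
    unfolding f_def using \<epsilon> by (intro continuous_intros continuous_on_powr') auto
  have "continuous_on UNIV w" unfolding w_def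
    by (rule continuous_on_compose2[OF f_cont]) (use \<epsilon> in \<open>auto intro!: continuous_intros\<close>)
  moreover have "w t = 0" if "t \<le> 0" for t using that \<epsilon> by (simp add: w_def f_def max_def min_def)
  ultimately have w: "w \<in> rel.paths" by (simp add: rel.paths_def)
  \<comment> \<open>The cumulative energy: \<open>4 / 3\<close> comes from
    \<open>powr_two_thirds_diff_le\<close>, the extra factors 2 from splitting the square of the sum
    of the \<open>u\<close> and \<open>v\<close> parts.\<close>
  define \<Phi> where "\<Phi> \<tau> = 8 / 3 * (D * norm u)\<^sup>2 / \<epsilon> * (\<tau> / \<epsilon>) powr (1 / 3) + 2 * (norm v)\<^sup>2 * \<tau>" for \<tau>
  define E0 where "E0 = \<Phi> \<epsilon> - \<Phi> 0"
  have energy_w: "energy w {0..} \<le> ennreal E0"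
  proof -
    have "energy w {0..\<epsilon>} \<le> ennreal E0"
      unfolding E0_def
    proof (rule energy_le_increment)
      fix s t assume st: "0 \<le> s" "s \<le> t" "t \<le> \<epsilon>"
      let ?d = "(t / \<epsilon>) powr (2 / 3) - (s / \<epsilon>) powr (2 / 3)"
      have w_eq: "w t - w s = (D * ?d) *\<^sub>R u - (t - s) *\<^sub>R v"
        using st by (simp add: w_def f_def algebra_simps)
      have "norm (w t - w s) \<le> D * \<bar>?d\<bar> * norm u + (t - s) * norm v"
        unfolding w_eq using norm_triangle_ineq4[of "(D * ?d) *\<^sub>R u" "(t - s) *\<^sub>R v"] D st by (simp add: abs_mult)
      then have "(norm (w t - w s))\<^sup>2 \<le> (D * \<bar>?d\<bar> * norm u + (t - s) * norm v)\<^sup>2"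
        by (intro power_mono) auto
      also have "\<dots> \<le> 2 * (D * \<bar>?d\<bar> * norm u)\<^sup>2 + 2 * ((t - s) * norm v)\<^sup>2"
        using sum_squares_bound[of "D * \<bar>?d\<bar> * norm u" "(t - s) * norm v"] by (simp add: power2_sum)
      also have "(D * \<bar>?d\<bar> * norm u)\<^sup>2 = (D * norm u)\<^sup>2 * ?d\<^sup>2" by (simp add: power_mult_distrib)
      also have "?d\<^sup>2 \<le> 4 / 3 * (t / \<epsilon> - s / \<epsilon>) * ((t / \<epsilon>) powr (1 / 3) - (s / \<epsilon>) powr (1 / 3))"
        using st \<epsilon> by (intro powr_two_thirds_diff_le) (auto simp: divide_right_mono)
      also have "2 * ((D * norm u)\<^sup>2 * (4 / 3 * (t / \<epsilon> - s / \<epsilon>) * ((t / \<epsilon>) powr (1 / 3) - (s / \<epsilon>) powr (1 / 3))))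
          + 2 * ((t - s) * norm v)\<^sup>2 = (t - s) * (\<Phi> t - \<Phi> s)"
      proof -
        have "2 * (U * (4 / 3 * (t / \<epsilon> - s / \<epsilon>) * (X - Y))) + 2 * ((t - s) * V)\<^sup>2
          = (t - s) * ((8 / 3 * U / \<epsilon> * X + 2 * V\<^sup>2 * t) - (8 / 3 * U / \<epsilon> * Y + 2 * V\<^sup>2 * s))" for U V X Y
          using \<epsilon> by (simp add: field_simps power2_eq_square)
        then show ?thesis unfolding \<Phi>_def by blast
      qed
      finally show "(norm (w t - w s))\<^sup>2 \<le> (t - s) * (\<Phi> t - \<Phi> s)"
        by (simp add: mult_left_mono)
    qed (use \<epsilon> in auto)
    moreover have "energy w {\<epsilon>..} = energy (\<lambda>_. f \<epsilon>) {\<epsilon>..}"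
      using \<epsilon> by (intro energy_cong) (auto simp: w_def)
    ultimately show ?thesis using energy_Ici_split[of 0 \<epsilon> w] \<epsilon> by (simp add: energy_const)
  qed
  define c where "c = norm v"
  have pot_start: "rel.potential t (w t) \<le> ennreal (2 * mass / (\<eta> * D) * \<epsilon> powr (2 / 3) * t powr (- 2 / 3))"
    if t: "0 < t" "t \<le> \<epsilon>" for t
  proof -
    define s where "s = D * (t / \<epsilon>) powr (2 / 3)"
    have te: "0 < t / \<epsilon>" "t / \<epsilon> \<le> 1" using t \<epsilon> by auto
    have "(t / \<epsilon>) powr (2 / 3) \<le> 1" using te by (intro powr_le1) auto
    moreover have "0 < (t / \<epsilon>) powr (2 / 3)" using t \<epsilon> by simp
    ultimately have s: "0 < s" "s \<le> D" using D by (auto simp: s_def mult_left_le)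
    have pw: "t / \<epsilon> \<le> (t / \<epsilon>) powr (2 / 3)" using powr_mono'[of "2 / 3" 1 "t / \<epsilon>"] te t \<epsilon> by simp
    have "L * t \<le> \<eta> * s / 2"
    proof -
      have "L * t = L * \<epsilon> * (t / \<epsilon>)" using \<epsilon> by simp
      also have "\<dots> \<le> \<eta> * D / 2 * (t / \<epsilon>) powr (2 / 3)"
        using L\<epsilon> te pw \<eta> D by (intro mult_mono) auto
      finally show ?thesis by (simp add: s_def)
    qed
    have "\<eta> * s / 2 \<le> norm (w t - (p i t - (x + t *\<^sub>R v)))" if i: "i \<in> I" for i
    proof -
      have "\<eta> * s \<le> norm (x + s *\<^sub>R u - p i 0)" using ray[OF i] s by simp
      also have "x + s *\<^sub>R u - p i 0 = (w t - (p i t - (x + t *\<^sub>R v))) + (p i t - p i 0)"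
        using t by (simp add: w_def f_def s_def algebra_simps)
      also have "norm \<dots> \<le> norm (w t - (p i t - (x + t *\<^sub>R v))) + norm (p i t - p i 0)" by (rule norm_triangle_ineq)
      finally show ?thesis using p_Lipschitz[OF i, of t 0] \<open>L * t \<le> \<eta> * s / 2\<close> t by simp
    qed
    then have "rel.potential t (w t) \<le> ennreal (mass / (\<eta> * s / 2))"
      using \<eta> s by (intro rel.potential_le_mass) auto
    also have "mass / (\<eta> * s / 2) = 2 * mass / (\<eta> * D) * \<epsilon> powr (2 / 3) * t powr (- 2 / 3)"
    proof -
      have "t powr (- 2 / 3) = 1 / t powr (2 / 3)" using powr_minus_divide[of t "2 / 3"] by simp
      moreover have "(t / \<epsilon>) powr (2 / 3) = t powr (2 / 3) / \<epsilon> powr (2 / 3)" using t \<epsilon> by (simp add: powr_divide)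
      ultimately show ?thesis using t \<epsilon> \<eta> D by (simp add: s_def ac_simps)
    qed
    finally show ?thesis .
  qed
  define C0 where "C0 = 2 * mass / (\<eta> * D) * \<epsilon> powr (2 / 3) * (3 * \<epsilon> powr (1 / 3))"
  have C0: "C0 \<ge> 0" using mass_nonneg \<eta> D by (simp add: C0_def)
  have start: "(\<integral>\<^sup>+t\<in>{0..\<epsilon>}. (rel.potential t (w t) - ennreal (floor_potential B t)) \<partial>lborel) \<le> ennreal C0" for B
  proof -
    let ?g = "\<lambda>t. 2 * mass / (\<eta> * D) * \<epsilon> powr (2 / 3) * t powr (- 2 / 3)"
    have "(\<integral>\<^sup>+t\<in>{0..\<epsilon>}. (rel.potential t (w t) - ennreal (floor_potential B t)) \<partial>lborel)
       \<le> (\<integral>\<^sup>+t. ennreal (indicator {0..\<epsilon>} t * ?g t) \<partial>lborel)"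
    proof (rule nn_integral_mono_AE)
      have "AE t in lborel. t \<noteq> (0::real)" by (rule AE_lborel_singleton)
      then show "AE t in lborel. (rel.potential t (w t) - ennreal (floor_potential B t)) * indicator {0..\<epsilon>} t
          \<le> ennreal (indicator {0..\<epsilon>} t * ?g t)"
      proof eventually_elim
        case (elim t)
        show ?case
        proof (cases "t \<in> {0..\<epsilon>}")
          case True
          have "rel.potential t (w t) - ennreal (floor_potential B t) \<le> rel.potential t (w t)"
            by (rule diff_le_self_ennreal)
          also have "\<dots> \<le> ennreal (?g t)" using True elim by (intro pot_start) auto
          finally show ?thesis using True by simp
        qed simp
      qed
    qed
    also have "\<dots> = ennreal C0"
    proof (rule nn_integral_has_integral_lebesgue)
      show "0 \<le> ?g t" for t using mass_nonneg \<eta> D by simp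
      have "((\<lambda>t. t powr (- 2 / 3)) has_integral (\<epsilon> powr (- 2 / 3 + 1) / (- 2 / 3 + 1))) {0..\<epsilon>}"
        using \<epsilon> by (intro has_integral_powr_from_0) auto
      then have "((\<lambda>t. t powr (- 2 / 3)) has_integral (3 * \<epsilon> powr (1 / 3))) {0..\<epsilon>}" by (simp add: mult.commute)
      then show "(?g has_integral C0) {0..\<epsilon>}" unfolding C0_def by (rule has_integral_mult_right)
    qed
    finally show ?thesis .
  qed
  define a where "a = R + norm x + 1"
  have a: "a \<ge> 1" using R_nonneg by (simp add: a_def)
  define A1 where "A1 B = mass * (a + B / sqrt c)" for B
  have c: "c > 0" using nv by (simp add: c_def)
  have A1: "A1 B \<ge> 0" if "B \<ge> 0" for B using mass_nonneg a c that by (simp add: A1_def)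
  \<comment> \<open>The leading terms cancel: the potential is at most \<open>mass / b\<close> with
    \<open>b = c * t + 1\<close>, and the denominator of the floor exceeds \<open>b\<close> only by
    \<open>a - 1 + B * sqrt t\<close>. The difference is thus of order \<open>b powr (-3/2)\<close>,
    with a factor affine in \<open>B\<close>.\<close>
  have pot_tail: "rel.potential t (w t) - ennreal (floor_potential B t) \<le> ennreal (A1 B * (c * t + 1) powr (- 3 / 2))"
    if B: "B \<ge> 0" and t: "\<epsilon> \<le> t" for B t
  proof -
    have t0: "t > 0" using t \<epsilon> by linarith
    have far: "c * t + 1 \<le> norm (w t - (p i t - (x + t *\<^sub>R v)))" if i: "i \<in> I" for i
    proof -
      have w_eq: "w t = D *\<^sub>R u - \<epsilon> *\<^sub>R v" using t \<epsilon> by (simp add: w_def f_def)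
      have "D *\<^sub>R u + (t - \<epsilon>) *\<^sub>R v = v * Complex (D + t - \<epsilon>) (D * \<beta>)"
        by (simp add: u_def complex_eq_iff algebra_simps)
      then have "norm (D *\<^sub>R u + (t - \<epsilon>) *\<^sub>R v) = c * norm (Complex (D + t - \<epsilon>) (D * \<beta>))"
        by (simp add: norm_mult c_def)
      moreover have "D + t - \<epsilon> \<le> norm (Complex (D + t - \<epsilon>) (D * \<beta>))"
        using complex_Re_le_cmod[of "Complex (D + t - \<epsilon>) (D * \<beta>)"] by simp
      ultimately have n1: "c * (D + t - \<epsilon>) \<le> norm (D *\<^sub>R u + (t - \<epsilon>) *\<^sub>R v)"
        using c by (simp add: mult_left_mono)
      have "D *\<^sub>R u + (t - \<epsilon>) *\<^sub>R v = (w t - (p i t - (x + t *\<^sub>R v))) - x + p i t"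
        by (simp add: w_eq algebra_simps)
      then have "norm (D *\<^sub>R u + (t - \<epsilon>) *\<^sub>R v) \<le> norm (w t - (p i t - (x + t *\<^sub>R v))) + norm x + norm (p i t)"
        using norm_triangle_ineq[of "w t - (p i t - (x + t *\<^sub>R v)) - x" "p i t"]
          norm_triangle_ineq4[of "w t - (p i t - (x + t *\<^sub>R v))" x] by simp
      moreover have "c * (D + t - \<epsilon>) = c * t + c * (D - 1) + c * (1 - \<epsilon>)" by (simp add: algebra_simps)
      moreover have "0 \<le> c * (1 - \<epsilon>)" using c \<epsilon> by simp
      ultimately show ?thesis using n1 D(2) p_bounded[OF i, of t] by (simp add: c_def)
    qed
    define b where "b = c * t + 1"
    have b: "b \<ge> 1" using c t0 by (simp add: b_def)
    have "rel.potential t (w t) \<le> ennreal (mass / b)"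
      using far b unfolding b_def by (intro rel.potential_le_mass) auto
    then have "rel.potential t (w t) - ennreal (floor_potential B t) \<le> ennreal (mass / b) - ennreal (floor_potential B t)"
      by (intro ennreal_minus_mono) auto
    also have "\<dots> = ennreal (mass / b - floor_potential B t)"
      using floor_potential_bounds[OF B, of t] by (intro ennreal_minus) auto
    also have "\<dots> \<le> ennreal (A1 B * b powr (- 3 / 2))"
    proof (rule ennreal_leI)
      have st: "B * sqrt t \<le> B / sqrt c * sqrt b"
      proof -
        have "sqrt t = sqrt (c * t) / sqrt c" using c by (simp add: real_sqrt_mult)
        also have "\<dots> \<le> sqrt b / sqrt c" using c by (intro divide_right_mono real_sqrt_le_mono) (auto simp: b_def)
        finally have "B * sqrt t \<le> B * (sqrt b / sqrt c)" using B by (rule mult_left_mono)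
        then show ?thesis by simp
      qed
      have den: "floor_potential B t = mass / (a + c * t + B * sqrt t)"
        using t0 by (simp add: floor_potential_def a_def c_def)
      define k where "k = a + c * t + B * sqrt t"
      have "0 \<le> B * sqrt t" using B t0 by simp
      then have kb: "b \<le> k" using a unfolding k_def b_def by linarith
      have "mass / b - mass / k = mass * ((k - b) / (b * k))" using b kb by (simp add: field_simps)
      also have "\<dots> \<le> mass * ((k - b) / (b * b))"
        using b kb mass_nonneg by (intro mult_left_mono divide_left_mono mult_mono mult_pos_pos) auto
      also have "\<dots> \<le> mass * ((a * sqrt b + B / sqrt c * sqrt b) / (b * b))"
      proof (intro mult_left_mono divide_right_mono mass_nonneg)
        have "k - b = a - 1 + B * sqrt t" by (simp add: k_def b_def)
        moreover have "a * 1 \<le> a * sqrt b" using a b by (intro mult_left_mono) auto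
        ultimately show "k - b \<le> a * sqrt b + B / sqrt c * sqrt b" using st by simp
      qed (use b in auto)
      also have "\<dots> = A1 B * (sqrt b / (b * b))" by (simp add: A1_def algebra_simps add_divide_distrib)
      also have "sqrt b / (b * b) = b powr (- 3 / 2)"
      proof -
        have "b powr (- 3 / 2) = b powr (1 / 2) / b powr 2"
          by (subst powr_diff[symmetric]) simp
        then show ?thesis using b by (simp add: powr_half_sqrt power2_eq_square)
      qed
      finally show "mass / b - floor_potential B t \<le> A1 B * b powr (- 3 / 2)"
        by (simp add: den k_def)
    qed
    finally show ?thesis by (simp add: b_def)
  qed
  have tail: "(\<integral>\<^sup>+t\<in>{\<epsilon>..}. (rel.potential t (w t) - ennreal (floor_potential B t)) \<partial>lborel)
      \<le> ennreal (A1 B * (2 / c))" if B: "B \<ge> 0" for B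
  proof -
    have "(\<integral>\<^sup>+t\<in>{\<epsilon>..}. (rel.potential t (w t) - ennreal (floor_potential B t)) \<partial>lborel)
      \<le> (\<integral>\<^sup>+t. ennreal (A1 B) * (ennreal ((c * t + 1) powr (- 3 / 2)) * indicator {0..} t) \<partial>lborel)"
    proof (rule nn_integral_mono)
      fix t
      show "(rel.potential t (w t) - ennreal (floor_potential B t)) * indicator {\<epsilon>..} t
        \<le> ennreal (A1 B) * (ennreal ((c * t + 1) powr (- 3 / 2)) * indicator {0..} t)"
        using pot_tail[OF B, of t] \<epsilon> A1[OF B] by (cases "\<epsilon> \<le> t") (auto simp: ennreal_mult')
    qed
    also have "\<dots> = ennreal (A1 B) * ennreal (2 / c)"
      using nn_integral_powr_tail[OF c] by (subst nn_integral_cmult) auto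
    also have "\<dots> = ennreal (A1 B * (2 / c))" using A1[OF B] c by (intro ennreal_mult[symmetric]) auto
    finally show ?thesis .
  qed
  define c0 where "c0 = E0 + C0 + mass * a * (2 / c)"
  define c1 where "c1 = mass / sqrt c * (2 / c)"
  have E0: "E0 \<ge> 0" using \<epsilon> D by (simp add: E0_def \<Phi>_def)
  show thesis
  proof (rule that[OF w])
    show "c0 \<ge> 0" "c1 \<ge> 0" using E0 C0 mass_nonneg a c by (auto simp: c0_def c1_def)
    fix B :: real assume B: "B \<ge> 0"
    have [measurable]: "floor_potential B \<in> borel_measurable borel"
      using continuous_floor_potential[OF B] by (rule borel_measurable_continuous_onI)
    have [measurable]: "(\<lambda>t. rel.potential t (w t)) \<in> borel_measurable borel"
      using w by (intro rel.measurable_potential) (simp add: rel.paths_def)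
    let ?V = "\<lambda>t. rel.potential t (w t) - ennreal (floor_potential B t)"
    have "(\<integral>\<^sup>+t\<in>{0..}. ?V t \<partial>lborel)
       \<le> (\<integral>\<^sup>+t. ?V t * indicator {0..\<epsilon>} t + ?V t * indicator {\<epsilon>..} t \<partial>lborel)"
      by (intro nn_integral_mono) (auto simp: indicator_def)
    also have "\<dots> = (\<integral>\<^sup>+t\<in>{0..\<epsilon>}. ?V t \<partial>lborel) + (\<integral>\<^sup>+t\<in>{\<epsilon>..}. ?V t \<partial>lborel)"
      by (rule nn_integral_add) measurable
    also have "\<dots> \<le> ennreal C0 + ennreal (A1 B * (2 / c))" by (intro add_mono start tail B)
    finally have "rel.reduced_action (floor_potential B) w {0..} \<le> ennreal E0 + (ennreal C0 + ennreal (A1 B * (2 / c)))"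
      unfolding rel.reduced_action_def using energy_w by (intro add_mono)
    also have "\<dots> = ennreal (E0 + (C0 + A1 B * (2 / c)))"
      using E0 C0 A1[OF B] c by simp
    also have "E0 + (C0 + A1 B * (2 / c)) = c0 + c1 * B"
      by (simp add: c0_def c1_def A1_def algebra_simps)
    finally show "rel.reduced_action (floor_potential B) w {0..} \<le> ennreal (c0 + c1 * B)" .
  qed
qed

lemma sublinear_local_minimizer:
  obtains w B where "rel.local_minimizer w" "w 0 = 0" "B \<ge> 0" "\<And>t. 0 \<le> t \<Longrightarrow> norm (w t) \<le> B * sqrt t"
proof -
  obtain w0 c0 c1 where w0: "w0 \<in> rel.paths" "c0 \<ge> 0" "c1 \<ge> 0"
    "\<And>B. B \<ge> 0 \<Longrightarrow> rel.reduced_action (floor_potential B) w0 {0..} \<le> ennreal (c0 + c1 * B)"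
    by (rule reference_path) (rule that)
  \<comment> \<open>As \<open>B \<ge> 1\<close>, expanding one factor of \<open>B^2\<close> shows
    that it dominates \<open>c0 + c1 * B\<close>: the bound on the growth closes up.\<close>
  define B where "B = 1 + c0 + c1"
  have B: "B \<ge> 1" using w0 by (simp add: B_def)
  have "c0 + c1 * B \<le> B\<^sup>2"
  proof -
    have "c0 * 1 \<le> c0 * B" using w0 B by (intro mult_left_mono) auto
    moreover have "B\<^sup>2 = B + c0 * B + c1 * B" by (simp add: B_def power2_eq_square algebra_simps)
    ultimately show ?thesis using B by linarith
  qed
  then have le: "rel.reduced_action (floor_potential B) w0 {0..} \<le> ennreal (B\<^sup>2)"
    using w0(4)[of B] B by (meson ennreal_leI order_trans zero_le_one)
  have meas: "floor_potential B \<in> borel_measurable borel"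
    using continuous_floor_potential[of B] B by (intro borel_measurable_continuous_onI) auto
  obtain w where w: "w \<in> rel.paths" "rel.reduced_action (floor_potential B) w {0..} \<le> ennreal (B\<^sup>2)"
    "\<And>g. g \<in> rel.paths \<Longrightarrow> rel.reduced_action (floor_potential B) w {0..} \<le> rel.reduced_action (floor_potential B) g {0..}"
    by (rule rel.minimizer_exists[OF meas w0(1) le]) (rule that)
  have w_0: "w 0 = 0" using w(1) by (simp add: rel.paths_def)
  have "energy w {0..} \<le> ennreal (B\<^sup>2)"
    using w(2) by (rule order_trans[rotated]) (simp add: rel.reduced_action_def)
  then have bound: "norm (w t) \<le> B * sqrt t" if "0 \<le> t" for t
    using norm_diff_le_sqrt_energy[of w "{0..}" B 0 t] that B w_0 by simp
  have "rel.local_minimizer w"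
  proof (rule rel.minimizer_imp_local_minimizer[OF meas w(1) _ w(3)])
    show "rel.reduced_action (floor_potential B) w {0..} < \<infinity>" using w(2) by (rule le_less_trans) simp
    show "ennreal (floor_potential B t) \<le> rel.potential t y" if "0 \<le> t" "norm (y - w t) \<le> 1" for t y
      using that B bound[OF that(1)] norm_triangle_sub[of y "w t"] by (intro floor_potential_le) auto
    show "(\<integral>\<^sup>+t\<in>{a..b}. ennreal (floor_potential B t) \<partial>lborel) < \<infinity>" for a b
    proof -
      have "(\<integral>\<^sup>+t\<in>{a..b}. ennreal (floor_potential B t) \<partial>lborel)
         \<le> (\<integral>\<^sup>+t\<in>{a..b}. ennreal mass \<partial>lborel)"
        using floor_potential_bounds[of B] B by (intro nn_integral_mono mult_right_mono ennreal_leI) auto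
      also have "\<dots> = ennreal mass * emeasure lborel {a..b}" by (simp add: nn_integral_cmult_indicator)
      also have "\<dots> < \<infinity>" by (cases "a \<le> b") (auto simp: ennreal_mult_less_top)
      finally show ?thesis .
    qed
  qed
  moreover have "0 \<le> B" using B by simp
  ultimately show ?thesis using that[OF _ w_0 _ bound] by blast
qed

end

section \<open>Hyperbolic motions\<close>

text \<open>The mean value inequality for \<open>f - t f' a\<close>. Read backwards, it bounds a
  velocity by a displacement and the oscillation of the velocity, and this is its use below.\<close>

lemma displacement_bound:
  fixes f :: "real \<Rightarrow> 'a::real_normed_vector"
  assumes "a \<le> b" "\<And>t. t \<in> {a..b} \<Longrightarrow> (f has_vector_derivative f' t) (at t within {a..b})"
    and "\<And>t. t \<in> {a..b} \<Longrightarrow> norm (f' t - f' a) \<le> K"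
  shows "norm (f b - f a - (b - a) *\<^sub>R f' a) \<le> K * (b - a)"
proof -
  have "norm ((f b - b *\<^sub>R f' a) - (f a - a *\<^sub>R f' a)) \<le> K * \<bar>b - a\<bar>"
  proof (rule has_vector_derivative_diff_bound)
    show "((\<lambda>t. f t - t *\<^sub>R f' a) has_vector_derivative f' t - f' a) (at t within {a..b})" if "t \<in> {a..b}" for t
      using assms(2)[OF that] by (auto intro!: derivative_eq_intros)
  qed (use assms in auto)
  then show ?thesis using assms(1) by (simp add: algebra_simps)
qed

lemma has_vector_derivative_Icc_imp_Ici:
  assumes "(f has_vector_derivative f') (at t within {a..b})" "0 \<le> a" "a \<le> t" "t < b" "a = 0 \<or> a < t"
  shows "(f has_vector_derivative f') (at t within {0..})"
proof -
  define S where "S = (if a = 0 then {..<b} else {a<..<b})"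
  have "at t within {a..b} = at t within {0..}"
    by (rule at_within_nhd[of t S]) (use assms(2-) in \<open>auto simp: S_def\<close>)
  then show ?thesis using assms(1) by simp
qed

lemma norm_attraction_le:
  assumes "0 \<le> \<mu>" "0 < r" "r \<le> norm (z - p)"
  shows "norm (attraction \<mu> p z) \<le> \<mu> / r\<^sup>2"
proof -
  have pos: "0 < norm (z - p)" using assms by linarith
  then have "norm (attraction \<mu> p z) = \<mu> / (norm (z - p))\<^sup>2"
    using assms by (simp add: attraction_def power2_eq_square power3_eq_cube)
  also have "\<dots> \<le> \<mu> / r\<^sup>2" using assms pos by (intro divide_left_mono power_mono) auto
  finally show ?thesis .
qed

context translated_centers
begin

text \<open>The velocity of \<open>w\<close> tends to 0 by comparison on \<open>{t..2 * t}\<close>: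
  a force of order \<open>1 / t^2\<close> changes \<open>w'\<close> there by at most
  \<open>M / t\<close>, while \<open>w\<close> itself moves by at most a multiple of
  \<open>sqrt t\<close>. Dividing by the length \<open>t\<close> leaves
  \<open>M / t + 3 * B / sqrt t\<close>.\<close>

lemma hyperbolic_motion:
  obtains z z' where "z 0 = x" "continuous_on UNIV z" "\<And>t i. 0 < t \<Longrightarrow> i \<in> I \<Longrightarrow> z t \<noteq> p i t"
    "\<And>t. 0 \<le> t \<Longrightarrow> \<forall>i\<in>I. z t \<noteq> p i t \<Longrightarrow> (z has_vector_derivative z' t) (at t within {0..})"
    "\<And>t. 0 \<le> t \<Longrightarrow> \<forall>i\<in>I. z t \<noteq> p i t \<Longrightarrow> (z' has_vector_derivative force t (z t)) (at t within {0..})"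
    "(z' \<longlongrightarrow> v) at_top" "((\<lambda>t. z t /\<^sub>R t) \<longlongrightarrow> v) at_top"
proof -
  obtain w B where w: "rel.local_minimizer w" "w 0 = 0" "B \<ge> 0" "\<And>t. 0 \<le> t \<Longrightarrow> norm (w t) \<le> B * sqrt t"
    by (rule sublinear_local_minimizer) (rule that)
  define z where "z t = x + t *\<^sub>R v + w t" for t
  define w' where "w' t = vector_derivative w (at t within {0..})" for t
  define z' where "z' t = v + w' t" for t
  have z_iff: "z t = p i t \<longleftrightarrow> w t = p i t - (x + t *\<^sub>R v)" for t i by (auto simp: z_def algebra_simps)
  have force_eq: "rel.force t (w t) = force t (z t)" for t
    unfolding rel.force_def force_def attraction_def by (simp add: z_def algebra_simps)
  have w_cont: "continuous_on UNIV w" using w(1) by (simp add: rel.local_minimizer_def)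
  have free: "z t \<noteq> p i t" if "0 < t" "i \<in> I" for t i
    using rel.local_minimizer_collision_free[OF w(1) that(2,1)] z_iff by simp
  have eqs: "(w has_vector_derivative w' t) (at t within {0..}) \<and>
      (w' has_vector_derivative force t (z t)) (at t within {0..})"
    if t: "0 \<le> t" "\<forall>i\<in>I. z t \<noteq> p i t" for t
  proof -
    define a b where "a = t / 2" and "b = t + 1"
    have ab: "0 \<le> a" "a \<le> t" "t < b" "a < b" "a = 0 \<or> a < t" using t by (auto simp: a_def b_def)
    have "w s \<noteq> p i s - (x + s *\<^sub>R v)" if "s \<in> {a..b}" "i \<in> I" for s i
      using free[of s i] bspec[OF t(2) that(2)] that t(1) z_iff[of s i] by (cases "s = 0") (auto simp: a_def)
    then obtain w1 where w1: "\<And>s. s \<in> {a..b} \<Longrightarrow> (w has_vector_derivative w1 s) (at s within {a..b})"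
      "\<And>s. s \<in> {a..b} \<Longrightarrow> (w1 has_vector_derivative rel.force s (w s)) (at s within {a..b})"
      using rel.local_minimizer_equation[OF w(1) ab(1) ab(4)] by blast
    have w1_Ici: "(w has_vector_derivative w1 s) (at s within {0..})" if "a \<le> s" "s < b" "a = 0 \<or> a < s" for s
      by (rule has_vector_derivative_Icc_imp_Ici[OF w1(1)]) (use that ab in auto)
    have w1_eq: "w' s = w1 s" if "a \<le> s" "s < b" "a = 0 \<or> a < s" for s
    proof -
      have "s islimpt {0..}"
        by (rule islimpt_subset[OF islimpt_greaterThanLessThan1[of s "s + 1"]]) (use that ab in auto)
      then have "at s within {0..} \<noteq> bot" by (simp add: trivial_limit_within)
      then show ?thesis unfolding w'_def by (rule vector_derivative_within) (rule w1_Ici[OF that])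
    qed
    define \<delta> where "\<delta> = (if a = 0 then b - t else min (t - a) (b - t))"
    have \<delta>: "\<delta> > 0" using ab by (auto simp: \<delta>_def)
    have "(w1 has_vector_derivative force t (z t)) (at t within {0..})"
      unfolding force_eq[symmetric] by (rule has_vector_derivative_Icc_imp_Ici[OF w1(2)]) (use ab in auto)
    then have "(w' has_vector_derivative force t (z t)) (at t within {0..})"
    proof (rule has_vector_derivative_transform_within[OF _ \<delta>])
      show "w1 s = w' s" if "s \<in> {0..}" "dist s t < \<delta>" for s
        using that ab by (intro w1_eq[symmetric]) (auto simp: \<delta>_def dist_real_def split: if_splits)
    qed (use t in auto)
    moreover have "(w has_vector_derivative w' t) (at t within {0..})"
      using w1_Ici[of t] w1_eq[of t] ab by simp
    ultimately show ?thesis by simp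
  qed
  define c where "c = norm v"
  have c: "c > 0" using v_nonzero by (simp add: c_def)
  have sqrt_lim: "((\<lambda>t. K / sqrt t) \<longlongrightarrow> 0) at_top" for K
    by (intro tendsto_divide_0[OF tendsto_const] filterlim_at_top_imp_at_infinity sqrt_at_top)
  have inv_lim: "((\<lambda>t. K / t) \<longlongrightarrow> 0) at_top" for K :: real
    by (intro tendsto_divide_0[OF tendsto_const] filterlim_at_top_imp_at_infinity filterlim_ident)
  define M where "M = 4 * mass / c\<^sup>2"
  have M: "M \<ge> 0" using mass_nonneg c by (simp add: M_def)
  \<comment> \<open>Eventually the bodies, the offset \<open>x\<close> and \<open>w\<close> together
    consume at most half of the distance \<open>c * t\<close>, so every centre is at least
    \<open>c * t / 2\<close> away.\<close>
  have "\<forall>\<^sub>F t in at_top. (R + norm x) / t + B / sqrt t < c / 2"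
  proof -
    have "((\<lambda>t. (R + norm x) / t + B / sqrt t) \<longlongrightarrow> 0 + 0) at_top" by (intro tendsto_add inv_lim sqrt_lim)
    then show ?thesis using c by (intro order_tendstoD) auto
  qed
  then obtain t1 where t1: "\<And>t. t \<ge> t1 \<Longrightarrow> (R + norm x) / t + B / sqrt t < c / 2"
    unfolding eventually_at_top_linorder by blast
  have force_le: "norm (force t (z t)) \<le> M / t\<^sup>2" if t: "t \<ge> max t1 1" for t
  proof -
    have t0: "t > 0" using t by simp
    have "R + norm x + B * sqrt t = t * ((R + norm x) / t + B / sqrt t)"
    proof -
      have "t / sqrt t = sqrt t" using t0 by (intro real_div_sqrt) simp
      moreover have "t * ((R + norm x) / t + B / sqrt t) = R + norm x + B * (t / sqrt t)"
        using t0 by (simp only: distrib_left) simp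
      ultimately show ?thesis by simp
    qed
    also have "\<dots> \<le> t * (c / 2)" using t1[of t] t t0 by (intro mult_left_mono) auto
    finally have small: "R + norm x + B * sqrt t \<le> c * t / 2" by (simp add: mult.commute)
    have "c * t / 2 \<le> norm (z t - p i t)" if i: "i \<in> I" for i
    proof -
      have "t *\<^sub>R v = (z t - p i t) - x - w t + p i t" by (simp add: z_def)
      then have "norm (t *\<^sub>R v) \<le> norm (z t - p i t) + norm x + norm (w t) + norm (p i t)"
        using norm_triangle_ineq[of "(z t - p i t) - x - w t" "p i t"]
          norm_triangle_ineq4[of "(z t - p i t) - x" "w t"] norm_triangle_ineq4[of "z t - p i t" x] by simp
      then show ?thesis using w(4)[of t] p_bounded[OF i, of t] small t0 by (simp add: c_def mult.commute)
    qed
    then have "norm (force t (z t)) \<le> (\<Sum>i\<in>I. m i / (c * t / 2)\<^sup>2)"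
      unfolding force_def norm_minus_cancel using c t0
      by (intro order_trans[OF norm_sum] sum_mono norm_attraction_le) (auto simp: m_nonneg)
    also have "\<dots> = (mass / 2) / (c * t / 2)\<^sup>2" by (simp add: mass_def sum_divide_distrib[symmetric] sum_distrib_left[symmetric])
    also have "\<dots> \<le> M / t\<^sup>2"
      using c t0 mass_nonneg by (simp add: M_def power_divide power_mult_distrib field_simps)
    finally show ?thesis .
  qed
  have w'_le: "norm (w' t) \<le> M / t + 3 * B / sqrt t" if t: "t \<ge> max t1 1" for t
  proof -
    have t0: "t > 0" using t by simp
    have E: "(w has_vector_derivative w' s) (at s within {t..2 * t})"
      "(w' has_vector_derivative force s (z s)) (at s within {t..2 * t})" if "s \<in> {t..2 * t}" for s
      using eqs[of s] free[of s] that t0 by (auto intro: has_vector_derivative_within_subset)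
    have "norm (w' s - w' t) \<le> M / t" if s: "s \<in> {t..2 * t}" for s
    proof -
      have "norm (w' s - w' t) \<le> M / t\<^sup>2 * \<bar>s - t\<bar>"
      proof (rule has_vector_derivative_diff_bound[OF _ E(2)])
        fix u assume u: "u \<in> {t..2 * t}"
        have "norm (force u (z u)) \<le> M / u\<^sup>2" using force_le[of u] u t by auto
        also have "\<dots> \<le> M / t\<^sup>2" using u t0 M by (intro divide_left_mono power_mono mult_pos_pos) auto
        finally show "norm (force u (z u)) \<le> M / t\<^sup>2" .
      qed (use s t0 in auto)
      also have "\<dots> \<le> M / t\<^sup>2 * t" using s t0 M by (intro mult_left_mono) auto
      also have "\<dots> = M / t" using t0 by (simp add: power2_eq_square)
      finally show ?thesis .
    qed
    then have "norm (w (2 * t) - w t - (2 * t - t) *\<^sub>R w' t) \<le> M / t * (2 * t - t)"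
      using E(1) t0 by (intro displacement_bound) auto
    then have "norm (w (2 * t) - w t - t *\<^sub>R w' t) \<le> M" using t0 by simp
    then have "norm (t *\<^sub>R w' t) \<le> M + norm (w (2 * t)) + norm (w t)"
      using norm_triangle_ineq4[of "w (2 * t) - w t" "w (2 * t) - w t - t *\<^sub>R w' t"]
        norm_triangle_ineq4[of "w (2 * t)" "w t"] by simp
    also have "\<dots> \<le> M + B * sqrt (2 * t) + B * sqrt t" using w(4)[of "2 * t"] w(4)[of t] t0 by simp
    also have "sqrt (2 * t) \<le> sqrt (4 * t)" using t0 by simp
    then have "B * sqrt (2 * t) \<le> B * (2 * sqrt t)" using w(3) by (intro mult_left_mono) (auto simp: real_sqrt_mult)
    finally have "t * norm (w' t) \<le> M + 3 * (B * sqrt t)" using t0 by simp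
    then have "norm (w' t) \<le> (M + 3 * (B * sqrt t)) / t" using t0 by (simp add: field_simps)
    also have "\<dots> = M / t + 3 * B * (sqrt t / t)" by (simp add: add_divide_distrib)
    also have "sqrt t / t = 1 / sqrt t" using t0 real_sqrt_mult_self[of t] by (simp add: field_simps)
    finally show ?thesis by simp
  qed
  have "(w' \<longlongrightarrow> 0) at_top"
  proof (rule Lim_null_comparison)
    show "\<forall>\<^sub>F t in at_top. norm (w' t) \<le> M / t + 3 * B / sqrt t"
      using w'_le unfolding eventually_at_top_linorder by blast
    show "((\<lambda>t. M / t + 3 * B / sqrt t) \<longlongrightarrow> 0) at_top"
      using tendsto_add[OF inv_lim[of M] sqrt_lim[of "3 * B"]] by simp
  qed
  then have lim1: "(z' \<longlongrightarrow> v) at_top"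
    unfolding z'_def using tendsto_add[OF tendsto_const[of v]] by fastforce
  have "((\<lambda>t. x /\<^sub>R t + w t /\<^sub>R t) \<longlongrightarrow> 0) at_top"
  proof (rule Lim_null_comparison)
    have "norm (x /\<^sub>R t + w t /\<^sub>R t) \<le> norm x / t + B / sqrt t" if "t \<ge> 1" for t
    proof -
      have "norm (w t) / t \<le> B * sqrt t / t" using w(4)[of t] that by (intro divide_right_mono) auto
      also have "\<dots> = B / sqrt t" using that real_sqrt_mult_self[of t] by (simp add: field_simps)
      finally show ?thesis using norm_triangle_ineq[of "x /\<^sub>R t" "w t /\<^sub>R t"] that by (simp add: divide_inverse mult.commute)
    qed
    then show "\<forall>\<^sub>F t in at_top. norm (x /\<^sub>R t + w t /\<^sub>R t) \<le> norm x / t + B / sqrt t"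
      unfolding eventually_at_top_linorder by blast
    show "((\<lambda>t. norm x / t + B / sqrt t) \<longlongrightarrow> 0) at_top"
      using tendsto_add[OF inv_lim[of "norm x"] sqrt_lim[of B]] by simp
  qed
  then have "((\<lambda>t. v + (x /\<^sub>R t + w t /\<^sub>R t)) \<longlongrightarrow> v + 0) at_top" by (intro tendsto_add tendsto_const)
  moreover have "\<forall>\<^sub>F t in at_top. v + (x /\<^sub>R t + w t /\<^sub>R t) = z t /\<^sub>R t"
    unfolding eventually_at_top_linorder
    by (intro exI[of _ 1]) (auto simp: z_def scaleR_right_distrib)
  ultimately have lim2: "((\<lambda>t. z t /\<^sub>R t) \<longlongrightarrow> v) at_top" by (simp add: tendsto_cong)
  show thesis
  proof (rule that[of z z', OF _ _ free _ _ lim1 lim2])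
    show "z 0 = x" by (simp add: z_def w(2))
    show "continuous_on UNIV z" unfolding z_def by (intro continuous_intros w_cont)
    show "(z has_vector_derivative z' t) (at t within {0..})" if t: "0 \<le> t" "\<forall>i\<in>I. z t \<noteq> p i t" for t
      unfolding z_def z'_def using eqs[OF t] by (auto intro!: derivative_eq_intros)
    show "(z' has_vector_derivative force t (z t)) (at t within {0..})" if t: "0 \<le> t" "\<forall>i\<in>I. z t \<noteq> p i t" for t
      unfolding z'_def using eqs[OF t] by (auto intro!: derivative_eq_intros)
  qed
qed

end

section \<open>From the periodic motion of the bodies to moving centres\<close>

lemma periodic_bounded:
  fixes f :: "real \<Rightarrow> 'a::real_normed_vector"
  assumes "T > 0" "\<And>t. f t = f (t + T)" "continuous_on UNIV f"
  obtains R where "R \<ge> 0" "\<And>t. norm (f t) \<le> R"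
proof -
  have per: "f (t + real n * T) = f t" for t n
  proof (induction n)
    case (Suc n)
    have "f (t + real (Suc n) * T) = f ((t + real n * T) + T)" by (simp add: algebra_simps)
    then show ?case using Suc assms(2)[of "t + real n * T"] by simp
  qed simp
  have "compact (f ` {0..T})" using assms(3) by (intro compact_continuous_image) (auto intro: continuous_on_subset)
  then obtain R where R: "\<And>t. t \<in> {0..T} \<Longrightarrow> norm (f t) \<le> R"
    using compact_imp_bounded bounded_iff by (metis imageI)
  have "norm (f t) \<le> R" for t
  proof -
    define k where "k = \<lfloor>t / T\<rfloor>"
    define s where "s = t - of_int k * T"
    have "of_int k \<le> t / T" "t / T < of_int k + 1" by (simp_all add: k_def)
    then have "s \<in> {0..T}" using assms(1) by (auto simp: s_def field_simps)
    moreover have "f t = f s"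
    proof (cases "k \<ge> 0")
      case True
      then show ?thesis using per[of s "nat k"] by (simp add: s_def)
    next
      case False
      then show ?thesis using per[of t "nat (- k)"] by (simp add: s_def)
    qed
    ultimately show ?thesis using R by simp
  qed
  moreover from this[of 0] have "R \<ge> 0" by (meson norm_ge_zero order_trans)
  ultimately show ?thesis using that by blast
qed

text \<open>For \<open>\<sigma> = -1\<close> the past is the future of the reversed bodies; the
  equation is of second order, so \<open>\<sigma>\<close> enters it squared. Periodicity bounds the
  positions by \<open>R\<close>, the separation \<open>d\<close> bounds the accelerations by
  \<open>C\<close>, and both together bound the velocities.\<close>

lemma one_sided_hyperbolic_solution:
  fixes q :: "nat \<Rightarrow> real \<Rightarrow> complex" and \<sigma> \<tau> :: real and x v :: complex
  assumes m: "\<And>i. i \<in> {1..N} \<Longrightarrow> m i > 0" and nb: "n_body_solution N m q"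
    and per: "periodic_motion N q" and cf: "collision_free_motion N q" and v: "v \<noteq> 0"
    and \<sigma>: "\<sigma> = 1 \<and> F = at_top \<and> D = {\<tau>..} \<or> \<sigma> = -1 \<and> F = at_bot \<and> D = {..\<tau>}"
  shows "\<exists>\<gamma>. restricted_solution N m q D \<gamma> \<and> hyperbolic F D \<gamma> \<and> \<gamma> \<tau> = x \<and>
    ((\<lambda>t. \<gamma> t / of_real (norm (\<gamma> t))) \<longlongrightarrow> v / of_real (norm v)) F \<and>
    (velocity D \<gamma> \<longlongrightarrow> \<sigma> *\<^sub>R v) F \<and> (\<forall>t\<in>D - {\<tau>}. collision_free_at N q \<gamma> t)"
proof -
  let ?I = "{1..N}"
  have \<sigma>2: "\<sigma> * \<sigma> = 1" "\<bar>\<sigma>\<bar> = 1" using \<sigma> by auto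
  define X where "X = {norm (q i t - q j t) | i j t. i \<in> ?I \<and> j \<in> ?I \<and> i \<noteq> j}"
  define d where "d = Inf X"
  have d: "d > 0" using cf by (simp add: collision_free_motion_def d_def X_def)
  have sep: "d \<le> norm (q i t - q j t)" if "i \<in> ?I" "j \<in> ?I" "i \<noteq> j" for i j t
    unfolding d_def
  proof (rule cInf_lower)
    show "bdd_below X" by (rule bdd_belowI[of _ 0]) (auto simp: X_def)
  qed (use that in \<open>auto simp: X_def\<close>)
  define V where "V i = velocity UNIV (q i)" for i
  have q_deriv: "(q i has_vector_derivative V i t) (at t)" if "i \<in> ?I" for i t
    using nb that by (auto simp: n_body_solution_def has_acceleration_def V_def velocity_def vector_derivative_works)
  define A where "A i t = - (\<Sum>j\<in>?I - {i}. attraction (m j) (q j t) (q i t))" for i t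
  have V_deriv: "(V i has_vector_derivative A i t) (at t)" if "i \<in> ?I" for i t
    using nb that by (auto simp: n_body_solution_def has_acceleration_def V_def A_def)
  have m_nonneg: "0 \<le> m i" if "i \<in> ?I" for i using m[OF that] by simp
  define C where "C = (\<Sum>j\<in>?I. m j / d\<^sup>2)"
  have C: "C \<ge> 0" unfolding C_def by (intro sum_nonneg divide_nonneg_nonneg m_nonneg) auto
  have A_le: "norm (A i t) \<le> C" if "i \<in> ?I" for i t
  proof -
    have "norm (A i t) \<le> (\<Sum>j\<in>?I - {i}. m j / d\<^sup>2)"
      unfolding A_def norm_minus_cancel
      by (intro order_trans[OF norm_sum] sum_mono norm_attraction_le m_nonneg sep d that) auto
    also have "\<dots> \<le> C" unfolding C_def by (intro sum_mono2 divide_nonneg_nonneg m_nonneg) auto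
    finally show ?thesis .
  qed
  have V_Lip: "norm (V i t - V i s) \<le> C * \<bar>t - s\<bar>" if "i \<in> ?I" for i t s
    by (rule has_vector_derivative_diff_bound[of UNIV _ "A i"]) (use V_deriv A_le that in auto)
  have "\<exists>R\<ge>0. \<forall>t. norm (q i t) \<le> R" if i: "i \<in> ?I" for i
  proof -
    obtain T where "T > 0" "\<And>t. q i t = q i (t + T)" using per i unfolding periodic_motion_def by blast
    moreover have "continuous_on UNIV (q i)"
      using q_deriv[OF i] by (meson continuous_at_imp_continuous_on has_vector_derivative_continuous)
    ultimately show ?thesis using periodic_bounded[of T "q i"] by blast
  qed
  then obtain Ri where Ri: "\<And>i. i \<in> ?I \<Longrightarrow> Ri i \<ge> 0" "\<And>i t. i \<in> ?I \<Longrightarrow> norm (q i t) \<le> Ri i" by metis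
  define R where "R = (\<Sum>i\<in>?I. Ri i)"
  have R: "R \<ge> 0" unfolding R_def using Ri by (intro sum_nonneg) auto
  have q_le: "norm (q i t) \<le> R" if "i \<in> ?I" for i t
    using Ri(2)[OF that, of t] member_le_sum[OF that, of Ri] Ri(1) unfolding R_def by fastforce
  \<comment> \<open>Over a unit of time the displacement is at most \<open>2 * R\<close>, and it
    differs from the initial velocity by at most the bound \<open>C\<close> on the
    acceleration.\<close>
  have V_le: "norm (V i t) \<le> 2 * R + C" if i: "i \<in> ?I" for i t
  proof -
    have "norm (q i (t + 1) - q i t - (t + 1 - t) *\<^sub>R V i t) \<le> C * (t + 1 - t)"
    proof (rule displacement_bound)
      show "norm (V i s - V i t) \<le> C" if "s \<in> {t..t + 1}" for s
        using V_Lip[OF i, of s t] that C mult_left_mono[of "\<bar>s - t\<bar>" 1 C] by auto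
    qed (use q_deriv[OF i] in \<open>auto intro: has_vector_derivative_at_within\<close>)
    then show ?thesis
      using q_le[OF i, of t] q_le[OF i, of "t + 1"] norm_triangle_ineq4[of "q i (t + 1)" "q i t"]
        norm_triangle_ineq4[of "q i (t + 1) - q i t" "q i (t + 1) - q i t - V i t"] by simp
  qed
  interpret translated_centers ?I m "\<lambda>i s. q i (\<tau> + \<sigma> * s)" "\<lambda>i s. \<sigma> *\<^sub>R V i (\<tau> + \<sigma> * s)" "2 * R + C" C d R x v
  proof
    show "((\<lambda>s. q i (\<tau> + \<sigma> * s)) has_vector_derivative \<sigma> *\<^sub>R V i (\<tau> + \<sigma> * s)) (at s)" if "i \<in> ?I" for i s
    proof -
      have "((\<lambda>s. \<tau> + \<sigma> * s) has_vector_derivative \<sigma>) (at s)" by (auto intro!: derivative_eq_intros)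
      from vector_diff_chain_at[OF this q_deriv[OF that]] show ?thesis by (simp add: o_def)
    qed
    show "norm (\<sigma> *\<^sub>R V i (\<tau> + \<sigma> * t) - \<sigma> *\<^sub>R V i (\<tau> + \<sigma> * s)) \<le> C * \<bar>t - s\<bar>" if "i \<in> ?I" for i t s
    proof -
      have "norm (\<sigma> *\<^sub>R V i (\<tau> + \<sigma> * t) - \<sigma> *\<^sub>R V i (\<tau> + \<sigma> * s)) = norm (V i (\<tau> + \<sigma> * t) - V i (\<tau> + \<sigma> * s))"
        using \<sigma>2 by (simp add: scaleR_diff_right[symmetric])
      also have "\<dots> \<le> C * \<bar>(\<tau> + \<sigma> * t) - (\<tau> + \<sigma> * s)\<bar>" by (rule V_Lip[OF that])
      also have "\<bar>(\<tau> + \<sigma> * t) - (\<tau> + \<sigma> * s)\<bar> = \<bar>t - s\<bar>" using \<sigma> by auto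
      finally show ?thesis .
    qed
  qed (use m V_le \<sigma>2 sep d R C q_le v in auto)
  obtain z z' where z: "z 0 = x" "continuous_on UNIV z" "\<And>t i. 0 < t \<Longrightarrow> i \<in> ?I \<Longrightarrow> z t \<noteq> q i (\<tau> + \<sigma> * t)"
    and z_deriv: "\<And>t. 0 \<le> t \<Longrightarrow> \<forall>i\<in>?I. z t \<noteq> q i (\<tau> + \<sigma> * t) \<Longrightarrow> (z has_vector_derivative z' t) (at t within {0..})"
    and z'_deriv: "\<And>t. 0 \<le> t \<Longrightarrow> \<forall>i\<in>?I. z t \<noteq> q i (\<tau> + \<sigma> * t) \<Longrightarrow> (z' has_vector_derivative force t (z t)) (at t within {0..})"
    and z_lim: "(z' \<longlongrightarrow> v) at_top" "((\<lambda>t. z t /\<^sub>R t) \<longlongrightarrow> v) at_top"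
    by (rule hyperbolic_motion) (rule that)
  define \<phi> where "\<phi> t = \<sigma> * (t - \<tau>)" for t
  have \<phi>_inv: "\<tau> + \<sigma> * \<phi> t = t" for t using \<sigma> by (auto simp: \<phi>_def)
  have \<phi>_D: "t \<in> D \<longleftrightarrow> 0 \<le> \<phi> t" for t using \<sigma> by (auto simp: \<phi>_def)
  have \<phi>_\<tau>: "\<phi> t = 0 \<longleftrightarrow> t = \<tau>" for t using \<sigma> by (auto simp: \<phi>_def)
  have \<phi>_image: "\<phi> ` D \<subseteq> {0..}" using \<phi>_D by auto
  have \<phi>_deriv: "(\<phi> has_vector_derivative \<sigma>) (at t within D)" for t
    unfolding \<phi>_def by (auto intro!: derivative_eq_intros)
  have \<phi>_lim: "filterlim \<phi> at_top F"
    using \<sigma>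
  proof
    assume *: "\<sigma> = 1 \<and> F = at_top \<and> D = {\<tau>..}"
    have "filterlim (\<lambda>t. - \<tau> + t) at_top at_top"
      by (rule filterlim_tendsto_add_at_top[OF tendsto_const filterlim_ident])
    then show ?thesis using * by (simp add: \<phi>_def[abs_def])
  next
    assume *: "\<sigma> = -1 \<and> F = at_bot \<and> D = {..\<tau>}"
    have "filterlim (\<lambda>t. \<tau> + - t) at_top at_bot"
      by (rule filterlim_tendsto_add_at_top[OF tendsto_const filterlim_uminus_at_top_at_bot])
    then show ?thesis using * by (simp add: \<phi>_def[abs_def])
  qed
  define \<gamma> where "\<gamma> t = z (\<phi> t)" for t
  define \<gamma>' where "\<gamma>' t = \<sigma> *\<^sub>R z' (\<phi> t)" for t
  have free_iff: "collision_free_at N q \<gamma> t \<longleftrightarrow> (\<forall>i\<in>?I. z (\<phi> t) \<noteq> q i (\<tau> + \<sigma> * \<phi> t))" for t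
    by (simp only: collision_free_at_def \<gamma>_def \<phi>_inv)
  have free: "collision_free_at N q \<gamma> t" if "0 < \<phi> t" for t
    unfolding free_iff using z(3) that by blast
  have chain: "((\<lambda>t. f (\<phi> t)) has_vector_derivative \<sigma> *\<^sub>R f') (at t within D)"
    if "(f has_vector_derivative f') (at (\<phi> t) within {0..})" for f :: "real \<Rightarrow> complex" and f' t
    using vector_diff_chain_within[OF \<phi>_deriv has_vector_derivative_within_subset[OF that \<phi>_image]] by (simp add: o_def)
  have \<gamma>_deriv: "(\<gamma> has_vector_derivative \<gamma>' t) (at t within D)" if "t \<in> D" "collision_free_at N q \<gamma> t" for t
    unfolding \<gamma>_def[abs_def] \<gamma>'_def using that free_iff \<phi>_D by (intro chain z_deriv) auto
  have "force (\<phi> t) (z (\<phi> t)) = - (\<Sum>i\<in>?I. attraction (m i) (q i t) (\<gamma> t))" for t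
    by (simp only: force_def \<phi>_inv \<gamma>_def)
  then have \<gamma>'_deriv: "(\<gamma>' has_vector_derivative - (\<Sum>i\<in>?I. attraction (m i) (q i t) (\<gamma> t))) (at t within D)"
    if "t \<in> D" "collision_free_at N q \<gamma> t" for t
  proof -
    have "((\<lambda>t. z' (\<phi> t)) has_vector_derivative \<sigma> *\<^sub>R force (\<phi> t) (z (\<phi> t))) (at t within D)"
      using that free_iff \<phi>_D by (intro chain z'_deriv) auto
    then have "((\<lambda>t. \<sigma> *\<^sub>R z' (\<phi> t)) has_vector_derivative \<sigma> *\<^sub>R \<sigma> *\<^sub>R force (\<phi> t) (z (\<phi> t))) (at t within D)"
      by (auto intro!: derivative_eq_intros)
    then show ?thesis using \<open>force (\<phi> t) (z (\<phi> t)) = _\<close> \<sigma>2(1) by (simp add: \<gamma>'_def[abs_def])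
  qed
  have not_bot: "at t within D \<noteq> bot" if "t \<in> D" for t
  proof -
    have "t islimpt D"
      using \<sigma>
    proof
      assume "\<sigma> = 1 \<and> F = at_top \<and> D = {\<tau>..}"
      then show ?thesis using that by (intro islimpt_subset[OF islimpt_greaterThanLessThan1[of t "t + 1"]]) auto
    next
      assume "\<sigma> = -1 \<and> F = at_bot \<and> D = {..\<tau>}"
      then show ?thesis using that by (intro islimpt_subset[OF islimpt_greaterThanLessThan2[of "t - 1" t]]) auto
    qed
    then show ?thesis by (simp add: trivial_limit_within)
  qed
  have velocity_eq: "velocity D \<gamma> t = \<gamma>' t" if "t \<in> D" "collision_free_at N q \<gamma> t" for t
    unfolding velocity_def by (rule vector_derivative_within[OF not_bot[OF that(1)] \<gamma>_deriv[OF that]])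
  have acc: "has_acceleration D \<gamma> (- (\<Sum>i\<in>?I. attraction (m i) (q i t) (\<gamma> t))) t"
    if t: "t \<in> D" "collision_free_at N q \<gamma> t" for t
    unfolding has_acceleration_def
  proof
    show "\<gamma> differentiable (at t within D)" using \<gamma>_deriv[OF t] by (rule differentiableI_vector)
    \<comment> \<open>\<open>velocity\<close> is known to equal \<open>\<gamma>'\<close> only at
      collision-free times, so the neighbourhood must avoid \<open>\<tau>\<close>, where a collision
      is allowed, unless \<open>t = \<tau>\<close> is itself collision-free.\<close>
    define \<delta> where "\<delta> = (if t = \<tau> then 1 else \<bar>t - \<tau>\<bar>)"
    show "(velocity D \<gamma> has_vector_derivative - (\<Sum>i\<in>?I. attraction (m i) (q i t) (\<gamma> t))) (at t within D)"
    proof (rule has_vector_derivative_transform_within[OF \<gamma>'_deriv[OF t], of \<delta>])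
      show "\<delta> > 0" by (simp add: \<delta>_def)
      fix s assume s: "s \<in> D" "dist s t < \<delta>"
      have "collision_free_at N q \<gamma> s"
      proof (cases "s = \<tau>")
        case True
        then have "t = \<tau>" using s(2) by (auto simp: \<delta>_def dist_real_def split: if_splits)
        then show ?thesis using t True by simp
      next
        case False
        then show ?thesis using s(1) \<phi>_D[of s] \<phi>_\<tau>[of s] by (intro free) auto
      qed
      then show "\<gamma>' s = velocity D \<gamma> s" using velocity_eq s by simp
    qed (use t in auto)
  qed
  have "continuous_on D \<gamma>"
    unfolding \<gamma>_def \<phi>_def by (rule continuous_on_compose2[OF z(2)]) (auto intro!: continuous_intros)
  then have sol: "restricted_solution N m q D \<gamma>" using acc by (simp add: restricted_solution_def)
  have late: "\<forall>\<^sub>F t in F. 0 < \<phi> t" using \<phi>_lim by (simp add: filterlim_at_top_dense)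
  have "((\<lambda>t. \<gamma>' t) \<longlongrightarrow> \<sigma> *\<^sub>R v) F"
    unfolding \<gamma>'_def by (intro tendsto_scaleR tendsto_const filterlim_compose[OF z_lim(1) \<phi>_lim])
  moreover have "\<forall>\<^sub>F t in F. \<gamma>' t = velocity D \<gamma> t"
    using late by eventually_elim (use velocity_eq free \<phi>_D in force)
  ultimately have vel: "(velocity D \<gamma> \<longlongrightarrow> \<sigma> *\<^sub>R v) F" by (rule Lim_transform_eventually)
  have quot: "((\<lambda>t. \<gamma> t /\<^sub>R \<phi> t) \<longlongrightarrow> v) F"
    unfolding \<gamma>_def using filterlim_compose[OF z_lim(2) \<phi>_lim] by simp
  have nv: "norm v > 0" using v by simp
  have "((\<lambda>t. (\<gamma> t /\<^sub>R \<phi> t) / of_real (norm (\<gamma> t /\<^sub>R \<phi> t))) \<longlongrightarrow> v / of_real (norm v)) F"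
    by (intro tendsto_divide tendsto_of_real tendsto_norm quot) (use v in simp)
  \<comment> \<open>In both time directions \<open>\<phi> t\<close> is eventually positive, so
    dividing by it leaves the direction unchanged; this is why the limit is \<open>+v\<close> in the
    past as well, although the velocity tends to \<open>-v\<close>.\<close>
  moreover have "\<forall>\<^sub>F t in F. (\<gamma> t /\<^sub>R \<phi> t) / of_real (norm (\<gamma> t /\<^sub>R \<phi> t)) = \<gamma> t / of_real (norm (\<gamma> t))"
    using late
  proof eventually_elim
    case (elim t)
    have "norm (\<gamma> t /\<^sub>R \<phi> t) = norm (\<gamma> t) / \<phi> t" using elim by (simp add: divide_inverse mult.commute)
    then show ?case using elim by (simp only: of_real_divide scaleR_conv_of_real of_real_inverse) (simp add: divide_inverse)
  qed
  ultimately have dir: "((\<lambda>t. \<gamma> t / of_real (norm (\<gamma> t))) \<longlongrightarrow> v / of_real (norm v)) F"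
    by (rule Lim_transform_eventually)
  have grow: "filterlim (\<lambda>t. norm (\<gamma> t /\<^sub>R \<phi> t) * \<phi> t) at_top F"
    by (rule filterlim_tendsto_pos_mult_at_top[OF tendsto_norm[OF quot] nv \<phi>_lim])
  have "\<forall>\<^sub>F t in F. norm (\<gamma> t /\<^sub>R \<phi> t) * \<phi> t = norm (\<gamma> t)"
    using late by eventually_elim simp
  from iffD1[OF filterlim_cong[OF refl refl this] grow]
  have "filterlim (\<lambda>t. norm (\<gamma> t)) at_top F" .
  moreover have "((\<lambda>t. norm (velocity D \<gamma> t)) \<longlongrightarrow> norm v) F"
    using tendsto_norm[OF vel] \<sigma>2 by simp
  ultimately have hyp: "hyperbolic F D \<gamma>" unfolding hyperbolic_def using nv by blast
  have "\<gamma> \<tau> = x" by (simp add: \<gamma>_def \<phi>_def z(1))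
  moreover have "\<forall>t\<in>D - {\<tau>}. collision_free_at N q \<gamma> t"
    using free \<phi>_D \<phi>_\<tau> by (metis DiffE insertI1 order_le_less)
  ultimately show ?thesis using sol hyp dir vel by blast
qed

theorem theorem1p1:
  fixes N :: nat and m :: "nat \<Rightarrow> real" and q :: "nat \<Rightarrow> real \<Rightarrow> complex"
    and h \<theta>p \<theta>m t\<^sub>x :: real and x :: complex
  assumes "N \<ge> 2"
    and "\<And>i. i \<in> {1..N} \<Longrightarrow> m i > 0"
    and "n_body_solution N m q"
    and "periodic_motion N q"
    and "collision_free_motion N q"
    and "h > 0"
    and "\<theta>p \<in> {0..<2 * pi}"
    and "\<theta>m \<in> {0..<2 * pi}"
  shows "\<exists>\<gamma>p \<gamma>m :: real \<Rightarrow> complex.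
      (restricted_solution N m q {t\<^sub>x..} \<gamma>p \<and> hyperbolic at_top {t\<^sub>x..} \<gamma>p \<and>
       \<gamma>p t\<^sub>x = x \<and>
       ((\<lambda>t. \<gamma>p t / of_real (norm (\<gamma>p t))) \<longlongrightarrow> exp (\<i> * of_real \<theta>p)) at_top \<and>
       (velocity {t\<^sub>x..} \<gamma>p \<longlongrightarrow> of_real (sqrt (2 * h)) * exp (\<i> * of_real \<theta>p)) at_top \<and>
       (\<forall>t>t\<^sub>x. collision_free_at N q \<gamma>p t)) \<and>
      (restricted_solution N m q {..t\<^sub>x} \<gamma>m \<and> hyperbolic at_bot {..t\<^sub>x} \<gamma>m \<and>
       \<gamma>m t\<^sub>x = x \<and>
       ((\<lambda>t. \<gamma>m t / of_real (norm (\<gamma>m t))) \<longlongrightarrow> exp (\<i> * of_real \<theta>m)) at_bot \<and>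
       (velocity {..t\<^sub>x} \<gamma>m \<longlongrightarrow> - of_real (sqrt (2 * h)) * exp (\<i> * of_real \<theta>m)) at_bot \<and>
       (\<forall>t<t\<^sub>x. collision_free_at N q \<gamma>m t))"
proof -
  define v where "v \<theta> = complex_of_real (sqrt (2 * h)) * exp (\<i> * of_real \<theta>)" for \<theta> :: real
  have n: "norm (v \<theta>) = sqrt (2 * h)" for \<theta> using assms(6) by (simp add: v_def norm_mult)
  have v: "v \<theta> \<noteq> 0" "v \<theta> / of_real (norm (v \<theta>)) = exp (\<i> * of_real \<theta>)" for \<theta>
    unfolding n using assms(6) by (simp_all add: v_def)
  note sol = one_sided_hyperbolic_solution[OF assms(2-5) v(1), where x = x and \<tau> = t\<^sub>x]
  obtain \<gamma>p where p: "restricted_solution N m q {t\<^sub>x..} \<gamma>p" "hyperbolic at_top {t\<^sub>x..} \<gamma>p" "\<gamma>p t\<^sub>x = x"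
    "((\<lambda>t. \<gamma>p t / of_real (norm (\<gamma>p t))) \<longlongrightarrow> exp (\<i> * of_real \<theta>p)) at_top"
    "(velocity {t\<^sub>x..} \<gamma>p \<longlongrightarrow> 1 *\<^sub>R v \<theta>p) at_top" "\<forall>t\<in>{t\<^sub>x..} - {t\<^sub>x}. collision_free_at N q \<gamma>p t"
    using sol[of 1 at_top "{t\<^sub>x..}" \<theta>p] unfolding v(2) by blast
  obtain \<gamma>m where m: "restricted_solution N m q {..t\<^sub>x} \<gamma>m" "hyperbolic at_bot {..t\<^sub>x} \<gamma>m" "\<gamma>m t\<^sub>x = x"
    "((\<lambda>t. \<gamma>m t / of_real (norm (\<gamma>m t))) \<longlongrightarrow> exp (\<i> * of_real \<theta>m)) at_bot"
    "(velocity {..t\<^sub>x} \<gamma>m \<longlongrightarrow> (-1) *\<^sub>R v \<theta>m) at_bot" "\<forall>t\<in>{..t\<^sub>x} - {t\<^sub>x}. collision_free_at N q \<gamma>m t"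
    using sol[of "-1" at_bot "{..t\<^sub>x}" \<theta>m] unfolding v(2) by blast
  show ?thesis
    using p m by (intro exI[of _ \<gamma>p] exI[of _ \<gamma>m]) (auto simp: v_def)
qed

end
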